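(* Let $\tau:E\to\mathbb{R}$ be a bundle with $\dim E=n+1$. Let $h$ be a section of the line bundle $\rho:T^*E\to J^1\tau^*$ and let $X_h$ be the corresponding Hamiltonian vector field on $J^1\tau^*$. Let $R$ be a type $(1,1)$ tensor field on $E$ such that (i) $R(dt)=0$, (ii) the Nijenhuis torsion $N_R$ vanishes, (iii) $R$ is algebraically diagonalizable with distinct eigenvalues. Let $\widetilde{R}$ be the complete lift of $R$ to $J^1\tau^*$, and assume that the $n+1$ vector fields $X_h,\widetilde{R}(X_h),\ldots,\widetilde{R}^n(X_h)$ are linearly independent. Let $\omega_R=dR^h$, where $R^h$ is the horizontal lift of $R$ to $J^1\tau^*$, and let $$\mathcal{D}_h=\mathrm{sp}\{X_h,\widetilde{R}(X_h),\ldots,\widetilde{R}^n(X_h)\}.$$ Then: (1) $\mathcal{D}_h$ is Lagrangian with respect to the presymplectic form $\omega_R$, i.e. $\mathcal{D}_h$ coincides with its $\omega_R$-orthogonal complement. (2) $\mathcal{D}_h$ is integrable provided that $(\mathcal{L}_{X_h}\omega_R)\big|_{\mathcal{D}_h}=0$, i.e. $(\mathcal{L}_{X_h}\omega_R)(X,Y)=0$ for all $X,Y\in\mathcal{D}_h$. (3) In Darboux-Nijenhuis coordinates $(t,Q^i,P_i)$ on $J^1\tau^*$, with $K(t,Q,P)$ the local Hamiltonian function representing $h$ in these coordinates, the condition $(\mathcal{L}_{X_h}\omega_R)\big|_{\mathcal{D}_h}=0$ is equivalent to Forbat's separability conditions (no summation over repeated indices) $$\frac{\partial K}{\partial P_i}\left(\frac{\partial^2K}{\partial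 Q^i\partial Q^j}\frac{\partial K}{\partial P_j}-\frac{\partial^2K}{\partial Q^i\partial P_j}\frac{\partial K}{\partial Q^j}\right)=\frac{\partial K}{\partial Q^i}\left(\frac{\partial^2K}{\partial P_i\partial Q^j}\frac{\partial K}{\partial P_j}-\frac{\partial^2K}{\partial P_i\partial P_j}\frac{\partial K}{\partial Q^j}\right)\quad (i\neq j),$$ $$\frac{\partial K}{\partial P_i}\frac{\partial^2K}{\partial Q^i\partial t}=\frac{\partial K}{\partial Q^i}\frac{\partial^2K}{\partial P_i\partial t},\qquad i,j=1,\ldots,n,$$ which are the necessary and sufficient conditions known from Forbat for separability of the time-dependent Hamilton-Jacobi equation $\partial S/\partial t+K(t,Q^i,\partial S/\partial Q^i)=0$ in the coordinates $(t,Q^i)$.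
   Context: Setting: all objects are smooth. $E$ has bundle coordinates $(t,q^i)$, $i=1,\ldots,n$, where $t$ is the (pulled-back) coordinate of $\mathbb{R}$; admissible coordinate changes are $(t,q)\mapsto(t,Q(t,q))$. $T^*E$ has natural coordinates $(t,q^i,p_0,p_i)$, canonical 1-form $\theta_E=p_0dt+p_idq^i$ and symplectic form $\omega_E=d\theta_E$. $J^1\tau^*:=T^*E/\langle dt\rangle$ (the dual of the first jet bundle), with coordinates $(t,q^i,p_i)$; $\rho:T^*E\to J^1\tau^*$ and $\pi:J^1\tau^*\to E$ are the natural projections. Hamiltonian: a section $h$ of $\rho$ is locally $h:(t,q,p)\mapsto(t,q,p_0=-H(t,q,p),p)$. $X_h$ is the vector field on $J^1\tau^*$ defined by $i_{X_h}h^*\omega_E=0$, $\langle X_h,dt\rangle=1$; locally $X_h=\frac{\partial}{\partial t}+\frac{\partial H}{\partial p_i}\frac{\partial}{\partial q^i}-\frac{\partial H}{\partial q^i}\frac{\partial}{\partial p_i}$. Tensor $R$: a $(1,1)$ tensor acts on vector fields and on 1-forms, with $\langle X,R(\alpha)\rangle=\langle R(X),\alpha\rangle$. If $R(dt)=0$, then $R=R^i_j(t,q)\frac{\partial}{\partial q^i}\otimes dq^j+R^i_0(t,q)\frac{\partial}{\partial q^i}\otimes dt$. "Algebraically diagonalizable with distinct eigenvalues" means that at each $e\in E$ the endomorphism $R_e$ of $T_eE$ is diagonalizable with $n+1$ distinct eigenvalues; one of them is $0$, so the others, $\lambda_1,\ldots,\lambda_n$, are nonzero. $N_R(X,Y)=[RX,RY]+R^2[X,Y]-R[RX,Y]-R[X,RY]$.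 Complete lifts: $\tau_R:T^*E\to T^*E$ is the fibre linear map $(t,q^i,p_0,p_i)\mapsto(t,q^i,R^i_0p_i,R^i_jp_i)$. The complete lift $\widetilde{R}_{T^*}$ of $R$ to $T^*E$ is defined by $i_{\widetilde{R}_{T^*}(Z)}d\theta_E=i_Z(\tau_R^*d\theta_E)$ for all vector fields $Z$ on $T^*E$. The complete lift $\widetilde{R}$ to $J^1\tau^*$ is the $(1,1)$ tensor that is $\rho$-related to $\widetilde{R}_{T^*}$ (if $Y$ is $\rho$-related to $X$, then $\widetilde{R}_{T^*}(Y)$ is $\rho$-related to $\widetilde{R}(X)$); in coordinates $$\widetilde{R}=R^i_j\Big(\tfrac{\partial}{\partial q^i}\otimes dq^j+\tfrac{\partial}{\partial p_j}\otimes dp_i\Big)+R^i_0\tfrac{\partial}{\partial q^i}\otimes dt+p_i\Big(\tfrac{\partial R^i_j}{\partial q^k}-\tfrac{\partial R^i_k}{\partial q^j}\Big)\tfrac{\partial}{\partial p_j}\otimes dq^k+p_i\Big(\tfrac{\partial R^i_k}{\partial t}-\tfrac{\partial R^i_0}{\partial q^k}\Big)\tfrac{\partial}{\partial p_k}\otimes dt.$$ Horizontal lift: $R^h$ is the 1-form on $J^1\tau^*$ given by $\langle X_m,R^h_m\rangle=\langle T\pi(X_m),R_{\pi(m)}(m)\rangle$, $m\in J^1\tau^*$ (well defined since $R(dt)=0$); in coordinates $R^h=p_iR^i_jdq^j+p_iR^i_0dt$. Under the assumptions $\omega_R=dR^h$ is closed of maximal rank $2n$ (presymplectic). Darboux-Nijenhuis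 coordinates: it is known that under (i)-(iii) there exist local coordinates $(t,Q^i)$ on $E$, obtained by a transformation $(t,q)\mapsto(t,Q(t,q))$, in which $R=\sum_{i=1}^n\lambda_i(Q^i)\frac{\partial}{\partial Q^i}\otimes dQ^i$, each $\lambda_i$ depending at most on $Q^i$. The induced coordinates $(t,Q^i,P_i)$ on $J^1\tau^*$, with $P_i=p_l\,\partial q^l/\partial Q^i$, are Darboux-Nijenhuis coordinates; in them $\widetilde{R}=\sum_i\lambda_i(Q^i)\big(\frac{\partial}{\partial Q^i}\otimes dQ^i+\frac{\partial}{\partial P_i}\otimes dP_i\big)$. The function $K$ is determined by $h:(t,Q,P)\mapsto(t,Q,P_0=-K(t,Q,P),P)$, i.e. $K=H-p_l\,\partial q^l/\partial t$ expressed in the new variables. *)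

theory Defs
  imports "HOL-Analysis.Analysis"
begin

section \<open>Calculus on open subsets of Euclidean spaces\<close>

abbreviation der :: "('a::real_normed_vector \<Rightarrow> 'b::real_normed_vector) \<Rightarrow> 'a \<Rightarrow> 'a \<Rightarrow> 'b"
  where "der f x \<equiv> frechet_derivative f (at x)"

text \<open>Meant for open sets: derivatives are taken in the ambient space.\<close>

primrec Ck_on :: "nat \<Rightarrow> 'a::euclidean_space set \<Rightarrow> ('a \<Rightarrow> 'b::real_normed_vector) \<Rightarrow> bool" where
  "Ck_on 0 S f \<longleftrightarrow> continuous_on S f"
| "Ck_on (Suc k) S f \<longleftrightarrow>
     (\<forall>x\<in>S. f differentiable (at x)) \<and> (\<forall>v. Ck_on k S (\<lambda>x. der f x v))"

definition smooth_on :: "'a::euclidean_space set \<Rightarrow> ('a \<Rightarrow> 'b::real_normed_vector) \<Rightarrow> bool"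
  where "smooth_on S f \<longleftrightarrow> (\<forall>k. Ck_on k S f)"

definition local_diffeo_on :: "'a::euclidean_space set \<Rightarrow> ('a \<Rightarrow> 'a) \<Rightarrow> bool" where
  "local_diffeo_on S f \<longleftrightarrow>
     (\<forall>x\<in>S. \<exists>W. open W \<and> x \<in> W \<and> W \<subseteq> S \<and> smooth_on W f \<and> inj_on f W \<and>
        open (f ` W) \<and> smooth_on (f ` W) (inv_into W f))"

definition lie_bracket ::
  "('a::euclidean_space \<Rightarrow> 'a) \<Rightarrow> ('a \<Rightarrow> 'a) \<Rightarrow> 'a \<Rightarrow> 'a"
  where "lie_bracket X Y x = der Y x (X x) - der X x (Y x)"

text \<open>Exterior derivative of a 1-form: \<open>d\<alpha>(u,v) = u(\<alpha>(v)) - v(\<alpha>(u))\<close> for constant fields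
  \<open>u\<close>, \<open>v\<close>.\<close>

definition ext_d ::
  "('a::euclidean_space \<Rightarrow> 'a \<Rightarrow> real) \<Rightarrow> 'a \<Rightarrow> 'a \<Rightarrow> 'a \<Rightarrow> real"
  where "ext_d \<alpha> x u v = der (\<lambda>y. \<alpha> y v) x u - der (\<lambda>y. \<alpha> y u) x v"

definition pullback2 ::
  "('a::euclidean_space \<Rightarrow> 'b::euclidean_space) \<Rightarrow> ('b \<Rightarrow> 'b \<Rightarrow> 'b \<Rightarrow> real)
     \<Rightarrow> 'a \<Rightarrow> 'a \<Rightarrow> 'a \<Rightarrow> real"
  where "pullback2 f \<omega> x u v = \<omega> (f x) (der f x u) (der f x v)"

text \<open>The formula
  \<open>(L\<^sub>X\<omega>)(u,v) = X(\<omega>(u,v)) - \<omega>([X,u],v) - \<omega>(u,[X,v])\<close>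
  for constant fields \<open>u\<close>, \<open>v\<close>, for which \<open>[X,u] = - DX(u)\<close>.\<close>

definition lie_deriv2 ::
  "('a::euclidean_space \<Rightarrow> 'a) \<Rightarrow> ('a \<Rightarrow> 'a \<Rightarrow> 'a \<Rightarrow> real) \<Rightarrow> 'a \<Rightarrow> 'a \<Rightarrow> 'a \<Rightarrow> real"
  where "lie_deriv2 X \<omega> x u v =
    der (\<lambda>y. \<omega> y u v) x (X x) + \<omega> x (der X x u) v + \<omega> x u (der X x v)"

text \<open>A (1,1) tensor field is a function \<open>R\<close> such that \<open>R x\<close> is an endomorphism of the tangent
  space at \<open>x\<close>.\<close>

definition nijenhuis ::
  "('a::euclidean_space \<Rightarrow> 'a \<Rightarrow> 'a) \<Rightarrow> ('a \<Rightarrow> 'a) \<Rightarrow> ('a \<Rightarrow> 'a) \<Rightarrow> 'a \<Rightarrow> 'a"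
  where "nijenhuis R X Y x =
    lie_bracket (\<lambda>y. R y (X y)) (\<lambda>y. R y (Y y)) x
    + R x (R x (lie_bracket X Y x))
    - R x (lie_bracket (\<lambda>y. R y (X y)) Y x)
    - R x (lie_bracket X (\<lambda>y. R y (Y y)) x)"

text \<open>The basis \<open>B\<close> has \<open>DIM('a)\<close> elements, so there are \<open>DIM('a)\<close> distinct eigenvalues.\<close>

definition diagonalizable_distinct :: "('a::euclidean_space \<Rightarrow> 'a) \<Rightarrow> bool" where
  "diagonalizable_distinct L \<longleftrightarrow>
     (\<exists>B \<mu>. independent B \<and> span B = UNIV \<and> (\<forall>b\<in>B. L b = \<mu> b *\<^sub>R b) \<and> inj_on \<mu> B)"

text \<open>\<open>f\<close> embeds the open set \<open>W\<close> as a submanifold of \<open>S\<close> whose tangent space at each of its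
  points is the given distribution.\<close>

definition integral_submanifold ::
  "'b::euclidean_space set \<Rightarrow> ('b \<Rightarrow> 'b set) \<Rightarrow> 'a::euclidean_space set \<Rightarrow> ('a \<Rightarrow> 'b) \<Rightarrow> bool"
  where "integral_submanifold S \<D> W f \<longleftrightarrow>
    open W \<and> smooth_on W f \<and> f ` W \<subseteq> S \<and> (\<exists>g. homeomorphism W (f ` W) f g) \<and>
    (\<forall>w\<in>W. inj (der f w) \<and> range (der f w) = \<D> (f w))"


section \<open>Bundles over the real line\<close>

text \<open>
  Coordinates: \<open>(t,q)\<close> on \<open>E\<close>; \<open>((t,q),(p\<^sub>0,p))\<close> on the cotangent bundle of \<open>E\<close>;
  \<open>((t,q),p)\<close> on the dual of the first jet bundle (the cotangent bundle modulo \<open>dt\<close>).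
  The dimension \<open>n\<close> of the fibres of \<open>E\<close> is \<open>CARD('n)\<close>.  A covector is given by its components,
  and its pairing with a vector is the inner product.
\<close>

type_synonym 'n base = "real \<times> (real ^ 'n)"
type_synonym 'n cot = "'n base \<times> 'n base"
type_synonym 'n jet = "'n base \<times> (real ^ 'n)"
type_synonym ('e, 'n) chart = "'e set \<times> ('e \<Rightarrow> 'n base)"

abbreviation cdom :: "('e, 'n) chart \<Rightarrow> 'e set"
  where "cdom c \<equiv> fst c"

definition cinv :: "('e, 'n) chart \<Rightarrow> 'n base \<Rightarrow> 'e"
  where "cinv c = inv_into (fst c) (snd c)"

definition cimg :: "('e, 'n) chart \<Rightarrow> 'n base set"
  where "cimg c = snd c ` fst c"

definition jdom :: "('e, 'n) chart \<Rightarrow> 'n jet set"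
  where "jdom c = cimg c \<times> UNIV"

definition overlap :: "('e, 'n) chart \<Rightarrow> ('e, 'n) chart \<Rightarrow> 'n base set"
  where "overlap c d = snd c ` (fst c \<inter> fst d)"

definition trans_map :: "('e, 'n) chart \<Rightarrow> ('e, 'n) chart \<Rightarrow> 'n base \<Rightarrow> 'n base"
  where "trans_map c d = snd d \<circ> cinv c"

definition adapted_chart ::
  "('e::topological_space \<Rightarrow> real) \<Rightarrow> ('e, 'n::finite) chart \<Rightarrow> bool"
  where "adapted_chart \<tau> c \<longleftrightarrow>
    open (cdom c) \<and> open (cimg c) \<and> homeomorphism (cdom c) (cimg c) (snd c) (cinv c) \<and>
    (\<forall>e\<in>cdom c. fst (snd c e) = \<tau> e)"

definition compatible :: "('e, 'n::finite) chart \<Rightarrow> ('e, 'n) chart \<Rightarrow> bool"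
  where "compatible c d \<longleftrightarrow>
    smooth_on (overlap c d) (trans_map c d) \<and> smooth_on (overlap d c) (trans_map d c)"

text \<open>Around each \<open>t\<^sub>0\<close>, \<open>\<tau>\<close> is a product over an open set \<open>I\<close>, via a diffeomorphism
  \<open>e \<mapsto> (\<tau> e, \<Phi> e)\<close> of \<open>\<tau> -` I\<close> onto the product of \<open>I\<close> with the fibre over \<open>t\<^sub>0\<close>.\<close>

definition locally_trivial ::
  "('e::topological_space \<Rightarrow> real) \<Rightarrow> ('e, 'n::finite) chart set \<Rightarrow> bool"
  where "locally_trivial \<tau> A \<longleftrightarrow>
    (\<forall>t\<^sub>0. \<exists>I \<Phi>. open I \<and> t\<^sub>0 \<in> I \<and>
       bij_betw (\<lambda>e. (\<tau> e, \<Phi> e)) (\<tau> -` I) (I \<times> (\<tau> -` {t\<^sub>0})) \<and>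
       (\<forall>c\<in>A. \<forall>d\<in>A. local_diffeo_on {x \<in> cimg c. fst x \<in> I \<and> \<Phi> (cinv c x) \<in> cdom d}
          (\<lambda>x. (fst x, snd (snd d (\<Phi> (cinv c x)))))))"

text \<open>\<open>A\<close> is the maximal atlas of bundle charts; its transition maps are of the form
  \<open>(t,q) \<mapsto> (t, Q(t,q))\<close> since the first component of every chart is \<open>\<tau>\<close>.\<close>

definition bundle_over_R ::
  "('e::topological_space \<Rightarrow> real) \<Rightarrow> ('e, 'n::finite) chart set \<Rightarrow> bool"
  where "bundle_over_R \<tau> A \<longleftrightarrow>
    surj \<tau> \<and> (\<forall>c\<in>A. adapted_chart \<tau> c) \<and> (\<Union>c\<in>A. cdom c) = UNIV \<and>
    (\<forall>c\<in>A. \<forall>d\<in>A. compatible c d) \<and>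
    (\<forall>c. adapted_chart \<tau> c \<and> (\<forall>d\<in>A. compatible c d) \<longrightarrow> c \<in> A) \<and>
    locally_trivial \<tau> A"

text \<open>A geometric object is given by its representatives in all charts of \<open>A\<close>, subject to the
  transformation law; a tensor field of type (1,1):\<close>

definition tensor11_field ::
  "('e, 'n::finite) chart set \<Rightarrow> (('e, 'n) chart \<Rightarrow> 'n base \<Rightarrow> 'n base \<Rightarrow> 'n base) \<Rightarrow> bool"
  where "tensor11_field A R \<longleftrightarrow>
    (\<forall>c\<in>A. (\<forall>x\<in>cimg c. linear (R c x)) \<and> (\<forall>v. smooth_on (cimg c) (\<lambda>x. R c x v))) \<and>
    (\<forall>c\<in>A. \<forall>d\<in>A. \<forall>x\<in>overlap c d. \<forall>v.
       der (trans_map c d) x (R c x v) = R d (trans_map c d x) (der (trans_map c d) x v))"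

text \<open>\<open>R(\<alpha>)\<close> for a covector \<open>\<alpha>\<close> is \<open>adjoint (R x) \<alpha>\<close>.\<close>

definition dt :: "'n::finite base"
  where "dt = (1, 0)"


section \<open>The cotangent bundle, the dual of the jet bundle, and Hamiltonian sections\<close>

text \<open>The natural projection of the cotangent bundle modulo \<open>dt\<close>.\<close>

definition rho :: "'n::finite cot \<Rightarrow> 'n jet"
  where "rho z = (fst z, snd (snd z))"

text \<open>Natural coordinates with respect to \<open>c\<close> and \<open>d\<close> of the same covector, resp. of the same
  class of covectors modulo \<open>dt\<close>.\<close>

definition same_cot :: "('e, 'n::finite) chart \<Rightarrow> ('e, 'n) chart \<Rightarrow> 'n cot \<Rightarrow> 'n cot \<Rightarrow> bool"
  where "same_cot c d z z' \<longleftrightarrow>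
    fst z \<in> overlap c d \<and> fst z' = trans_map c d (fst z) \<and>
    snd z = adjoint (der (trans_map c d) (fst z)) (snd z')"

definition same_jet :: "('e, 'n::finite) chart \<Rightarrow> ('e, 'n) chart \<Rightarrow> 'n jet \<Rightarrow> 'n jet \<Rightarrow> bool"
  where "same_jet c d m m' \<longleftrightarrow> (\<exists>z z'. rho z = m \<and> rho z' = m' \<and> same_cot c d z z')"

definition section_of_rho ::
  "('e, 'n::finite) chart set \<Rightarrow> (('e, 'n) chart \<Rightarrow> 'n jet \<Rightarrow> 'n cot) \<Rightarrow> bool"
  where "section_of_rho A h \<longleftrightarrow>
    (\<forall>c\<in>A. smooth_on (jdom c) (h c) \<and> (\<forall>m\<in>jdom c. rho (h c m) = m)) \<and>
    (\<forall>c\<in>A. \<forall>d\<in>A. \<forall>m m'. same_jet c d m m' \<longrightarrow> same_cot c d (h c m) (h d m'))"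

text \<open>\<open>h (t,q,p) = (t, q, p\<^sub>0 = - H(t,q,p), p)\<close>.\<close>

definition hamiltonian :: "('n::finite jet \<Rightarrow> 'n cot) \<Rightarrow> 'n jet \<Rightarrow> real"
  where "hamiltonian h m = - fst (snd (h m))"

definition theta :: "'n::finite cot \<Rightarrow> 'n cot \<Rightarrow> real"
  where "theta z w = snd z \<bullet> fst w"

definition omegaE :: "'n::finite cot \<Rightarrow> 'n cot \<Rightarrow> 'n cot \<Rightarrow> real"
  where "omegaE = ext_d theta"

definition ham_field :: "('n::finite jet \<Rightarrow> 'n cot) \<Rightarrow> 'n jet \<Rightarrow> 'n jet"
  where "ham_field h m =
    (THE v. (\<forall>w. pullback2 h omegaE m v w = 0) \<and> fst v \<bullet> dt = 1)"


section \<open>Lifts of a tensor field\<close>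

definition tauR :: "('n::finite base \<Rightarrow> 'n base \<Rightarrow> 'n base) \<Rightarrow> 'n cot \<Rightarrow> 'n cot"
  where "tauR R z = (fst z, adjoint (R (fst z)) (snd z))"

definition complete_lift_cot ::
  "('n::finite base \<Rightarrow> 'n base \<Rightarrow> 'n base) \<Rightarrow> 'n cot \<Rightarrow> 'n cot \<Rightarrow> 'n cot"
  where "complete_lift_cot R z w =
    (THE u. \<forall>w'. omegaE z u w' = pullback2 (tauR R) omegaE z w w')"

text \<open>The tensor field that is \<open>rho\<close>-related to \<open>complete_lift_cot R\<close>.\<close>

definition complete_lift ::
  "('n::finite base \<Rightarrow> 'n base \<Rightarrow> 'n base) \<Rightarrow> 'n jet \<Rightarrow> 'n jet \<Rightarrow> 'n jet"
  where "complete_lift R m v =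
    (THE u. \<forall>z w. rho z = m \<and> der rho z w = v \<longrightarrow> der rho z (complete_lift_cot R z w) = u)"

text \<open>The class \<open>m\<close> is represented by the covector with components \<open>(0, p)\<close>; the choice is
  irrelevant when \<open>R(dt) = 0\<close>.  The derivative of the projection onto \<open>E\<close> is \<open>fst\<close>.\<close>

definition horizontal_lift ::
  "('n::finite base \<Rightarrow> 'n base \<Rightarrow> 'n base) \<Rightarrow> 'n jet \<Rightarrow> 'n jet \<Rightarrow> real"
  where "horizontal_lift R m v = fst v \<bullet> adjoint (R (fst m)) (0, snd m)"

definition omegaR ::
  "('n::finite base \<Rightarrow> 'n base \<Rightarrow> 'n base) \<Rightarrow> 'n jet \<Rightarrow> 'n jet \<Rightarrow> 'n jet \<Rightarrow> real"
  where "omegaR R = ext_d (horizontal_lift R)"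


section \<open>The distribution and the separability conditions\<close>

definition iterate_field ::
  "('n::finite base \<Rightarrow> 'n base \<Rightarrow> 'n base) \<Rightarrow> ('n jet \<Rightarrow> 'n cot) \<Rightarrow> 'n jet \<Rightarrow> nat \<Rightarrow> 'n jet"
  where "iterate_field R h m k = (complete_lift R m ^^ k) (ham_field h m)"

definition ham_distr ::
  "('n::finite base \<Rightarrow> 'n base \<Rightarrow> 'n base) \<Rightarrow> ('n jet \<Rightarrow> 'n cot) \<Rightarrow> 'n jet \<Rightarrow> 'n jet set"
  where "ham_distr R h m = span (iterate_field R h m ` {..CARD('n)})"

definition orth_complement :: "('a \<Rightarrow> 'a \<Rightarrow> real) \<Rightarrow> 'a set \<Rightarrow> 'a set"
  where "orth_complement \<omega> V = {u. \<forall>v\<in>V. \<omega> u v = 0}"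

definition lie_condition ::
  "('e, 'n::finite) chart \<Rightarrow> ('n base \<Rightarrow> 'n base \<Rightarrow> 'n base) \<Rightarrow> ('n jet \<Rightarrow> 'n cot) \<Rightarrow> bool"
  where "lie_condition c R h \<longleftrightarrow>
    (\<forall>m\<in>jdom c. \<forall>u\<in>ham_distr R h m. \<forall>v\<in>ham_distr R h m.
       lie_deriv2 (ham_field h) (omegaR R) m u v = 0)"

text \<open>\<open>R = \<Sum>\<^sub>i \<lambda>\<^sub>i(Q\<^sup>i) \<partial>/\<partial>Q\<^sup>i \<otimes> dQ\<^sup>i\<close> in the chart \<open>c\<close>.\<close>

definition darboux_nijenhuis ::
  "('e, 'n::finite) chart \<Rightarrow> ('n base \<Rightarrow> 'n base \<Rightarrow> 'n base) \<Rightarrow> bool"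
  where "darboux_nijenhuis c R \<longleftrightarrow>
    (\<exists>ev :: 'n \<Rightarrow> real \<Rightarrow> real. \<forall>x\<in>cimg c. \<forall>v.
       R x v = (0, \<chi> i. ev i (snd x $ i) * (snd v $ i)))"

definition pd_t :: "('n::finite jet \<Rightarrow> real) \<Rightarrow> 'n jet \<Rightarrow> real"
  where "pd_t f m = der f m ((1, 0), 0)"

definition pd_Q :: "'n \<Rightarrow> ('n::finite jet \<Rightarrow> real) \<Rightarrow> 'n jet \<Rightarrow> real"
  where "pd_Q i f m = der f m ((0, axis i 1), 0)"

definition pd_P :: "'n \<Rightarrow> ('n::finite jet \<Rightarrow> real) \<Rightarrow> 'n jet \<Rightarrow> real"
  where "pd_P i f m = der f m ((0, 0), axis i 1)"

definition forbat_conditions :: "'n jet set \<Rightarrow> ('n::finite jet \<Rightarrow> real) \<Rightarrow> bool"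
  where "forbat_conditions S K \<longleftrightarrow>
    (\<forall>m\<in>S.
      (\<forall>i j. i \<noteq> j \<longrightarrow>
         pd_P i K m * (pd_Q i (pd_Q j K) m * pd_P j K m - pd_Q i (pd_P j K) m * pd_Q j K m) =
         pd_Q i K m * (pd_P i (pd_Q j K) m * pd_P j K m - pd_P i (pd_P j K) m * pd_Q j K m)) \<and>
      (\<forall>i. pd_P i K m * pd_Q i (pd_t K) m = pd_Q i K m * pd_P i (pd_t K) m))"

end

theory Submission
  imports Defs
begin

text \<open>
  Everything happens inside one chart.  Put \<open>X\<^sub>a = N\<^sup>a X\<^sub>h\<close>, \<open>N\<close> the complete lift of \<open>R\<close>, and let
  \<open>d\<^sub>0\<close>, \<open>d\<^sub>1\<close>, \<open>d\<^sub>2\<close> be the exterior derivatives of the Poincare--Cartan form \<open>p dq - H dt\<close> and of the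
  horizontal lifts of \<open>R\<close> and \<open>R\<^sup>2\<close>.  If \<open>dt(u) = 0\<close> then \<open>d\<^sub>1(u,v) = d\<^sub>0(u,Nv)\<close>, and the vanishing of the
  torsion gives \<open>d\<^sub>2(u,v) = d\<^sub>1(u,Nv)\<close>.  Hence all \<open>d\<^sub>k(X\<^sub>a,X\<^sub>b)\<close> vanish, and the Lagrangian property
  is a dimension count.

  With \<open>B(a,b,l) = d\<^sub>0([X\<^sub>a,X\<^sub>b],X\<^sub>l)\<close>, closedness of \<open>d\<^sub>k\<close> reads
  \<open>B(a,b,l+k) + B(b,l,a+k) + B(l,a,b+k) = 0\<close>, while the hypothesis on the Lie derivative reads
  \<open>B(0,b,l+1) = B(0,l,b+1)\<close>.  These relations force \<open>B = 0\<close>, so the distribution is involutive, and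
  Frobenius' theorem applies.  The latter is proved by normalising the frame to a commuting one
  \<open>G\<close> and solving \<open>Df = G(f)\<close> by Picard iteration along rays: commutativity makes the defects
  \<open>Df\<^sub>k - G(f\<^sub>k)\<close> decay geometrically.

  In Darboux--Nijenhuis coordinates the distribution is spanned by \<open>\<partial>/\<partial>t\<close> and the vectors
  \<open>Z\<^sub>i = K\<^sub>P\<^sub>i \<partial>/\<partial>Q\<^sub>i - K\<^sub>Q\<^sub>i \<partial>/\<partial>P\<^sub>i\<close>; the Lie derivative takes on \<open>(Z\<^sub>i,Z\<^sub>j)\<close> the value
  \<open>\<lambda>\<^sub>i - \<lambda>\<^sub>j\<close> times the first Forbat expression, and on \<open>(Z\<^sub>i,\<partial>/\<partial>t)\<close> the value \<open>\<lambda>\<^sub>i\<close> times the second.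
\<close>

section \<open>Calculus of smooth maps\<close>

lemma der_eqI: "(f has_derivative f') (at x) \<Longrightarrow> der f x = f'"
  by (metis frechet_derivative_at)

lemma der_has_derivative: "f differentiable (at x) \<Longrightarrow> (f has_derivative der f x) (at x)"
  by (simp add: frechet_derivative_works)

lemma has_derivative_cong_open:
  assumes "open S" "x \<in> S" "\<And>y. y \<in> S \<Longrightarrow> f y = g y"
  shows "(f has_derivative D) (at x) \<longleftrightarrow> (g has_derivative D) (at x)"
  using assms by (metis (no_types, lifting) has_derivative_transform_within_open)

lemma der_cong_open:
  assumes "open S" "x \<in> S" "\<And>y. y \<in> S \<Longrightarrow> f y = g y"
  shows "der f x = der g x"
  unfolding frechet_derivative_def using has_derivative_cong_open[OF assms] by simp

lemma linear_der: "f differentiable (at x) \<Longrightarrow> linear (der f x)"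
  by (simp add: linear_frechet_derivative)

text \<open>\<open>Ck_on\<close> controls derivatives only in fixed directions; linearity reduces a
  direction that moves with the point to the finitely many basis directions.\<close>

lemma der_eq_sum_Basis:
  fixes f :: "'a::euclidean_space \<Rightarrow> 'b::real_normed_vector"
  assumes "f differentiable (at x)"
  shows "der f x v = (\<Sum>b\<in>Basis. (v \<bullet> b) *\<^sub>R der f x b)"
proof -
  interpret linear "der f x" by (rule linear_der[OF assms])
  have "der f x v = der f x (\<Sum>b\<in>Basis. (v \<bullet> b) *\<^sub>R b)"
    by (simp add: euclidean_representation)
  then show ?thesis by (simp add: sum scale)
qed

section \<open>Closure properties of maps of class C^k\<close>

lemma Ck_on_cong:
  fixes f g :: "'a::euclidean_space \<Rightarrow> 'b::real_normed_vector"
  assumes "open S" "\<And>x. x \<in> S \<Longrightarrow> f x = g x" "Ck_on k S f"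
  shows "Ck_on k S g"
  using assms(2,3)
proof (induction k arbitrary: f g)
  case 0
  then show ?case by (simp cong: continuous_on_cong)
next
  case (Suc k)
  have "g differentiable (at x)" if "x \<in> S" for x
    using Suc.prems(2) has_derivative_cong_open[OF assms(1) that, of f g] Suc.prems(1) that
    unfolding Ck_on.simps differentiable_def by blast
  moreover have "Ck_on k S (\<lambda>x. der g x v)" for v
    using Suc.IH[of "\<lambda>x. der f x v" "\<lambda>x. der g x v"] Suc.prems
      der_cong_open[OF assms(1), of _ f g] by auto
  ultimately show ?case by auto
qed

text \<open>Uniqueness of the derivative lets an explicit formula \<open>f'\<close> stand in for
  \<open>der f\<close>, so the inductions below can work with the product and chain rules
  directly.\<close>

lemma Ck_SucI:
  fixes f :: "'a::euclidean_space \<Rightarrow> 'b::real_normed_vector"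
  assumes "open S" "\<And>x. x \<in> S \<Longrightarrow> (f has_derivative f' x) (at x)"
    "\<And>v. Ck_on k S (\<lambda>x. f' x v)"
  shows "Ck_on (Suc k) S f"
proof -
  have "Ck_on k S (\<lambda>x. der f x v)" for v
    by (rule Ck_on_cong[OF assms(1) _ assms(3)[of v]]) (simp add: der_eqI[OF assms(2)])
  then show ?thesis
    using assms(2) by (auto simp: differentiable_def)
qed

lemma Ck_on_subset: "Ck_on k S f \<Longrightarrow> T \<subseteq> S \<Longrightarrow> Ck_on k T f"
  by (induction k arbitrary: f) (auto intro: continuous_on_subset)

lemma Ck_on_Suc_imp: "Ck_on (Suc k) S f \<Longrightarrow> Ck_on k S f"
proof (induction k arbitrary: f)
  case 0
  then show ?case
    by (auto intro!: differentiable_imp_continuous_on simp: differentiable_on_def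
        differentiable_at_withinI)
qed auto

lemma Ck_on_const: "Ck_on k S (\<lambda>x. c)"
  by (induction k arbitrary: c) (auto simp: frechet_derivative_const)

lemma Ck_on_bounded_linear:
  assumes "bounded_linear L" "open S" "Ck_on k S f"
  shows "Ck_on k S (\<lambda>x. L (f x))"
  using assms(3)
proof (induction k arbitrary: f)
  case 0
  then show ?case by (auto intro: bounded_linear.continuous_on[OF assms(1)])
next
  case (Suc k)
  show ?case
  proof (rule Ck_SucI[where f' = "\<lambda>x v. L (der f x v)"])
    show "((\<lambda>x. L (f x)) has_derivative (\<lambda>v. L (der f x v))) (at x)" if "x \<in> S" for x
      using Suc.prems that
      by (auto intro!: bounded_linear.has_derivative[OF assms(1)] der_has_derivative)
    show "Ck_on k S (\<lambda>x. L (der f x v))" for v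
      using Suc by auto
  qed (use assms in auto)
qed

lemma Ck_on_add:
  assumes "open S" "Ck_on k S f" "Ck_on k S g"
  shows "Ck_on k S (\<lambda>x. f x + g x)"
  using assms(2,3)
proof (induction k arbitrary: f g)
  case 0
  then show ?case by (auto intro: continuous_intros)
next
  case (Suc k)
  show ?case
  proof (rule Ck_SucI[where f' = "\<lambda>x v. der f x v + der g x v"])
    show "((\<lambda>x. f x + g x) has_derivative (\<lambda>v. der f x v + der g x v)) (at x)" if "x \<in> S" for x
      using Suc.prems that by (auto intro!: has_derivative_add der_has_derivative)
    show "Ck_on k S (\<lambda>x. der f x v + der g x v)" for v
      using Suc by auto
  qed (use assms in auto)
qed

lemma Ck_on_bilinear:
  assumes "bounded_bilinear B" "open S" "Ck_on k S f" "Ck_on k S g"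
  shows "Ck_on k S (\<lambda>x. B (f x) (g x))"
  using assms(3,4)
proof (induction k arbitrary: f g)
  case 0
  then show ?case by (auto intro: bounded_bilinear.continuous_on[OF assms(1)])
next
  case (Suc k)
  show ?case
  proof (rule Ck_SucI[where f' = "\<lambda>x v. B (f x) (der g x v) + B (der f x v) (g x)"])
    show "((\<lambda>x. B (f x) (g x)) has_derivative (\<lambda>v. B (f x) (der g x v) + B (der f x v) (g x))) (at x)"
      if "x \<in> S" for x
      using Suc.prems that
      by (auto intro!: bounded_bilinear.FDERIV[OF assms(1)] der_has_derivative)
    \<comment> \<open>The undifferentiated factors enter only in class \<open>k\<close>, one order
      below what is given.\<close>
    show "Ck_on k S (\<lambda>x. B (f x) (der g x v) + B (der f x v) (g x))" for v
      using Suc Ck_on_Suc_imp[of k S f] Ck_on_Suc_imp[of k S g]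
      by (intro Ck_on_add assms Suc.IH) auto
  qed (use assms in auto)
qed

lemma Ck_on_sum:
  assumes "open S" "\<And>i. i \<in> I \<Longrightarrow> Ck_on k S (f i)"
  shows "Ck_on k S (\<lambda>x. \<Sum>i\<in>I. f i x)"
  using assms(2) by (induction I rule: infinite_finite_induct)
    (auto intro: Ck_on_const Ck_on_add[OF assms(1)])

lemma Ck_on_id:
  assumes "open S"
  shows "Ck_on k S (\<lambda>x. x)"
proof (cases k)
  case 0
  then show ?thesis by (simp add: continuous_on_id)
next
  case (Suc k)
  then show ?thesis
    using Ck_SucI[of S "\<lambda>x. x" "\<lambda>x v. v" k] assms by (auto intro: Ck_on_const)
qed

lemma Ck_on_compose:
  fixes f :: "'a::euclidean_space \<Rightarrow> 'b::euclidean_space"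
    and g :: "'b \<Rightarrow> 'c::real_normed_vector"
  assumes "open S" "open T" "f ` S \<subseteq> T" "Ck_on k S f" "Ck_on k T g"
  shows "Ck_on k S (\<lambda>x. g (f x))"
  using assms(3-5)
proof (induction k arbitrary: f g)
  case 0
  then show ?case
    by (auto intro: continuous_on_compose2)
next
  case (Suc k)
  have f: "f differentiable (at x)" if "x \<in> S" for x
    using Suc.prems that by auto
  have g: "g differentiable (at (f x))" if "x \<in> S" for x
    using Suc.prems that by auto
  show ?case
  \<comment> \<open>The chain rule yields \<open>der g (f x)\<close> at the moving direction
    \<open>der f x v\<close>. Split over the basis, each summand is a component of
    \<open>der f\<close> times \<open>der g (f x) b\<close>, and the induction hypothesis applies to
    the latter.\<close>
  proof (rule Ck_SucI[where f' = "\<lambda>x v. \<Sum>b\<in>Basis. (der f x v \<bullet> b) *\<^sub>R der g (f x) b"])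
    show "((\<lambda>x. g (f x)) has_derivative (\<lambda>v. \<Sum>b\<in>Basis. (der f x v \<bullet> b) *\<^sub>R der g (f x) b)) (at x)"
      if "x \<in> S" for x
      using has_derivative_compose[OF der_has_derivative[OF f[OF that]]
          der_has_derivative[OF g[OF that]]]
      by (simp add: der_eq_sum_Basis[OF g[OF that], symmetric])
    show "Ck_on k S (\<lambda>x. \<Sum>b\<in>Basis. (der f x v \<bullet> b) *\<^sub>R der g (f x) b)" for v
    proof (intro Ck_on_sum Ck_on_bilinear[OF bounded_bilinear_scaleR] assms)
      fix b :: 'b assume "b \<in> Basis"
      show "Ck_on k S (\<lambda>x. der f x v \<bullet> b)"
        using Suc.prems by (intro Ck_on_bounded_linear[OF bounded_linear_inner_left] assms) auto
      show "Ck_on k S (\<lambda>x. der g (f x) b)"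
        using Suc.prems Ck_on_Suc_imp[of k S f] by (intro Suc.IH) auto
    qed
  qed (use assms in auto)
qed

section \<open>Smooth maps\<close>

lemma smooth_on_der: "smooth_on S f \<Longrightarrow> smooth_on S (\<lambda>x. der f x v)"
  unfolding smooth_on_def using Ck_on.simps(2) by blast

lemma smooth_on_differentiable: "smooth_on S f \<Longrightarrow> x \<in> S \<Longrightarrow> f differentiable (at x)"
  unfolding smooth_on_def using Ck_on.simps(2)[of 0 S f] by blast

lemma smooth_on_continuous: "smooth_on S f \<Longrightarrow> continuous_on S f"
  unfolding smooth_on_def using Ck_on.simps(1)[of S f] by blast

lemma smooth_on_has_derivative: "smooth_on S f \<Longrightarrow> x \<in> S \<Longrightarrow> (f has_derivative der f x) (at x)"
  by (simp add: smooth_on_differentiable der_has_derivative)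

lemma smooth_on_cong:
  "open S \<Longrightarrow> (\<And>x. x \<in> S \<Longrightarrow> f x = g x) \<Longrightarrow> smooth_on S f \<Longrightarrow> smooth_on S g"
  unfolding smooth_on_def using Ck_on_cong by blast

lemma smooth_on_subset: "smooth_on S f \<Longrightarrow> T \<subseteq> S \<Longrightarrow> smooth_on T f"
  unfolding smooth_on_def using Ck_on_subset by blast

lemma smooth_on_const: "smooth_on S (\<lambda>x. c)"
  unfolding smooth_on_def by (simp add: Ck_on_const)

lemma smooth_on_id: "open S \<Longrightarrow> smooth_on S (\<lambda>x. x)"
  unfolding smooth_on_def by (simp add: Ck_on_id)

lemma smooth_on_bounded_linear:
  "bounded_linear L \<Longrightarrow> open S \<Longrightarrow> smooth_on S f \<Longrightarrow> smooth_on S (\<lambda>x. L (f x))"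
  unfolding smooth_on_def by (simp add: Ck_on_bounded_linear)

lemma smooth_on_add:
  "open S \<Longrightarrow> smooth_on S f \<Longrightarrow> smooth_on S g \<Longrightarrow> smooth_on S (\<lambda>x. f x + g x)"
  unfolding smooth_on_def by (simp add: Ck_on_add)

lemma smooth_on_minus: "open S \<Longrightarrow> smooth_on S f \<Longrightarrow> smooth_on S (\<lambda>x. - f x)"
  by (rule smooth_on_bounded_linear[OF bounded_linear_minus[OF bounded_linear_ident]])

lemma smooth_on_diff:
  "open S \<Longrightarrow> smooth_on S f \<Longrightarrow> smooth_on S g \<Longrightarrow> smooth_on S (\<lambda>x. f x - g x)"
  using smooth_on_add[OF _ _ smooth_on_minus, of S f g] by simp

lemma smooth_on_bilinear:
  "bounded_bilinear B \<Longrightarrow> open S \<Longrightarrow> smooth_on S f \<Longrightarrow> smooth_on S g \<Longrightarrow>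
    smooth_on S (\<lambda>x. B (f x) (g x))"
  unfolding smooth_on_def by (simp add: Ck_on_bilinear)

lemmas smooth_on_scaleR = smooth_on_bilinear[OF bounded_bilinear_scaleR]
lemmas smooth_on_inner = smooth_on_bilinear[OF bounded_bilinear_inner]

lemma smooth_on_sum:
  "open S \<Longrightarrow> (\<And>i. i \<in> I \<Longrightarrow> smooth_on S (f i)) \<Longrightarrow> smooth_on S (\<lambda>x. \<Sum>i\<in>I. f i x)"
  unfolding smooth_on_def by (simp add: Ck_on_sum)

lemma smooth_on_compose:
  fixes f :: "'a::euclidean_space \<Rightarrow> 'b::euclidean_space"
  shows "open S \<Longrightarrow> open T \<Longrightarrow> f ` S \<subseteq> T \<Longrightarrow> smooth_on S f \<Longrightarrow> smooth_on T g \<Longrightarrow>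
    smooth_on S (\<lambda>x. g (f x))"
  unfolding smooth_on_def using Ck_on_compose by blast

text \<open>Smoothness of a tensor field is given through its values on fixed vectors; expanding
  \<open>w\<close> in the basis is the passage to vector fields.\<close>

lemma smooth_on_family_apply:
  fixes w :: "'a::euclidean_space \<Rightarrow> 'c::euclidean_space"
  assumes "open S" "\<And>x. x \<in> S \<Longrightarrow> linear (L x)" "\<And>v. smooth_on S (\<lambda>x. L x v)" "smooth_on S w"
  shows "smooth_on S (\<lambda>x. L x (w x))"
proof (rule smooth_on_cong[OF assms(1)])
  show "smooth_on S (\<lambda>x. \<Sum>b\<in>Basis. (w x \<bullet> b) *\<^sub>R L x b)"
    by (intro smooth_on_sum smooth_on_scaleR smooth_on_bounded_linear[OF bounded_linear_inner_left]
        assms)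
  show "(\<Sum>b\<in>Basis. (w x \<bullet> b) *\<^sub>R L x b) = L x (w x)" if "x \<in> S" for x
  proof -
    interpret linear "L x" by (rule assms(2)[OF that])
    have "L x (w x) = L x (\<Sum>b\<in>Basis. (w x \<bullet> b) *\<^sub>R b)"
      by (simp add: euclidean_representation)
    then show ?thesis by (simp add: sum scale)
  qed
qed

text \<open>The product rule for a family of linear maps whose dependence on the point is known only
  on fixed vectors, again through the basis expansion.\<close>

lemma has_derivative_family_apply:
  fixes w :: "'a::real_normed_vector \<Rightarrow> 'c::euclidean_space"
  assumes "open S" "\<And>x. x \<in> S \<Longrightarrow> linear (L x)" "x \<in> S"
    "\<And>v. (\<lambda>x. L x v) differentiable (at x)" "(w has_derivative w') (at x)"
  shows "((\<lambda>x. L x (w x)) has_derivative (\<lambda>u. der (\<lambda>y. L y (w x)) x u + L x (w' u))) (at x)"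
proof -
  have expand: "L y z = (\<Sum>b\<in>Basis. (z \<bullet> b) *\<^sub>R L y b)" if "y \<in> S" for y z
  proof -
    interpret linear "L y" by (rule assms(2)[OF that])
    have "L y z = L y (\<Sum>b\<in>Basis. (z \<bullet> b) *\<^sub>R b)"
      by (simp add: euclidean_representation)
    then show ?thesis by (simp add: sum scale)
  qed
  have d: "((\<lambda>y. \<Sum>b\<in>Basis. (w x \<bullet> b) *\<^sub>R L y b) has_derivative
      (\<lambda>u. \<Sum>b\<in>Basis. (w x \<bullet> b) *\<^sub>R der (\<lambda>y. L y b) x u)) (at x)"
    by (auto intro!: derivative_eq_intros der_has_derivative assms)
  have d': "der (\<lambda>y. L y (w x)) x = (\<lambda>u. \<Sum>b\<in>Basis. (w x \<bullet> b) *\<^sub>R der (\<lambda>y. L y b) x u)"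
    by (rule der_eqI, subst has_derivative_cong_open[OF assms(1,3) expand], assumption, rule d)
  have "((\<lambda>y. \<Sum>b\<in>Basis. (w y \<bullet> b) *\<^sub>R L y b) has_derivative
      (\<lambda>u. \<Sum>b\<in>Basis. (w x \<bullet> b) *\<^sub>R der (\<lambda>y. L y b) x u + (w' u \<bullet> b) *\<^sub>R L x b)) (at x)"
    by (intro has_derivative_sum has_derivative_scaleR has_derivative_inner_left assms
        der_has_derivative)
  then have "((\<lambda>y. L y (w y)) has_derivative
      (\<lambda>u. \<Sum>b\<in>Basis. (w x \<bullet> b) *\<^sub>R der (\<lambda>y. L y b) x u + (w' u \<bullet> b) *\<^sub>R L x b)) (at x)"
    using has_derivative_cong_open[OF assms(1,3), of "\<lambda>y. L y (w y)"
        "\<lambda>y. \<Sum>b\<in>Basis. (w y \<bullet> b) *\<^sub>R L y b", OF expand] by blast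
  moreover have "(\<Sum>b\<in>Basis. (w x \<bullet> b) *\<^sub>R der (\<lambda>y. L y b) x u + (w' u \<bullet> b) *\<^sub>R L x b)
      = der (\<lambda>y. L y (w x)) x u + L x (w' u)"
    for u
    unfolding expand[OF assms(3), of "w' u"] d' by (rule sum.distrib)
  ultimately show ?thesis by (simp only:)
qed

section \<open>Symmetry of second derivatives\<close>

text \<open>The mean value theorem is applied twice: first to the increment of \<open>f\<close>
  across \<open>h *\<^sub>R v\<close> as a function of the step along \<open>u\<close>, then to
  \<open>der f _ u\<close> along \<open>v\<close>.\<close>

lemma second_difference_mean_value:
  fixes f :: "'a::euclidean_space \<Rightarrow> real"
  assumes S: "\<And>s t. 0 \<le> s \<Longrightarrow> s \<le> h \<Longrightarrow> 0 \<le> t \<Longrightarrow> t \<le> h \<Longrightarrow> x + s *\<^sub>R u + t *\<^sub>R v \<in> S"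
    and f: "\<And>y. y \<in> S \<Longrightarrow> f differentiable (at y)"
    and f': "\<And>y. y \<in> S \<Longrightarrow> (\<lambda>z. der f z u) differentiable (at y)"
    and h: "0 < h"
  obtains s t where "0 \<le> s" "s \<le> h" "0 \<le> t" "t \<le> h"
    "f (x + h *\<^sub>R u + h *\<^sub>R v) - f (x + h *\<^sub>R u) - f (x + h *\<^sub>R v) + f x
      = h * h * der (\<lambda>z. der f z u) (x + s *\<^sub>R u + t *\<^sub>R v) v"
proof -
  define \<phi> where "\<phi> s = f (x + s *\<^sub>R u + h *\<^sub>R v) - f (x + s *\<^sub>R u)" for s
  have S0: "x + s *\<^sub>R u \<in> S" if "0 \<le> s" "s \<le> h" for s
    using S[of s 0] that h by simp
  have line: "((\<lambda>s. f (y + s *\<^sub>R u + c)) has_real_derivative der f (y + s *\<^sub>R u + c) u) (at s)"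
    if "y + s *\<^sub>R u + c \<in> S" for y c s
  proof -
    have "((\<lambda>s. y + s *\<^sub>R u + c) has_derivative (\<lambda>k. k *\<^sub>R u)) (at s)"
      by (auto intro!: derivative_eq_intros)
    from has_derivative_compose[OF this der_has_derivative[OF f[OF that]]]
    show ?thesis
      using linear_der[OF f[OF that]]
      by (simp add: has_field_derivative_def linear_cmul mult.commute[of "der f _ u"] cong: if_cong)
        (simp add: mult_commute_abs)
  qed
  have "(\<phi> has_real_derivative der f (x + s *\<^sub>R u + h *\<^sub>R v) u - der f (x + s *\<^sub>R u) u) (at s)"
    if "0 \<le> s" "s \<le> h" for s
    unfolding \<phi>_def
    using line[of x s "h *\<^sub>R v"] line[of x s 0] S[of s h] S0[of s] that h
    by (auto intro!: derivative_eq_intros)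
  from MVT2[OF h this] obtain s where s: "0 < s" "s < h"
    "\<phi> h - \<phi> 0 = h * (der f (x + s *\<^sub>R u + h *\<^sub>R v) u - der f (x + s *\<^sub>R u) u)"
    by auto
  define \<psi> where "\<psi> t = der f (x + s *\<^sub>R u + t *\<^sub>R v) u" for t
  have "(\<psi> has_real_derivative der (\<lambda>z. der f z u) (x + s *\<^sub>R u + t *\<^sub>R v) v) (at t)"
    if t: "0 \<le> t" "t \<le> h" for t
  proof -
    have y: "x + s *\<^sub>R u + t *\<^sub>R v \<in> S" using S s t by simp
    have "((\<lambda>t. x + s *\<^sub>R u + t *\<^sub>R v) has_derivative (\<lambda>k. k *\<^sub>R v)) (at t)"
      by (auto intro!: derivative_eq_intros)
    from has_derivative_compose[OF this der_has_derivative[OF f'[OF y]]]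
    show ?thesis
      using linear_der[OF f'[OF y]]
      by (simp add: has_field_derivative_def linear_cmul \<psi>_def[abs_def] mult_commute_abs)
  qed
  from MVT2[OF h this] obtain t where t: "0 < t" "t < h"
    "\<psi> h - \<psi> 0 = h * der (\<lambda>z. der f z u) (x + s *\<^sub>R u + t *\<^sub>R v) v"
    by auto
  show ?thesis
    by (rule that[of s t]) (use s t in \<open>auto simp: \<phi>_def \<psi>_def algebra_simps\<close>)
qed

text \<open>The second difference over a small parallelogram is symmetric in \<open>u\<close> and
  \<open>v\<close>, so the two mixed derivatives agree at two nearby points; continuity moves both
  points to \<open>x\<close>.\<close>

lemma der_der_commute_real:
  fixes f :: "'a::euclidean_space \<Rightarrow> real"
  assumes S: "open S" "x \<in> S" and f: "Ck_on 2 S f"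
  shows "der (\<lambda>y. der f y u) x v = der (\<lambda>y. der f y v) x u"
proof (rule ccontr)
  let ?g = "\<lambda>u v y. der (\<lambda>y. der f y u) y v"
  have d1: "f differentiable (at y)" and d2: "(\<lambda>z. der f z w) differentiable (at y)"
    if "y \<in> S" for y w
    using f that by (auto simp: numeral_2_eq_2)
  have cont: "continuous_on S (?g u v)" for u v
    using f by (auto simp: numeral_2_eq_2)
  assume ne: "?g u v x \<noteq> ?g v u x"
  \<comment> \<open>Half the supposed gap: two numbers, each within \<open>\<epsilon>\<close> of one
    of the mixed derivatives at \<open>x\<close>, cannot then coincide.\<close>
  define \<epsilon> where "\<epsilon> = \<bar>?g u v x - ?g v u x\<bar> / 2"
  have \<epsilon>: "\<epsilon> > 0" using ne by (simp add: \<epsilon>_def)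
  obtain d0 where d0: "d0 > 0" "ball x d0 \<subseteq> S" using S by (meson openE)
  obtain da where da: "da > 0" "\<And>y. y \<in> S \<Longrightarrow> dist y x < da \<Longrightarrow> dist (?g u v y) (?g u v x) < \<epsilon>"
    using cont[of u v] \<epsilon> S(2) unfolding continuous_on_iff by metis
  obtain db where db: "db > 0" "\<And>y. y \<in> S \<Longrightarrow> dist y x < db \<Longrightarrow> dist (?g v u y) (?g v u x) < \<epsilon>"
    using cont[of v u] \<epsilon> S(2) unfolding continuous_on_iff by metis
  define d where "d = min d0 (min da db)"
  define c where "c = norm u + norm v + 1"
  \<comment> \<open>This side length keeps the parallelogram within \<open>d / 2\<close> of
    \<open>x\<close>; the summand \<open>1\<close> in \<open>c\<close> prevents a division by zero
    when \<open>u\<close> and \<open>v\<close> are both zero.\<close>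
  define h where "h = d / c / 2"
  have c: "c > 0" by (smt (verit) c_def norm_ge_zero)
  have d: "d > 0" using d0 da db by (simp add: d_def)
  have h: "h > 0" using d c by (simp add: h_def)
  have near: "dist (x + s *\<^sub>R u + t *\<^sub>R v) x < d"
    if "0 \<le> s" "s \<le> h" "0 \<le> t" "t \<le> h" for s t
  proof -
    have "dist (x + s *\<^sub>R u + t *\<^sub>R v) x = norm (s *\<^sub>R u + t *\<^sub>R v)"
      by (simp add: dist_norm algebra_simps)
    also have "\<dots> \<le> s * norm u + t * norm v"
      using norm_triangle_ineq[of "s *\<^sub>R u" "t *\<^sub>R v"] that by simp
    also have "\<dots> \<le> h * norm u + h * norm v"
      using that by (intro add_mono mult_right_mono) auto
    also have "\<dots> \<le> h * c" using h by (simp add: c_def algebra_simps)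
    also have "\<dots> = d / 2" using c by (simp add: h_def)
    finally show ?thesis using d by simp
  qed
  have inS: "x + s *\<^sub>R u + t *\<^sub>R v \<in> S" "x + t *\<^sub>R v + s *\<^sub>R u \<in> S"
    if "0 \<le> s" "s \<le> h" "0 \<le> t" "t \<le> h" for s t
    using near[OF that] d0 by (auto simp: d_def dist_commute add.commute add.left_commute subset_iff)
  obtain s t where st: "0 \<le> s" "s \<le> h" "0 \<le> t" "t \<le> h"
    "f (x + h *\<^sub>R u + h *\<^sub>R v) - f (x + h *\<^sub>R u) - f (x + h *\<^sub>R v) + f x
      = h * h * ?g u v (x + s *\<^sub>R u + t *\<^sub>R v)"
    using second_difference_mean_value[OF inS(1) d1 d2 h] by blast
  obtain s' t' where st': "0 \<le> s'" "s' \<le> h" "0 \<le> t'" "t' \<le> h"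
    "f (x + h *\<^sub>R v + h *\<^sub>R u) - f (x + h *\<^sub>R v) - f (x + h *\<^sub>R u) + f x
      = h * h * ?g v u (x + s' *\<^sub>R v + t' *\<^sub>R u)"
    using second_difference_mean_value[OF inS(2) d1 d2 h] by blast
  have "h * h * ?g u v (x + s *\<^sub>R u + t *\<^sub>R v) = h * h * ?g v u (x + s' *\<^sub>R v + t' *\<^sub>R u)"
    unfolding st(5)[symmetric] st'(5)[symmetric] by (simp add: algebra_simps)
  then have "?g u v (x + s *\<^sub>R u + t *\<^sub>R v) = ?g v u (x + s' *\<^sub>R v + t' *\<^sub>R u)"
    using h by simp
  moreover have "dist (?g u v (x + s *\<^sub>R u + t *\<^sub>R v)) (?g u v x) < \<epsilon>"
    using near[OF st(1-4)] inS(1)[OF st(1-4)] by (intro da) (auto simp: d_def)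
  moreover have "dist (?g v u (x + s' *\<^sub>R v + t' *\<^sub>R u)) (?g v u x) < \<epsilon>"
    using near[OF st'(3,4,1,2)] inS(2)[OF st'(3,4,1,2)]
    by (intro db) (auto simp: d_def add.commute add.left_commute)
  ultimately show False
    unfolding dist_real_def \<epsilon>_def by argo
qed

lemma der_der_commute:
  fixes f :: "'a::euclidean_space \<Rightarrow> 'b::euclidean_space"
  assumes S: "open S" "x \<in> S" and f: "Ck_on 2 S f"
  shows "der (\<lambda>y. der f y u) x v = der (\<lambda>y. der f y v) x u"
proof (rule euclidean_eqI)
  fix b :: 'b assume "b \<in> Basis"
  have d1: "f differentiable (at y)" and d2: "(\<lambda>z. der f z w) differentiable (at y)"
    if "y \<in> S" for y w
    using f that by (auto simp: numeral_2_eq_2)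
  have *: "der (\<lambda>y. der f y u) x v \<bullet> b = der (\<lambda>y. der (\<lambda>z. f z \<bullet> b) y u) x v" for u v
  proof -
    have 1: "der (\<lambda>z. f z \<bullet> b) y u = der f y u \<bullet> b" if "y \<in> S" for y
      using der_eqI[OF bounded_linear.has_derivative[OF bounded_linear_inner_left[of b] der_has_derivative[OF d1[OF that]]]] by simp
    have 2: "der (\<lambda>y. der f y u \<bullet> b) x v = der (\<lambda>y. der f y u) x v \<bullet> b"
      using der_eqI[OF bounded_linear.has_derivative[OF bounded_linear_inner_left[of b] der_has_derivative[OF d2[OF S(2)]]]] by simp
    show ?thesis
      using der_cong_open[OF S, of "\<lambda>y. der (\<lambda>z. f z \<bullet> b) y u" "\<lambda>y. der f y u \<bullet> b"] 1 2 by simp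
  qed
  have "Ck_on 2 S (\<lambda>z. f z \<bullet> b)"
    by (rule Ck_on_bounded_linear[OF bounded_linear_inner_left S(1) f])
  from der_der_commute_real[OF S this]
  show "der (\<lambda>y. der f y u) x v \<bullet> b = der (\<lambda>y. der f y v) x u \<bullet> b"
    by (simp add: *)
qed

section \<open>Smooth inversion of linear operators\<close>

text \<open>Since \<open>g x = 0\<close>, the term of the product rule that would differentiate
  \<open>f\<close> disappears, and continuity of \<open>f\<close> at \<open>x\<close> suffices. This
  serves to differentiate an inverse whose differentiability is not yet known.\<close>

lemma has_derivative_bilinear_vanishing:
  assumes B: "bounded_bilinear B" and f: "isCont f x"
    and g: "(g has_derivative g') (at x)" and g0: "g x = 0"
  shows "((\<lambda>y. B (f y) (g y)) has_derivative (\<lambda>v. B (f x) (g' v))) (at x)"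
proof -
  interpret bounded_bilinear B by (rule B)
  obtain K where K: "K > 0" "\<And>a b. norm (B a b) \<le> norm a * norm b * K"
    using pos_bounded by blast
  interpret g': bounded_linear g' using g by (rule has_derivative_bounded_linear)
  obtain C where C: "C > 0" "\<And>v. norm (g' v) \<le> norm v * C" using g'.pos_bounded by blast
  let ?q = "\<lambda>y. norm (g y - g x - g' (y - x)) / norm (y - x)"
  have q: "(?q \<longlongrightarrow> 0) (at x)"
    using g by (simp add: has_derivative_iff_norm)
  have lim: "((\<lambda>y. norm (f y - f x) * (?q y + C) * K) \<longlongrightarrow> norm (f x - f x) * (0 + C) * K) (at x)"
    using f by (intro tendsto_intros q) (auto simp: isCont_def)
  have "((\<lambda>y. B (f y - f x) (g y)) has_derivative (\<lambda>v. 0)) (at x)"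
    unfolding has_derivative_iff_norm
  proof (intro conjI Lim_null_comparison[OF always_eventually lim[simplified]] allI)
    show "bounded_linear (\<lambda>v. 0)" by (rule bounded_linear_zero)
    fix y
    have "norm (g y) \<le> norm (g y - g x - g' (y - x)) + norm (g' (y - x))"
      using norm_triangle_sub[of "g y" "g' (y - x)"] g0 by (simp add: algebra_simps)
    also have "\<dots> \<le> norm (g y - g x - g' (y - x)) + norm (y - x) * C"
      using C by simp
    finally have "norm (g y) / norm (y - x) \<le> ?q y + C" if "y \<noteq> x"
      using that by (simp add: field_simps)
    \<comment> \<open>At \<open>y = x\<close> both quotients have denominator zero and so equal
      \<open>0\<close>.\<close>
    then have *: "norm (g y) / norm (y - x) \<le> ?q y + C"
      using C by (cases "y = x") auto
    have "norm (B (f y - f x) (g y)) / norm (y - x) \<le> norm (f y - f x) * norm (g y) * K / norm (y - x)"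
      by (intro divide_right_mono K) auto
    also have "\<dots> = norm (f y - f x) * (norm (g y) / norm (y - x)) * K" by simp
    also have "\<dots> \<le> norm (f y - f x) * (?q y + C) * K"
      using * K by (intro mult_right_mono mult_left_mono) auto
    finally show "norm (norm (B (f y - f x) (g y) - B (f x - f x) (g x) - 0) / norm (y - x))
        \<le> norm (f y - f x) * (norm (g y - g x - g' (y - x)) / norm (y - x) + C) * K"
      by (simp add: zero_left)
  qed
  moreover have "((\<lambda>y. B (f x) (g y)) has_derivative (\<lambda>v. B (f x) (g' v))) (at x)"
    by (rule bounded_linear.has_derivative[OF bounded_linear_right g])
  ultimately have "((\<lambda>y. B (f y - f x) (g y) + B (f x) (g y)) has_derivative (\<lambda>v. 0 + B (f x) (g' v))) (at x)"
    by (rule has_derivative_add)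
  then show ?thesis by (simp add: diff_left)
qed

text \<open>A deviation of at most one half gives \<open>norm v \<le> 2 * norm (M v)\<close>. This
  forces injectivity, hence invertibility in finite dimension, and the same estimate bounds the
  inverse.\<close>

lemma blinfun_inverse_near_id:
  fixes M :: "'a::euclidean_space \<Rightarrow>\<^sub>L 'a"
  assumes "norm (M - id_blinfun) \<le> 1 / 2"
  obtains M' where "M' o\<^sub>L M = id_blinfun" "M o\<^sub>L M' = id_blinfun" "norm M' \<le> 2"
proof -
  have lower: "norm v \<le> 2 * norm (M v)" for v
  proof -
    have "norm ((M - id_blinfun) v) \<le> 1 / 2 * norm v"
      using norm_blinfun[of "M - id_blinfun" v] assms
      by (smt (verit, best) mult_right_mono norm_ge_zero)
    then have "norm (M v - v) \<le> norm v / 2" by (simp add: blinfun.diff_left)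
    moreover have "norm v \<le> norm (M v) + norm (M v - v)"
      by (metis norm_minus_commute norm_triangle_sub)
    ultimately show ?thesis by simp
  qed
  have lin: "linear (blinfun_apply M)"
    by (rule bounded_linear.linear[OF blinfun.bounded_linear_right])
  have "inj (blinfun_apply M)"
    unfolding linear_injective_0[OF lin] using lower by (metis mult_zero_right norm_zero norm_le_zero_iff)
  then obtain g where g: "linear g" "\<And>x. g (M x) = x" "\<And>x. M (g x) = x"
    using linear_injective_isomorphism[OF lin] by blast
  have ap: "blinfun_apply (Blinfun g) = g"
    using g(1) by (intro bounded_linear_Blinfun_apply) (simp add: linear_conv_bounded_linear)
  show ?thesis
  proof (rule that[of "Blinfun g"])
    show "norm (Blinfun g) \<le> 2"
      using lower[of "g _"] by (intro norm_blinfun_bound) (auto simp: ap g)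
  qed (auto intro!: blinfun_eqI simp: ap g)
qed

text \<open>The resolvent identity for \<open>M' y - M' x\<close> gives continuity by the uniform
  bound, and then a formula for the derivative. That formula contains \<open>M'\<close> only
  undifferentiated, so each order of differentiability yields the next.\<close>

lemma smooth_on_blinfun_inverse:
  fixes M M' :: "'b::euclidean_space \<Rightarrow> 'a::euclidean_space \<Rightarrow>\<^sub>L 'a"
  assumes S: "open S" and M: "smooth_on S M"
    and inv: "\<And>x. x \<in> S \<Longrightarrow> M' x o\<^sub>L M x = id_blinfun" "\<And>x. x \<in> S \<Longrightarrow> M x o\<^sub>L M' x = id_blinfun"
    and bound: "\<And>x. x \<in> S \<Longrightarrow> norm (M' x) \<le> C"
  shows "smooth_on S M'"
proof -
  have eq: "M' y = M' x - (M' y o\<^sub>L ((M y - M x) o\<^sub>L M' x))" if "x \<in> S" "y \<in> S" for x y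
  proof (rule blinfun_eqI)
    fix v
    have "M' y (M y (M' x v)) = M' x v" "M x (M' x v) = v"
      using inv(1)[OF that(2)] inv(2)[OF that(1)]
      by (metis blinfun_apply_blinfun_compose blinfun_apply_id_blinfun)+
    then show "M' y v = (M' x - (M' y o\<^sub>L ((M y - M x) o\<^sub>L M' x))) v"
      by (simp add: blinfun.diff_left blinfun.diff_right)
  qed
  have cont: "isCont M' x" if x: "x \<in> S" for x
  proof -
    have "isCont M x"
      using smooth_on_continuous[OF M] S x by (simp add: continuous_on_eq_continuous_at)
    then have "((\<lambda>y. C * norm (M y - M x) * norm (M' x)) \<longlongrightarrow> C * norm (M x - M x) * norm (M' x)) (at x)"
      by (intro tendsto_intros) (simp add: isCont_def)
    then have lim: "((\<lambda>y. C * norm (M y - M x) * norm (M' x)) \<longlongrightarrow> 0) (at x)" by simp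
    have "norm (M' y - M' x) \<le> C * norm (M y - M x) * norm (M' x)" if "y \<in> S" for y
    proof -
      have "M' y - M' x = - (M' y o\<^sub>L ((M y - M x) o\<^sub>L M' x))"
        using eq[OF x that] by (metis add_diff_cancel_left' diff_add_cancel minus_diff_eq)
      then have "norm (M' y - M' x) \<le> norm (M' y) * (norm (M y - M x) * norm (M' x))"
        using norm_blinfun_compose[of "M' y" "(M y - M x) o\<^sub>L M' x"]
          norm_blinfun_compose[of "M y - M x" "M' x"]
        by (smt (verit, best) mult_left_mono norm_ge_zero norm_minus_cancel)
      also have "\<dots> \<le> C * (norm (M y - M x) * norm (M' x))"
        using bound[OF that] by (intro mult_right_mono) auto
      finally show ?thesis by (simp add: mult.assoc)
    qed
    then have "\<forall>\<^sub>F y in at x. norm (M' y - M' x) \<le> C * norm (M y - M x) * norm (M' x)"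
      using S x eventually_at_topological by blast
    from Lim_null_comparison[OF this lim] show ?thesis
      by (simp add: isCont_def LIM_zero_iff)
  qed
  have deriv: "(M' has_derivative (\<lambda>v. - (M' x o\<^sub>L (der M x v o\<^sub>L M' x)))) (at x)" if x: "x \<in> S" for x
  proof -
    have "((\<lambda>y. (M y - M x) o\<^sub>L M' x) has_derivative (\<lambda>v. der M x v o\<^sub>L M' x)) (at x)"
      using smooth_on_has_derivative[OF M x]
      by (auto intro!: derivative_eq_intros bounded_bilinear.FDERIV[OF bounded_bilinear_blinfun_compose])
    from has_derivative_bilinear_vanishing[OF bounded_bilinear_blinfun_compose cont[OF x] this]
    have "((\<lambda>y. M' x - (M' y o\<^sub>L ((M y - M x) o\<^sub>L M' x))) has_derivative
        (\<lambda>v. - (M' x o\<^sub>L (der M x v o\<^sub>L M' x)))) (at x)"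
      using has_derivative_diff[OF has_derivative_const] by fastforce
    then show ?thesis
      using has_derivative_cong_open[OF S x, of M' "\<lambda>y. M' x - (M' y o\<^sub>L ((M y - M x) o\<^sub>L M' x))"] eq[OF x]
      by blast
  qed
  have "Ck_on k S M'" for k
  proof (induction k)
    case 0
    then show ?case using cont S by (simp add: continuous_on_eq_continuous_at)
  next
    case (Suc k)
    have "Ck_on k S (\<lambda>x. der M x v)" for v
      using smooth_on_der[OF M] by (simp add: smooth_on_def)
    then show ?case
      using Suc by (intro Ck_SucI[OF S deriv] Ck_on_bilinear[OF bounded_bilinear_blinfun_compose S]
          Ck_on_bounded_linear[OF bounded_linear_minus[OF bounded_linear_ident] S])
  qed
  then show ?thesis by (simp add: smooth_on_def)
qed

section \<open>Frobenius' theorem\<close>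

text \<open>\<open>comm\<close> says that the fields \<open>y \<mapsto> G y u\<close> with constant
  \<open>u\<close> have vanishing brackets. \<open>C * \<delta> \<le> \<rho>\<close> keeps the
  iterates inside the ball, and \<open>K * \<delta> \<le> 1 / 8\<close> makes both the iteration and
  the defects contract.\<close>

locale commuting_frame =
  fixes G :: "'b::euclidean_space \<Rightarrow> 'a::euclidean_space \<Rightarrow>\<^sub>L 'b"
    and DG :: "'b \<Rightarrow> 'b \<Rightarrow>\<^sub>L 'a \<Rightarrow>\<^sub>L 'b"
    and m0 :: 'b and \<rho> \<delta> C K :: real
  assumes deriv: "y \<in> cball m0 \<rho> \<Longrightarrow> (G has_derivative DG y) (at y)"
    and contDG: "continuous_on (cball m0 \<rho>) DG"
    and comm: "y \<in> cball m0 \<rho> \<Longrightarrow> DG y (G y u) v = DG y (G y v) u"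
    and G_bound: "y \<in> cball m0 \<rho> \<Longrightarrow> norm (G y) \<le> C"
    and DG_bound: "y \<in> cball m0 \<rho> \<Longrightarrow> norm (DG y) \<le> K"
    and \<rho>: "0 \<le> \<rho>" and \<delta>: "0 < \<delta>" and C\<delta>: "C * \<delta> \<le> \<rho>" and K\<delta>: "K * \<delta> \<le> 1 / 8"
begin

definition B :: "'a set" where "B = ball 0 \<delta>"

text \<open>A solution of \<open>Df = G f\<close> with \<open>f 0 = m0\<close> is a fixed point,
  because \<open>f (r *\<^sub>R x)\<close> has derivative \<open>G (f (r *\<^sub>R x)) x\<close> in
  \<open>r\<close>. The fixed point equation itself prescribes radial derivatives only; the others
  are controlled by \<open>picard_derivative\<close>.\<close>

definition picard :: "('a \<Rightarrow> 'b) \<Rightarrow> 'a \<Rightarrow> 'b"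
  where "picard g x = m0 + integral (cbox 0 1) (\<lambda>r::real. G (g (r *\<^sub>R x)) x)"

lemma C_nonneg: "0 \<le> C" and K_nonneg: "0 \<le> K"
  using order_trans[OF norm_ge_zero G_bound[of m0]] order_trans[OF norm_ge_zero DG_bound[of m0]] \<rho>
  by auto

lemma scaled_in_B: "x \<in> B \<Longrightarrow> r \<in> cbox 0 1 \<Longrightarrow> r *\<^sub>R x \<in> B"
  unfolding B_def using mult_left_le_one_le[of "norm x" r] by fastforce

lemma contG: "continuous_on (cball m0 \<rho>) G"
  by (meson deriv continuous_at_imp_continuous_on has_derivative_continuous)

lemma G_lipschitz:
  assumes "y \<in> cball m0 \<rho>" "z \<in> cball m0 \<rho>"
  shows "norm (G y - G z) \<le> K * norm (y - z)"
proof (rule differentiable_bound[OF convex_cball _ _ assms, of G DG])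
  fix y assume y: "y \<in> cball m0 \<rho>"
  show "(G has_derivative DG y) (at y within cball m0 \<rho>)"
    by (rule has_derivative_at_withinI[OF deriv[OF y]])
  show "onorm (blinfun_apply (DG y)) \<le> K"
    using DG_bound[OF y] by (simp add: norm_blinfun.rep_eq)
qed

lemma picard_in_cball:
  assumes cont: "continuous_on B g" and g: "g ` B \<subseteq> cball m0 \<rho>" and x: "x \<in> B"
  shows "picard g x \<in> cball m0 \<rho>" and "(\<lambda>r. G (g (r *\<^sub>R x)) x) integrable_on cbox (0::real) 1"
proof -
  have c: "continuous_on (cbox (0::real) 1) (\<lambda>r. G (g (r *\<^sub>R x)) x)"
    by (intro continuous_intros continuous_on_compose2[OF contG] continuous_on_compose2[OF cont])
      (use g scaled_in_B[OF x] in auto)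
  then show "(\<lambda>r. G (g (r *\<^sub>R x)) x) integrable_on cbox (0::real) 1"
    by (rule integrable_continuous)
  have "norm (integral {0..1::real} (\<lambda>r. G (g (r *\<^sub>R x)) x)) \<le> \<rho> * (1 - 0)"
  proof (rule integral_bound)
    fix r :: real assume "r \<in> {0..1}"
    then have "g (r *\<^sub>R x) \<in> cball m0 \<rho>" using g scaled_in_B[OF x, of r] by auto
    then have "norm (G (g (r *\<^sub>R x)) x) \<le> C * \<delta>"
      using norm_blinfun[of "G (g (r *\<^sub>R x))" x] x G_bound[of "g (r *\<^sub>R x)"] C_nonneg
        mult_mono[of "norm (G (g (r *\<^sub>R x)))" C "norm x" \<delta>]
      by (auto simp: B_def)
    then show "norm (G (g (r *\<^sub>R x)) x) \<le> \<rho>" using C\<delta> by simp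
  qed (use c in auto)
  then show "picard g x \<in> cball m0 \<rho>" by (simp add: picard_def dist_norm)
qed

text \<open>The integrand changes by at most \<open>K * D * \<delta>\<close>, whence the factor one
  eighth.\<close>

lemma picard_contraction:
  assumes g: "continuous_on B g" "g ` B \<subseteq> cball m0 \<rho>"
    and h: "continuous_on B h" "h ` B \<subseteq> cball m0 \<rho>"
    and D: "\<And>y. y \<in> B \<Longrightarrow> norm (g y - h y) \<le> D" and x: "x \<in> B"
  shows "norm (picard g x - picard h x) \<le> D / 8"
proof -
  have D0: "0 \<le> D" by (rule order_trans[OF norm_ge_zero D[OF x]])
  have "picard g x - picard h x
      = integral (cbox (0::real) 1) (\<lambda>r. G (g (r *\<^sub>R x)) x - G (h (r *\<^sub>R x)) x)"
    unfolding picard_def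
    by (simp add: integral_diff[OF picard_in_cball(2)[OF g x] picard_in_cball(2)[OF h x], simplified])
  also have "norm \<dots> \<le> integral (cbox (0::real) 1) (\<lambda>r. D / 8)"
  proof (rule integral_norm_bound_integral)
    fix r :: real assume r: "r \<in> cbox 0 1"
    have mem: "g (r *\<^sub>R x) \<in> cball m0 \<rho>" "h (r *\<^sub>R x) \<in> cball m0 \<rho>"
      using g(2) h(2) scaled_in_B[OF x r] by auto
    have "norm (G (g (r *\<^sub>R x)) - G (h (r *\<^sub>R x))) \<le> K * D"
      using G_lipschitz[OF mem] mult_left_mono[OF D[OF scaled_in_B[OF x r]] K_nonneg] by linarith
    then have "norm (G (g (r *\<^sub>R x)) - G (h (r *\<^sub>R x))) * norm x \<le> (K * D) * \<delta>"
      using x K_nonneg D0 by (intro mult_mono) (auto simp: B_def)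
    moreover have "norm (G (g (r *\<^sub>R x)) x - G (h (r *\<^sub>R x)) x)
        \<le> norm (G (g (r *\<^sub>R x)) - G (h (r *\<^sub>R x))) * norm x"
      by (metis blinfun.diff_left norm_blinfun)
    moreover have "(K * D) * \<delta> \<le> 1 / 8 * D"
      using mult_right_mono[OF K\<delta> D0] by (simp add: mult_ac)
    ultimately show "norm (G (g (r *\<^sub>R x)) x - G (h (r *\<^sub>R x)) x) \<le> D / 8" by simp
  qed (use picard_in_cball(2)[OF g x] picard_in_cball(2)[OF h x] in \<open>auto intro: integrable_diff\<close>)
  finally show ?thesis by simp
qed

text \<open>Differentiation under the integral gives \<open>d\<close>. Commutativity turns its
  integrand into a total derivative in \<open>r\<close> plus two terms linear in the defect of
  \<open>g'\<close>; each is bounded through \<open>K * \<delta> \<le> 1 / 8\<close>, which leaves a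
  quarter of the old defect.\<close>

lemma picard_derivative:
  assumes g: "\<And>y. y \<in> B \<Longrightarrow> (g has_derivative blinfun_apply (g' y)) (at y)"
    and cont: "continuous_on B g'" and ran: "g ` B \<subseteq> cball m0 \<rho>"
    and eps: "\<And>y. y \<in> B \<Longrightarrow> norm (g' y - G (g y)) \<le> \<epsilon>"
  obtains d where "\<And>x. x \<in> B \<Longrightarrow> (picard g has_derivative blinfun_apply (d x)) (at x)"
    "continuous_on B d" "\<And>x. x \<in> B \<Longrightarrow> norm (d x - G (g x)) \<le> \<epsilon> / 4"
proof -
  \<comment> \<open>The derivative of the integrand in \<open>x\<close>, as an operator:
    \<open>blinfun.prod_left x\<close> is evaluation at \<open>x\<close>, and the factor
    \<open>r\<close> comes from differentiating \<open>r *\<^sub>R x\<close>.\<close>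
  define fx where "fx x r = G (g (r *\<^sub>R x))
    + r *\<^sub>R (blinfun.prod_left x o\<^sub>L (DG (g (r *\<^sub>R x)) o\<^sub>L g' (r *\<^sub>R x)))" for x and r :: real
  define d where "d x = integral (cbox 0 1) (fx x)" for x
  have cg: "continuous_on B g"
    by (meson g continuous_at_imp_continuous_on has_derivative_continuous)
  have contfx: "continuous_on (B \<times> cbox 0 1) (\<lambda>(x, r). fx x r)"
    unfolding fx_def split_def
    by (intro continuous_intros continuous_on_compose2[OF contG] continuous_on_compose2[OF contDG]
        continuous_on_compose2[OF cg] continuous_on_compose2[OF cont]
        bounded_bilinear.continuous_on[OF bounded_bilinear_blinfun_compose]
        bounded_linear.continuous_on[OF blinfun.bounded_linear_prod_left])
      (use ran scaled_in_B in \<open>auto simp: image_subset_iff\<close>)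
  have contfx1: "continuous_on (cbox 0 1) (fx x)" if "x \<in> B" for x
  proof -
    have "continuous_on (cbox 0 1) (\<lambda>r::real. (x, r))" by (intro continuous_intros)
    from continuous_on_compose2[OF contfx this] that show ?thesis by auto
  qed
  have ap: "fx x r v = G (g (r *\<^sub>R x)) v + r *\<^sub>R DG (g (r *\<^sub>R x)) (g' (r *\<^sub>R x) v) x" for x r v
    by (simp add: fx_def blinfun.bilinear_simps)
  have inner: "((\<lambda>y. g (r *\<^sub>R y)) has_derivative (\<lambda>v. g' (r *\<^sub>R x) (r *\<^sub>R v))) (at x)"
    if "x \<in> B" "r \<in> cbox 0 1" for x r
    by (rule has_derivative_compose[OF _ g]) (use that in \<open>auto intro!: derivative_eq_intros scaled_in_B\<close>)
  have "((\<lambda>x. integral (cbox 0 1) (\<lambda>r. G (g (r *\<^sub>R x)) x)) has_derivative d x) (at x within B)"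
    if x: "x \<in> B" for x
    unfolding d_def
  proof (rule leibniz_rule[OF _ picard_in_cball(2)[OF cg ran] contfx x])
    fix x r assume x: "x \<in> B" and r: "r \<in> cbox (0::real) 1"
    have y: "g (r *\<^sub>R x) \<in> cball m0 \<rho>" using ran scaled_in_B[OF x r] by auto
    have "((\<lambda>x. G (g (r *\<^sub>R x)) x) has_derivative
        (\<lambda>v. G (g (r *\<^sub>R x)) v + DG (g (r *\<^sub>R x)) (g' (r *\<^sub>R x) (r *\<^sub>R v)) x)) (at x)"
      by (rule bounded_bilinear.FDERIV[OF bounded_bilinear_blinfun_apply
            has_derivative_compose[OF inner[OF x r] deriv[OF y]] has_derivative_ident])
    moreover have "G (g (r *\<^sub>R x)) v + DG (g (r *\<^sub>R x)) (g' (r *\<^sub>R x) (r *\<^sub>R v)) x = fx x r v" for v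
      by (simp add: ap blinfun.bilinear_simps)
    ultimately show "((\<lambda>x. G (g (r *\<^sub>R x)) x) has_derivative fx x r) (at x within B)"
      by (simp only: has_derivative_at_withinI)
  qed (auto simp: B_def)
  then have 1: "(picard g has_derivative d x) (at x)" if "x \<in> B" for x
    using that has_derivative_add[OF has_derivative_const, of _ "d x" "at x" m0]
    by (simp add: picard_def[abs_def] B_def at_within_open[OF _ open_ball])
  have 2: "continuous_on B d"
    unfolding d_def[abs_def] by (rule integral_continuous_on_param[OF contfx])
  have 3: "norm (d x - G (g x)) \<le> \<epsilon> / 4" if x: "x \<in> B" for x
  proof (rule norm_blinfun_bound)
    have \<epsilon>: "0 \<le> \<epsilon>" by (rule order_trans[OF norm_ge_zero eps[OF x]])
    then show "0 \<le> \<epsilon> / 4" by simp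
    fix v
    txt \<open>By commutativity, \<open>fx x r v\<close> is a radial derivative up to an error \<open>E r\<close> that is linear in the
      defect \<open>e\<close>.\<close>
    define e where "e y = g' y - G (g y)" for y
    define E where "E r = r *\<^sub>R (DG (g (r *\<^sub>R x)) (e (r *\<^sub>R x) v) x - DG (g (r *\<^sub>R x)) (e (r *\<^sub>R x) x) v)"
      for r
    have "((\<lambda>r. r *\<^sub>R G (g (r *\<^sub>R x)) v) has_vector_derivative (fx x r v - E r)) (at r within {0..1})"
      if r: "r \<in> {0..1}" for r
    proof -
      have rB: "r *\<^sub>R x \<in> B" using scaled_in_B[OF x, of r] r by simp
      then have y: "g (r *\<^sub>R x) \<in> cball m0 \<rho>" using ran by auto
      have "((\<lambda>r. r *\<^sub>R x) has_derivative (\<lambda>k. k *\<^sub>R x)) (at r)"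
        by (auto intro!: derivative_eq_intros)
      from has_derivative_compose[OF has_derivative_compose[OF this g[OF rB]] deriv[OF y]]
      have "((\<lambda>r. G (g (r *\<^sub>R x)) v) has_derivative (\<lambda>k. DG (g (r *\<^sub>R x)) (g' (r *\<^sub>R x) (k *\<^sub>R x)) v)) (at r)"
        by (rule bounded_linear.has_derivative[OF blinfun.bounded_linear_left])
      from has_derivative_scaleR[OF has_derivative_ident this]
      have "((\<lambda>r. r *\<^sub>R G (g (r *\<^sub>R x)) v) has_vector_derivative
          (r *\<^sub>R DG (g (r *\<^sub>R x)) (g' (r *\<^sub>R x) x) v + G (g (r *\<^sub>R x)) v)) (at r)"
        by (simp add: has_vector_derivative_def blinfun.bilinear_simps algebra_simps)
      moreover have "r *\<^sub>R DG (g (r *\<^sub>R x)) (g' (r *\<^sub>R x) x) v + G (g (r *\<^sub>R x)) v = fx x r v - E r"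
        unfolding ap E_def e_def using comm[OF y, of x v]
        by (simp add: blinfun.bilinear_simps algebra_simps)
      ultimately show ?thesis
        by (simp add: has_vector_derivative_at_within)
    qed
    \<comment> \<open>The primitive carries the factor \<open>r\<close>, so it vanishes at
      \<open>0\<close> and equals \<open>G (g x) v\<close> at \<open>1\<close>.\<close>
    from fundamental_theorem_of_calculus[OF zero_le_one this]
    have I1: "((\<lambda>r. fx x r v - E r) has_integral G (g x) v) (cbox 0 1)" by simp
    have I2: "((\<lambda>r. fx x r v) has_integral d x v) (cbox 0 1)"
      using has_integral_linear[OF integrable_integral[OF integrable_continuous[OF contfx1[OF x]]]
          blinfun.bounded_linear_left, of v]
      by (simp add: d_def o_def)
    have I3: "(E has_integral (d x - G (g x)) v) (cbox 0 1)"
      using has_integral_diff[OF I2 I1] by (simp add: blinfun.bilinear_simps)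
    have "norm (E r) \<le> \<epsilon> / 4 * norm v" if r: "r \<in> cbox 0 1" for r
    proof -
      have rB: "r *\<^sub>R x \<in> B" using scaled_in_B[OF x r] .
      then have y: "g (r *\<^sub>R x) \<in> cball m0 \<rho>" using ran by auto
      have nx: "norm x \<le> \<delta>" using x by (simp add: B_def)
      have bd: "norm (DG (g (r *\<^sub>R x)) (e (r *\<^sub>R x) a) b) \<le> K * \<epsilon> * (norm a * norm b)" for a b
      proof -
        have "norm (DG (g (r *\<^sub>R x)) (e (r *\<^sub>R x) a) b)
            \<le> norm (DG (g (r *\<^sub>R x))) * norm (e (r *\<^sub>R x) a) * norm b"
          by (rule order_trans[OF norm_blinfun mult_right_mono[OF norm_blinfun norm_ge_zero]])
        also have "\<dots> \<le> K * (\<epsilon> * norm a) * norm b"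
          using DG_bound[OF y] K_nonneg \<epsilon> eps[OF rB]
          by (intro mult_mono mult_right_mono order_trans[OF norm_blinfun]) (auto simp: e_def)
        finally show ?thesis by (simp add: mult_ac)
      qed
      have "norm (E r) = \<bar>r\<bar> * norm (DG (g (r *\<^sub>R x)) (e (r *\<^sub>R x) v) x - DG (g (r *\<^sub>R x)) (e (r *\<^sub>R x) x) v)"
        by (simp add: E_def)
      also have "\<dots> \<le> 1 * (K * \<epsilon> * (norm v * norm x) + K * \<epsilon> * (norm x * norm v))"
        using r by (intro mult_mono order_trans[OF norm_triangle_ineq4] add_mono bd) auto
      also have "\<dots> = 2 * K * \<epsilon> * norm v * norm x" by simp
      also have "\<dots> \<le> 2 * K * \<epsilon> * norm v * \<delta>"
        using nx K_nonneg \<epsilon> by (intro mult_left_mono) auto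
      also have "\<dots> = 2 * (K * \<delta>) * (\<epsilon> * norm v)" by simp
      also have "\<dots> \<le> 2 * (1 / 8) * (\<epsilon> * norm v)"
        using K\<delta> \<epsilon> by (intro mult_right_mono mult_left_mono) auto
      finally show ?thesis by simp
    qed
    from has_integral_bound[OF _ I3 this]
    show "norm ((d x - G (g x)) v) \<le> \<epsilon> / 4 * norm v" using \<epsilon> by simp
  qed
  show ?thesis by (rule that[OF 1 2 3])
qed

definition iter :: "nat \<Rightarrow> 'a \<Rightarrow> 'b" where "iter k = (picard ^^ k) (\<lambda>x. m0)"

text \<open>\<open>C\<close> covers the defect of the constant map at the start;
  \<open>4 * K * \<rho>\<close> is room for the error made when \<open>G (iter k)\<close> is
  replaced by \<open>G (iter (Suc k))\<close>.\<close>

definition A :: real where "A = C + 4 * K * \<rho>"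

text \<open>One Picard step leaves a quarter of the defect, measured against
  \<open>G (iter k)\<close>. Passing to \<open>G (iter (Suc k))\<close> costs at most another
  quarter of \<open>A / 2 ^ k\<close>, because successive iterates differ by at most
  \<open>\<rho> / 8 ^ k\<close>; hence the defect halves.\<close>

lemma iter_props:
  "(\<exists>g'. (\<forall>y\<in>B. (iter k has_derivative blinfun_apply (g' y)) (at y)) \<and> continuous_on B g' \<and>
      (\<forall>y\<in>B. norm (g' y - G (iter k y)) \<le> A / 2 ^ k)) \<and>
    iter k ` B \<subseteq> cball m0 \<rho> \<and> (\<forall>y\<in>B. norm (iter (Suc k) y - iter k y) \<le> \<rho> / 8 ^ k)"
proof (induction k)
  case 0
  have "norm (picard (\<lambda>x. m0) x - m0) \<le> \<rho>" if "x \<in> B" for x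
    using picard_in_cball(1)[OF _ _ that, of "\<lambda>x. m0"] \<rho>
    by (auto simp: dist_norm norm_minus_commute image_subset_iff)
  moreover have "norm (G m0) \<le> A"
    using G_bound[of m0] \<rho> K_nonneg by (auto simp: A_def intro: add_increasing2)
  ultimately show ?case
    using \<rho> has_derivative_const[of m0]
    by (intro conjI exI[of _ "\<lambda>_. 0"] ballI)
      (simp_all add: iter_def image_subset_iff zero_blinfun.rep_eq id_def)
next
  case (Suc k)
  from Suc.IH obtain g' where IH: "\<forall>y\<in>B. (iter k has_derivative blinfun_apply (g' y)) (at y)"
      "continuous_on B g'" "\<forall>y\<in>B. norm (g' y - G (iter k y)) \<le> A / 2 ^ k"
      "iter k ` B \<subseteq> cball m0 \<rho>" "\<forall>y\<in>B. norm (iter (Suc k) y - iter k y) \<le> \<rho> / 8 ^ k"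
    by (elim conjE exE)
  note g' = IH(1)[rule_format] IH(2) IH(3)[rule_format] and ran = IH(4) and diff = IH(5)[rule_format]
  have it: "iter (Suc n) = picard (iter n)" for n by (simp add: iter_def)
  have cont: "continuous_on B (iter k)"
    by (meson g'(1) continuous_at_imp_continuous_on has_derivative_continuous)
  have ran': "iter (Suc k) ` B \<subseteq> cball m0 \<rho>"
    using picard_in_cball(1)[OF cont ran] by (auto simp: it)
  obtain d where d: "\<And>x. x \<in> B \<Longrightarrow> (iter (Suc k) has_derivative blinfun_apply (d x)) (at x)"
    "continuous_on B d" "\<And>x. x \<in> B \<Longrightarrow> norm (d x - G (iter k x)) \<le> A / 2 ^ k / 4"
    using picard_derivative[OF g'(1,2) ran g'(3)] unfolding it by blast
  have cont': "continuous_on B (iter (Suc k))"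
    by (meson d(1) continuous_at_imp_continuous_on has_derivative_continuous)
  have "norm (d y - G (iter (Suc k) y)) \<le> A / 2 ^ Suc k" if y: "y \<in> B" for y
  proof -
    have "norm (d y - G (iter (Suc k) y)) \<le> norm (d y - G (iter k y)) + norm (G (iter k y) - G (iter (Suc k) y))"
      using norm_triangle_ineq[of "d y - G (iter k y)" "G (iter k y) - G (iter (Suc k) y)"] by simp
    also have "\<dots> \<le> A / 2 ^ k / 4 + K * (\<rho> / 8 ^ k)"
    proof (rule add_mono[OF d(3)[OF y]])
      have "norm (G (iter k y) - G (iter (Suc k) y)) \<le> K * norm (iter k y - iter (Suc k) y)"
        using ran ran' y by (intro G_lipschitz) auto
      also have "\<dots> \<le> K * (\<rho> / 8 ^ k)"
        using diff[OF y] K_nonneg by (intro mult_left_mono) (auto simp: norm_minus_commute)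
      finally show "norm (G (iter k y) - G (iter (Suc k) y)) \<le> K * (\<rho> / 8 ^ k)" .
    qed
    also have "K * (\<rho> / 8 ^ k) \<le> (K * \<rho>) / 2 ^ k"
      using K_nonneg \<rho> by (simp, intro divide_left_mono power_mono) auto
    also have "A / 2 ^ k / 4 + K * \<rho> / 2 ^ k \<le> A / 2 ^ k / 4 + (A / 4) / 2 ^ k"
      using C_nonneg by (intro add_left_mono divide_right_mono) (auto simp: A_def)
    also have "\<dots> = A / 2 ^ Suc k" by (simp add: field_simps)
    finally show ?thesis by simp
  qed
  moreover have "norm (iter (Suc (Suc k)) y - iter (Suc k) y) \<le> \<rho> / 8 ^ Suc k" if "y \<in> B" for y
    using picard_contraction[OF cont' ran' cont ran diff that] by (simp add: it mult.commute)
  ultimately show ?case using d ran' by blast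
qed

text \<open>The iterates converge uniformly by a geometric majorant. Their derivatives converge
  uniformly to \<open>G f\<close>, since the defects tend to zero and \<open>G\<close> is Lipschitz,
  so the limit is differentiable with that derivative.\<close>

lemma solution_exists:
  obtains f where "f 0 = m0" "f ` B \<subseteq> cball m0 \<rho>"
    "\<And>x. x \<in> B \<Longrightarrow> (f has_derivative blinfun_apply (G (f x))) (at x)"
proof -
  have "\<exists>F'. \<forall>k. (\<forall>y\<in>B. (iter k has_derivative blinfun_apply (F' k y)) (at y)) \<and>
      (\<forall>y\<in>B. norm (F' k y - G (iter k y)) \<le> A / 2 ^ k)"
    using iter_props by (intro choice) blast
  then obtain F' where F': "\<And>k y. y \<in> B \<Longrightarrow> (iter k has_derivative blinfun_apply (F' k y)) (at y)"
    "\<And>k y. y \<in> B \<Longrightarrow> norm (F' k y - G (iter k y)) \<le> A / 2 ^ k" by blast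
  have ran: "iter k y \<in> cball m0 \<rho>" if "y \<in> B" for k y
    using iter_props that by blast
  define f where "f x = m0 + (\<Sum>i. iter (Suc i) x - iter i x)" for x
  have "uniform_limit B (\<lambda>n x. \<Sum>i<n. iter (Suc i) x - iter i x) (\<lambda>x. \<Sum>i. iter (Suc i) x - iter i x)
      sequentially"
  proof (rule Weierstrass_m_test)
    show "norm (iter (Suc n) x - iter n x) \<le> \<rho> * (1 / 8) ^ n" if "x \<in> B" for n x
      using iter_props that by (simp add: power_divide)
    show "summable (\<lambda>n. \<rho> * (1 / 8) ^ n)"
      by (intro summable_mult summable_geometric) simp
  qed
  then have "uniform_limit B (\<lambda>n x. m0 + (\<Sum>i<n. iter (Suc i) x - iter i x)) f sequentially"
    unfolding f_def[abs_def] by (intro uniform_limit_intros)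
  moreover have "m0 + (\<Sum>i<n. iter (Suc i) x - iter i x) = iter n x" for n x
    using sum_lessThan_telescope[of "\<lambda>i. iter i x" n] by (simp add: iter_def)
  ultimately have lim: "uniform_limit B iter f sequentially" by simp
  have pt: "(\<lambda>n. iter n x) \<longlonglongrightarrow> f x" if "x \<in> B" for x
    using lim that by (rule tendsto_uniform_limitI)
  have fran: "f x \<in> cball m0 \<rho>" if "x \<in> B" for x
    by (rule closed_sequentially[OF closed_cball _ pt[OF that]]) (use ran that in blast)
  have it0: "iter n 0 = m0" for n
    by (cases n) (auto simp: iter_def picard_def)
  have B0: "0 \<in> B" using \<delta> by (simp add: B_def)
  have f0: "f 0 = m0" using pt[OF B0] by (simp add: it0 LIMSEQ_const_iff)
  have "\<exists>g. \<forall>x\<in>B. (\<lambda>n. iter n x) \<longlonglongrightarrow> g x \<and> (g has_derivative G (f x)) (at x within B)"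
  proof (rule has_derivative_sequence[where f = iter and f' = "\<lambda>n x. blinfun_apply (F' n x)"
        and g' = "\<lambda>x. blinfun_apply (G (f x))", OF _ _ _ B0 pt[OF B0]])
    show "convex B" by (simp add: B_def)
    show "(iter n has_derivative F' n x) (at x within B)" if "x \<in> B" for n x
      using F'(1)[OF that] by (rule has_derivative_at_withinI)
    fix e :: real assume e: "e > 0"
    have "(\<lambda>n. A * (1 / 2) ^ n) \<longlonglongrightarrow> A * 0"
      by (intro tendsto_intros LIMSEQ_power_zero) simp
    then have "\<forall>\<^sub>F n in sequentially. A * (1 / 2) ^ n < e / 2"
      using e by (intro order_tendstoD) auto
    \<comment> \<open>The denominator \<open>K + 1\<close> is positive even if
      \<open>K = 0\<close>.\<close>
    moreover have "\<forall>\<^sub>F n in sequentially. \<forall>x\<in>B. dist (iter n x) (f x) < e / 2 / (K + 1)"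
      using lim e K_nonneg by (intro uniform_limitD) auto
    ultimately show "\<forall>\<^sub>F n in sequentially. \<forall>x\<in>B. \<forall>h. norm (F' n x h - G (f x) h) \<le> e * norm h"
    proof eventually_elim
      case (elim n)
      show ?case
      proof (intro ballI allI)
        fix x h assume x: "x \<in> B"
        have "norm (F' n x - G (f x)) \<le> norm (F' n x - G (iter n x)) + norm (G (iter n x) - G (f x))"
          using norm_triangle_ineq[of "F' n x - G (iter n x)" "G (iter n x) - G (f x)"] by simp
        also have "\<dots> \<le> A / 2 ^ n + K * norm (iter n x - f x)"
          using F'(2)[OF x] G_lipschitz[OF ran[OF x] fran[OF x]] by (intro add_mono)
        also have "K * norm (iter n x - f x) \<le> (K + 1) * (e / 2 / (K + 1))"
          using elim(2) x K_nonneg by (intro mult_mono) (auto simp: dist_norm intro: less_imp_le)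
        also have "\<dots> = e / 2" using K_nonneg by (simp del: divide_divide_eq_left)
        also have "A / 2 ^ n + e / 2 \<le> e"
        proof -
          have "A * (1 / 2) ^ n = A / 2 ^ n" by (simp add: power_divide)
          with elim(1) show ?thesis by linarith
        qed
        finally have "norm (F' n x - G (f x)) \<le> e" by simp
        then show "norm (F' n x h - G (f x) h) \<le> e * norm h"
          using norm_blinfun[of "F' n x - G (f x)" h]
          by (simp add: blinfun.diff_left order_trans[OF _ mult_right_mono])
      qed
    qed
  qed
  then obtain g where g: "\<And>x. x \<in> B \<Longrightarrow> (\<lambda>n. iter n x) \<longlonglongrightarrow> g x"
    "\<And>x. x \<in> B \<Longrightarrow> (g has_derivative G (f x)) (at x within B)" by blast
  \<comment> \<open>The theorem on sequences of derivatives supplies a limit \<open>g\<close> of its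
    own, which is identified with \<open>f\<close> on \<open>B\<close>.\<close>
  have "g x = f x" if "x \<in> B" for x using LIMSEQ_unique[OF g(1) pt] that by blast
  moreover have "open B" by (simp add: B_def)
  ultimately have "(f has_derivative G (f x)) (at x)" if "x \<in> B" for x
    using g(2)[OF that] has_derivative_cong_open[OF \<open>open B\<close> that, of g f]
    unfolding at_within_open[OF that \<open>open B\<close>] by blast
  with f0 fran show ?thesis by (intro that[of f]) auto
qed

end

section \<open>From an involutive frame to a commuting one\<close>

text \<open>The frame is replaced by \<open>G\<close>, with the same range and with
  \<open>\<kappa>\<close> a left inverse. Brackets of the new frame lie in the range of
  \<open>G\<close>, while differentiating \<open>\<kappa> o\<^sub>L G m = id_blinfun\<close> shows
  that \<open>\<kappa>\<close> annihilates them; as \<open>\<kappa>\<close> is injective on that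
  range, they vanish.\<close>

theorem frobenius:
  fixes E :: "'b::euclidean_space \<Rightarrow> 'a::euclidean_space \<Rightarrow>\<^sub>L 'b"
  assumes J: "open J" "m0 \<in> J" and E: "smooth_on J E"
    and inj: "inj (blinfun_apply (E m0))"
    and invol: "\<And>m a b. m \<in> J \<Longrightarrow> der E m (E m a) b - der E m (E m b) a \<in> range (blinfun_apply (E m))"
  shows "\<exists>(W :: 'a set) f. integral_submanifold J (\<lambda>m. range (blinfun_apply (E m))) W f \<and> m0 \<in> f ` W"
proof -
  have lin: "linear (blinfun_apply (E m))" for m
    by (rule bounded_linear.linear[OF blinfun.bounded_linear_right])
  obtain \<kappa>0 where \<kappa>0: "linear \<kappa>0" "\<kappa>0 \<circ> blinfun_apply (E m0) = id"
    using linear_injective_left_inverse[OF lin inj] by blast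
  define \<kappa> where "\<kappa> = Blinfun \<kappa>0"
  have \<kappa>: "\<kappa> (E m0 a) = a" for a
    using \<kappa>0 by (simp add: \<kappa>_def bounded_linear_Blinfun_apply linear_conv_bounded_linear fun_eq_iff)
  define M where "M m = \<kappa> o\<^sub>L E m" for m
  have M: "smooth_on J M"
    unfolding M_def[abs_def] using J E
    by (intro smooth_on_bilinear[OF bounded_bilinear_blinfun_compose] smooth_on_const)
  \<comment> \<open>On \<open>J'\<close> the operator \<open>M m\<close> is invertible, with an
    inverse of norm at most \<open>2\<close>.\<close>
  define J' where "J' = J \<inter> (\<lambda>m. norm (M m - id_blinfun)) -` {..<1 / 2}"
  have J': "open J'"
    unfolding J'_def using smooth_on_continuous[OF M] J
    by (intro continuous_open_preimage continuous_intros) auto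
  have sub: "J' \<subseteq> J" by (auto simp: J'_def)
  have "M m0 = id_blinfun" by (rule blinfun_eqI) (simp add: M_def \<kappa>)
  then have m0: "m0 \<in> J'" using J by (simp add: J'_def)
  have "\<exists>N. N o\<^sub>L M m = id_blinfun \<and> M m o\<^sub>L N = id_blinfun \<and> norm N \<le> 2" if "m \<in> J'" for m
    using blinfun_inverse_near_id[of "M m"] that by (auto simp: J'_def)
  then obtain M' where M': "\<And>m. m \<in> J' \<Longrightarrow> M' m o\<^sub>L M m = id_blinfun"
      "\<And>m. m \<in> J' \<Longrightarrow> M m o\<^sub>L M' m = id_blinfun" "\<And>m. m \<in> J' \<Longrightarrow> norm (M' m) \<le> 2"
    by metis
  have sM': "smooth_on J' M'"
    by (rule smooth_on_blinfun_inverse[OF J' smooth_on_subset[OF M sub] M'])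
  have sE: "smooth_on J' E" by (rule smooth_on_subset[OF E sub])
  define G where "G m = E m o\<^sub>L M' m" for m
  have sG: "smooth_on J' G"
    unfolding G_def[abs_def] by (rule smooth_on_bilinear[OF bounded_bilinear_blinfun_compose J' sE sM'])
  have \<kappa>G: "\<kappa> o\<^sub>L G m = id_blinfun" if "m \<in> J'" for m
    using M'(2)[OF that] by (simp add: G_def M_def blinfun_eqI blinfun_apply_inject[symmetric] fun_eq_iff)
  have \<kappa>G': "\<kappa> (G m a) = a" if "m \<in> J'" for m a
    using arg_cong[OF \<kappa>G[OF that], of "\<lambda>f. blinfun_apply f a"] by simp
  have rangeG: "range (blinfun_apply (G m)) = range (blinfun_apply (E m))" if "m \<in> J'" for m
  proof -
    have "E m a = G m (M m a)" for a
      using arg_cong[OF M'(1)[OF that], of "\<lambda>f. blinfun_apply f a"] by (simp add: G_def)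
    then show ?thesis by (auto simp: G_def)
  qed
  have comm: "der G m (G m u) v = der G m (G m v) u" if m: "m \<in> J'" for m u v
  proof -
    have "(G has_derivative (\<lambda>z. (E m o\<^sub>L der M' m z) + (der E m z o\<^sub>L M' m))) (at m)"
      unfolding G_def[abs_def]
      by (rule bounded_bilinear.FDERIV[OF bounded_bilinear_blinfun_compose])
        (auto intro: smooth_on_has_derivative m sE sM')
    from der_eqI[OF this]
    have dG: "der G m z w = E m (der M' m z w) + der E m z (M' m w)" for z w
      by (simp add: blinfun.add_left)
    let ?D = "der G m (G m u) v - der G m (G m v) u"
    have "subspace (range (blinfun_apply (E m)))" using lin subspace_UNIV by (rule linear_subspace_image)
    \<comment> \<open>The terms that differentiate \<open>M'\<close> already lie in the range; the
      rest is the involutivity expression of \<open>E\<close> at the vectors \<open>M' m u\<close>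
      and \<open>M' m v\<close>.\<close>
    moreover have "?D = E m (der M' m (G m u) v - der M' m (G m v) u)
        + (der E m (E m (M' m u)) (M' m v) - der E m (E m (M' m v)) (M' m u))"
      by (simp add: dG blinfun.diff_right) (simp add: G_def)
    ultimately have "?D \<in> range (blinfun_apply (E m))"
      using invol[of m "M' m u" "M' m v"] sub m by (auto intro: subspace_add)
    then obtain w where w: "?D = G m w" using rangeG[OF m] by blast
    have "\<kappa> (der G m z a) = 0" for z a
    proof -
      have "((\<lambda>m. \<kappa> o\<^sub>L G m) has_derivative (\<lambda>z. \<kappa> o\<^sub>L der G m z)) (at m)"
        by (rule bounded_linear.has_derivative[OF bounded_bilinear.bounded_linear_right[OF
                bounded_bilinear_blinfun_compose]])
          (rule smooth_on_has_derivative[OF sG m])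
      moreover have "((\<lambda>m. \<kappa> o\<^sub>L G m) has_derivative (\<lambda>z. 0)) (at m)"
        using has_derivative_cong_open[OF J' m, of "\<lambda>m. \<kappa> o\<^sub>L G m" "\<lambda>m. id_blinfun"] \<kappa>G by simp
      ultimately have "(\<lambda>z. \<kappa> o\<^sub>L der G m z) = (\<lambda>z. 0)" by (rule has_derivative_unique)
      from arg_cong[OF fun_cong[OF this, of z], of "\<lambda>f. blinfun_apply f a"] show ?thesis by simp
    qed
    then have "w = 0" using arg_cong[OF w, of \<kappa>] \<kappa>G'[OF m, of w] by (simp add: blinfun.diff_right)
    then show ?thesis using w by simp
  qed
  define DG where "DG y = Blinfun (der G y)" for y
  have DG: "blinfun_apply (DG y) = der G y" if "y \<in> J'" for y
    unfolding DG_def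
    by (rule bounded_linear_Blinfun_apply[OF has_derivative_bounded_linear[OF
            smooth_on_has_derivative[OF sG that]]])
  obtain \<rho> where \<rho>: "\<rho> > 0" "cball m0 \<rho> \<subseteq> J'" using J' m0 by (meson open_contains_cball)
  have contG: "continuous_on (cball m0 \<rho>) G"
    by (rule continuous_on_subset[OF smooth_on_continuous[OF sG] \<rho>(2)])
  have "continuous_on (cball m0 \<rho>) (\<lambda>y. DG y i)" for i
    using continuous_on_subset[OF smooth_on_continuous[OF smooth_on_der[OF sG]] \<rho>(2), of i] \<rho>(2)
    by (subst continuous_on_cong[OF refl, of _ _ "\<lambda>y. der G y i"]) (auto simp: DG subset_iff)
  then have contDG: "continuous_on (cball m0 \<rho>) DG"
    by (rule continuous_on_blinfun_componentwise)
  obtain C where C: "C > 0" "\<And>y. y \<in> cball m0 \<rho> \<Longrightarrow> norm (G y) \<le> C"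
    using compact_imp_bounded[OF compact_continuous_image[OF contG compact_cball]]
    by (auto simp: bounded_pos)
  obtain K where K: "K > 0" "\<And>y. y \<in> cball m0 \<rho> \<Longrightarrow> norm (DG y) \<le> K"
    using compact_imp_bounded[OF compact_continuous_image[OF contDG compact_cball]]
    by (auto simp: bounded_pos)
  define \<delta> where "\<delta> = min (\<rho> / C) (1 / (8 * K))"
  have \<delta>: "\<delta> > 0" "C * \<delta> \<le> \<rho>" "K * \<delta> \<le> 1 / 8"
    using \<rho> C K by (auto simp: \<delta>_def min_def field_simps)
  interpret cf: commuting_frame G DG m0 \<rho> \<delta> C K
  proof
    fix y u v assume y: "y \<in> cball m0 \<rho>"
    then have "y \<in> J'" using \<rho> by blast
    then show "(G has_derivative DG y) (at y)" "DG y (G y u) v = DG y (G y v) u"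
      using smooth_on_has_derivative[OF sG] comm by (simp_all add: DG)
  qed (use \<rho> \<delta> C K contDG in auto)
  obtain f where f: "f 0 = m0" "f ` cf.B \<subseteq> cball m0 \<rho>"
    "\<And>x. x \<in> cf.B \<Longrightarrow> (f has_derivative blinfun_apply (G (f x))) (at x)"
    by (rule cf.solution_exists) (rule that)
  have oB: "open cf.B" and B0: "0 \<in> cf.B" using \<delta> by (auto simp: cf.B_def)
  have ran: "f ` cf.B \<subseteq> J'" using f(2) \<rho>(2) by blast
  have contf: "continuous_on cf.B f"
    by (meson f(3) continuous_at_imp_continuous_on has_derivative_continuous)
  \<comment> \<open>Bootstrapping: by the equation \<open>Df = G f\<close>, the derivative is as
    regular as \<open>f\<close> itself.\<close>
  have "Ck_on k cf.B f" for k
  proof (induction k)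
    case 0
    then show ?case using contf by simp
  next
    case (Suc k)
    show ?case
    proof (rule Ck_SucI[OF oB f(3)])
      show "Ck_on k cf.B (\<lambda>x. G (f x) v)" for v
        by (intro Ck_on_bounded_linear[OF blinfun.bounded_linear_left oB]
            Ck_on_compose[OF oB J' ran Suc]) (use sG in \<open>simp add: smooth_on_def\<close>)
    qed
  qed
  then have sf: "smooth_on cf.B f" by (simp add: smooth_on_def)
  \<comment> \<open>Up to a translation \<open>\<kappa>\<close> inverts \<open>f\<close>, because
    the derivative of \<open>\<kappa> (f w) - w\<close> is zero on a convex set. This is the
    continuous inverse required of an embedding.\<close>
  have \<kappa>f: "\<kappa> (f w) - \<kappa> m0 = w" if w: "w \<in> cf.B" for w
  proof -
    have "((\<lambda>w. \<kappa> (f w) - w) has_derivative (\<lambda>h. 0)) (at x)" if x: "x \<in> cf.B" for x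
    proof -
      have "((\<lambda>w. \<kappa> (f w) - w) has_derivative (\<lambda>h. \<kappa> (G (f x) h) - h)) (at x)"
        by (intro has_derivative_diff has_derivative_ident f x
            bounded_linear.has_derivative[OF blinfun.bounded_linear_right])
      then show ?thesis using \<kappa>G'[of "f x"] ran x by auto
    qed
    then have "\<kappa> (f w) - w = \<kappa> (f 0) - 0"
      using w B0 by (intro has_derivative_zero_unique[of cf.B "\<lambda>w. \<kappa> (f w) - w"])
        (auto simp: cf.B_def intro: has_derivative_at_withinI)
    then show ?thesis using f(1) by (simp add: algebra_simps)
  qed
  have "homeomorphism cf.B (f ` cf.B) f (\<lambda>m. \<kappa> m - \<kappa> m0)"
    unfolding homeomorphism_def using \<kappa>f contf by (auto intro!: continuous_intros simp: image_image)
  moreover have "inj (der f w) \<and> range (der f w) = range (blinfun_apply (E (f w)))" if "w \<in> cf.B" for w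
  proof -
    have fw: "f w \<in> J'" using ran that by blast
    show ?thesis
      unfolding der_eqI[OF f(3)[OF that]] using rangeG[OF fw] \<kappa>G'[OF fw] by (metis injI)
  qed
  ultimately have "integral_submanifold J (\<lambda>m. range (blinfun_apply (E m))) cf.B f"
    unfolding integral_submanifold_def using oB sf ran sub by blast
  moreover have "m0 \<in> f ` cf.B" using f(1) B0 by force
  ultimately show ?thesis by blast
qed

section \<open>Exact two-forms\<close>

text \<open>Two consecutive third slots \<open>a\<close> and \<open>Suc a\<close> are shown to
  vanish together. Slot \<open>a\<close> with \<open>k = 0\<close> makes row \<open>a\<close>
  symmetric, slot \<open>Suc a\<close> with \<open>k = 1\<close> lets a unit move between the last
  two arguments, and so row \<open>a\<close> reduces to \<open>S a b 0\<close>. A vanishing row then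
  gives slot \<open>a + 2\<close> through \<open>k = 2\<close>. For row \<open>0\<close> the start
  is made by \<open>zero\<close> and \<open>first\<close>.\<close>

lemma cyclic_system_trivial:
  fixes S :: "nat \<Rightarrow> nat \<Rightarrow> nat \<Rightarrow> real"
  assumes anti: "\<And>a b l. S a b l = - S b a l"
    and zero: "\<And>a b. S a b 0 = 0"
    and cyc: "\<And>a b l k. k \<le> 2 \<Longrightarrow> S a b (l + k) + S b l (a + k) + S l a (b + k) = 0"
    and first: "\<And>b l. S 0 b (Suc l) = S 0 l (Suc b)"
  shows "S a b l = 0"
proof -
  have row: "S a b l = 0"
    if third: "\<And>b l. S b l a = 0" and shift: "\<And>b l. S a b (Suc l) = S a l (Suc b)" for a b l
  proof -
    have sym: "S a b l = S a l b" for b l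
      using cyc[of 0 a b l] third[of b l] anti[of l a b] by simp
    show ?thesis
    proof (induction l arbitrary: b)
      case 0
      show ?case by (rule zero)
    next
      case (Suc l)
      then show ?case using shift[of b l] sym[of l "Suc b"] by simp
    qed
  qed
  have next1: "S b l (Suc a) = 0" and next2: "S b l (Suc (Suc a)) = 0"
    if "\<And>b l. S a b l = 0" for a b l
    using cyc[of 1 a b l] cyc[of 2 a b l] that anti[of l a "Suc b"] anti[of l a "Suc (Suc b)"] by simp_all
  have "(\<forall>b l. S b l a = 0) \<and> (\<forall>b l. S b l (Suc a) = 0)" for a
  proof (induction a)
    case 0
    have "S 0 b l = 0" for b l by (rule row[OF zero first])
    then show ?case using zero next1 by blast
  next
    case (Suc a)
    have "S a b (Suc l) = S a l (Suc b)" for b l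
      using cyc[of 1 a b l] Suc anti[of l a "Suc b"] by simp
    then have "S a b l = 0" for b l using row[of a] Suc by blast
    then show ?case using Suc next2 by blast
  qed
  then show ?thesis by blast
qed

section \<open>Closed two-forms and Lie brackets\<close>

text \<open>Here \<open>a\<close> stands for the 1-form \<open>v \<mapsto> a m \<bullet> v\<close>.\<close>

definition dform :: "('a::euclidean_space \<Rightarrow> 'a) \<Rightarrow> 'a \<Rightarrow> 'a \<Rightarrow> 'a \<Rightarrow> real"
  where "dform a m u v = der a m u \<bullet> v - der a m v \<bullet> u"

lemma dform_antisym: "dform a m u v = - dform a m v u"
  by (simp add: dform_def)

lemma bilinear_dform:
  assumes "a differentiable (at m)"
  shows "linear (\<lambda>u. dform a m u v)" "linear (\<lambda>v. dform a m u v)"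
proof -
  interpret linear "der a m" by (rule linear_der[OF assms])
  show "linear (\<lambda>u. dform a m u v)" "linear (\<lambda>v. dform a m u v)"
    by (rule linearI; simp add: dform_def add scale inner_add_left inner_add_right algebra_simps)+
qed

text \<open>This is \<open>dd = 0\<close>, that is, symmetry of second derivatives.\<close>

lemma dform_closed:
  fixes a :: "'a::euclidean_space \<Rightarrow> 'a"
  assumes J: "open J" "m \<in> J" and a: "smooth_on J a"
  shows "der (\<lambda>y. dform a y u v) m w + der (\<lambda>y. dform a y v w) m u + der (\<lambda>y. dform a y w u) m v = 0"
proof -
  have "der (\<lambda>y. dform a y u v) m w = der (\<lambda>y. der a y u) m w \<bullet> v - der (\<lambda>y. der a y v) m w \<bullet> u" for u v w
    unfolding dform_def
    by (rule fun_cong[OF der_eqI])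
      (auto intro!: derivative_eq_intros smooth_on_has_derivative[OF smooth_on_der[OF a] J(2)])
  moreover have "der (\<lambda>y. der a y u) m w = der (\<lambda>y. der a y w) m u" for u w
    using a by (intro der_der_commute[OF J]) (simp add: smooth_on_def)
  ultimately show ?thesis by simp
qed

lemma dform_has_derivative:
  fixes a :: "'a::euclidean_space \<Rightarrow> 'a"
  assumes J: "open J" "m \<in> J" and a: "smooth_on J a"
    and X: "(X has_derivative X') (at m)" and Y: "(Y has_derivative Y') (at m)"
  shows "((\<lambda>y. dform a y (X y) (Y y)) has_derivative
      (\<lambda>w. der (\<lambda>y. dform a y (X m) (Y m)) m w + dform a m (X' w) (Y m) + dform a m (X m) (Y' w))) (at m)"
proof -
  have D: "((\<lambda>y. der a y (Z y)) has_derivative (\<lambda>w. der (\<lambda>y. der a y (Z m)) m w + der a m (Z' w))) (at m)"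
    if "(Z has_derivative Z') (at m)" for Z Z'
    by (rule has_derivative_family_apply[OF J(1) _ J(2) _ that])
      (auto intro: linear_der smooth_on_differentiable[OF a] smooth_on_differentiable[OF smooth_on_der[OF a] J(2)])
  have "der (\<lambda>y. dform a y u v) m w = der (\<lambda>y. der a y u) m w \<bullet> v - der (\<lambda>y. der a y v) m w \<bullet> u" for u v w
    unfolding dform_def
    by (rule fun_cong[OF der_eqI])
      (auto intro!: derivative_eq_intros smooth_on_has_derivative[OF smooth_on_der[OF a] J(2)])
  then show ?thesis
    unfolding dform_def
    by (auto intro!: derivative_eq_intros D X Y simp: inner_add_left inner_commute dform_def algebra_simps)
qed

lemma dform_vanishing_derivative:
  fixes a :: "'a::euclidean_space \<Rightarrow> 'a"
  assumes J: "open J" "m \<in> J" and a: "smooth_on J a"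
    and X: "smooth_on J X" and Y: "smooth_on J Y"
    and van: "\<And>y. y \<in> J \<Longrightarrow> dform a y (X y) (Y y) = 0"
  shows "der (\<lambda>y. dform a y (X m) (Y m)) m w + dform a m (der X m w) (Y m) + dform a m (X m) (der Y m w) = 0"
proof -
  have "((\<lambda>y. dform a y (X y) (Y y)) has_derivative (\<lambda>w. 0)) (at m)"
    using has_derivative_cong_open[OF J, of "\<lambda>y. dform a y (X y) (Y y)" "\<lambda>_. 0"] van by simp
  from has_derivative_unique[OF this dform_has_derivative[OF J a smooth_on_has_derivative[OF X J(2)]
        smooth_on_has_derivative[OF Y J(2)]]]
  show ?thesis by metis
qed

text \<open>Cartan's formula for the exterior derivative of a closed two-form: the three terms that
  differentiate function values drop out because the pairings vanish on all of \<open>J\<close>, and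
  the bracket terms survive.\<close>

lemma dform_cyclic_bracket:
  fixes a :: "'a::euclidean_space \<Rightarrow> 'a"
  assumes J: "open J" "m \<in> J" and a: "smooth_on J a"
    and X: "smooth_on J X" and Y: "smooth_on J Y" and Z: "smooth_on J Z"
    and "\<And>y. y \<in> J \<Longrightarrow> dform a y (X y) (Y y) = 0"
    and "\<And>y. y \<in> J \<Longrightarrow> dform a y (Y y) (Z y) = 0"
    and "\<And>y. y \<in> J \<Longrightarrow> dform a y (Z y) (X y) = 0"
  shows "dform a m (lie_bracket X Y m) (Z m) + dform a m (lie_bracket Y Z m) (X m)
    + dform a m (lie_bracket Z X m) (Y m) = 0"
proof -
  note van = dform_vanishing_derivative[OF J a]
  note lin = linear_diff[OF bilinear_dform(1)[OF smooth_on_differentiable[OF a J(2)]]]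
  have "dform a m (lie_bracket U V m) w = dform a m (der V m (U m)) w - dform a m (der U m (V m)) w" for U V w
    unfolding lie_bracket_def by (rule lin)
  then show ?thesis
    \<comment> \<open>Each vanishing pairing is differentiated along the third field; closedness
      cancels the derivatives of the form, and what is left regroups into brackets.\<close>
    using van[OF X Y assms(7), of "Z m"] van[OF Y Z assms(8), of "X m"] van[OF Z X assms(9), of "Y m"]
      dform_closed[OF J a, of "X m" "Y m" "Z m"]
      dform_antisym[of a m "X m" "der Y m (Z m)"] dform_antisym[of a m "Y m" "der Z m (X m)"]
      dform_antisym[of a m "Z m" "der X m (Y m)"]
    by simp
qed

section \<open>Lifts of a tensor field in a chart\<close>

lemma smooth_on_Pair:
  fixes f :: "'c::euclidean_space \<Rightarrow> 'a::euclidean_space" and g :: "'c \<Rightarrow> 'b::euclidean_space"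
  assumes "open S" "smooth_on S f" "smooth_on S g"
  shows "smooth_on S (\<lambda>x. (f x, g x))"
proof -
  have "bounded_linear (\<lambda>a::'a. (a, 0::'b))" "bounded_linear (\<lambda>b::'b. (0::'a, b))"
    by (auto intro: bounded_linear_Pair bounded_linear_ident bounded_linear_zero)
  from smooth_on_add[OF assms(1) smooth_on_bounded_linear[OF this(1) assms(1,2)]
      smooth_on_bounded_linear[OF this(2) assms(1,3)]]
  show ?thesis by simp
qed

lemma smooth_on_vec_lambda:
  fixes f :: "'i::finite \<Rightarrow> 'a::euclidean_space \<Rightarrow> real"
  assumes "open S" "\<And>i. smooth_on S (f i)"
  shows "smooth_on S (\<lambda>x. \<chi> i. f i x)"
proof -
  have "(\<chi> i. f i x) = (\<Sum>i\<in>UNIV. f i x *\<^sub>R axis i 1)" for x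
    by (simp add: vec_eq_iff axis_def if_distrib cong: if_cong)
  then show ?thesis
    using assms by (auto intro!: smooth_on_sum smooth_on_scaleR smooth_on_const)
qed

section \<open>The horizontal lift and its exterior derivative\<close>

text \<open>Only linearity and smoothness are assumed, so that the construction applies to the
  square of \<open>R\<close> as well as to \<open>R\<close>.\<close>

locale endo_field =
  fixes S :: "'n::finite base set" and T :: "'n base \<Rightarrow> 'n base \<Rightarrow> 'n base"
  assumes open_S: "open S"
    and linear_T: "x \<in> S \<Longrightarrow> linear (T x)"
    and smooth_T: "smooth_on S (\<lambda>x. T x v)"
begin

definition J :: "'n jet set" where "J = S \<times> UNIV"

text \<open>The first vector is the direction of differentiation, the second the argument of the
  tensor.\<close>

definition D :: "'n base \<Rightarrow> 'n base \<Rightarrow> 'n base \<Rightarrow> 'n base" where "D x v u = der (\<lambda>y. T y u) x v"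

text \<open>The covector field representing the horizontal lift; its zero second component says that
  momentum directions are annihilated.\<close>

definition hlift :: "'n jet \<Rightarrow> 'n jet" where "hlift m = (adjoint (T (fst m)) (0, snd m), 0)"

lemma open_J: "open J"
  by (simp add: J_def open_S open_Times)

lemma fst_J: "m \<in> J \<Longrightarrow> fst m \<in> S" "fst ` J \<subseteq> S"
  by (auto simp: J_def)

lemma has_derivative_T:
  assumes "x \<in> S" "(w has_derivative w') (at x)"
  shows "((\<lambda>x. T x (w x)) has_derivative (\<lambda>u. D x u (w x) + T x (w' u))) (at x)"
  unfolding D_def
  by (rule has_derivative_family_apply[OF open_S linear_T assms(1) _ assms(2)])
    (auto intro: smooth_on_differentiable[OF smooth_T assms(1)])

lemma linear_D:
  assumes x: "x \<in> S"
  shows "linear (\<lambda>v. D x v u)" "linear (D x v)"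
proof -
  show "linear (\<lambda>v. D x v u)"
    unfolding D_def by (rule linear_der[OF smooth_on_differentiable[OF smooth_T x]])
  have "D x v (u + u') = D x v u + D x v u'" for u u'
    unfolding D_def
  proof (rule fun_cong[OF der_eqI])
    have "((\<lambda>y. T y u + T y u') has_derivative (\<lambda>v. der (\<lambda>y. T y u) x v + der (\<lambda>y. T y u') x v)) (at x)"
      by (intro has_derivative_add smooth_on_has_derivative[OF smooth_T x])
    then show "((\<lambda>y. T y (u + u')) has_derivative (\<lambda>v. der (\<lambda>y. T y u) x v + der (\<lambda>y. T y u') x v)) (at x)"
      using has_derivative_cong_open[OF open_S x, of "\<lambda>y. T y (u + u')" "\<lambda>y. T y u + T y u'"]
        linear_add[OF linear_T] by blast
  qed
  moreover have "D x v (c *\<^sub>R u) = c *\<^sub>R D x v u" for c u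
    unfolding D_def
  proof (rule fun_cong[OF der_eqI])
    have "((\<lambda>y. c *\<^sub>R T y u) has_derivative (\<lambda>v. c *\<^sub>R der (\<lambda>y. T y u) x v)) (at x)"
      by (intro has_derivative_scaleR_right smooth_on_has_derivative[OF smooth_T x])
    then show "((\<lambda>y. T y (c *\<^sub>R u)) has_derivative (\<lambda>v. c *\<^sub>R der (\<lambda>y. T y u) x v)) (at x)"
      using has_derivative_cong_open[OF open_S x, of "\<lambda>y. T y (c *\<^sub>R u)" "\<lambda>y. c *\<^sub>R T y u"]
        linear_scale[OF linear_T] by blast
  qed
  ultimately show "linear (D x v)" by (rule linearI)
qed

lemma smooth_T_fst: "smooth_on J (\<lambda>m. T (fst m) v)"
  by (rule smooth_on_compose[OF open_J open_S fst_J(2)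
        smooth_on_bounded_linear[OF bounded_linear_fst open_J smooth_on_id[OF open_J]] smooth_T])

lemma smooth_D_fst: "smooth_on J (\<lambda>m. D (fst m) v u)"
  unfolding D_def
  by (rule smooth_on_compose[OF open_J open_S fst_J(2)
        smooth_on_bounded_linear[OF bounded_linear_fst open_J smooth_on_id[OF open_J]]
        smooth_on_der[OF smooth_T]])

lemma smooth_momentum: "smooth_on J (\<lambda>m. (0 :: real, snd m))"
  by (intro smooth_on_Pair open_J smooth_on_const
      smooth_on_bounded_linear[OF bounded_linear_snd open_J smooth_on_id[OF open_J]])

lemma hlift_inner: "m \<in> J \<Longrightarrow> hlift m \<bullet> v = (0, snd m) \<bullet> T (fst m) (fst v)"
  using adjoint_works[OF linear_T[OF fst_J(1)], of m "fst v" "(0, snd m)"]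
  by (cases v) (simp add: hlift_def inner_commute del: inner_Pair_0)

lemma smooth_hlift: "smooth_on J hlift"
proof (rule smooth_on_cong[OF open_J])
  \<comment> \<open>Pairing with basis vectors replaces \<open>adjoint\<close> by \<open>T\<close>
    itself, whose smoothness is known.\<close>
  show "smooth_on J (\<lambda>m. \<Sum>b\<in>Basis. ((0, snd m) \<bullet> T (fst m) (fst b)) *\<^sub>R b)"
    by (intro smooth_on_sum smooth_on_scaleR smooth_on_inner open_J smooth_on_const smooth_momentum
        smooth_T_fst)
  show "(\<Sum>b\<in>Basis. ((0, snd m) \<bullet> T (fst m) (fst b)) *\<^sub>R b) = hlift m" if "m \<in> J" for m
    using euclidean_representation[of "hlift m"] by (simp add: hlift_inner[OF that])
qed

lemma der_hlift:
  assumes m: "m \<in> J"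
  shows "der hlift m u \<bullet> v = (0, snd m) \<bullet> D (fst m) (fst u) (fst v) + (0, snd u) \<bullet> T (fst m) (fst v)"
proof -
  have "((\<lambda>m. hlift m \<bullet> v) has_derivative (\<lambda>u. der hlift m u \<bullet> v)) (at m)"
    by (intro has_derivative_inner_left smooth_on_has_derivative[OF smooth_hlift m])
  moreover have "((\<lambda>m. (0, snd m) \<bullet> T (fst m) (fst v)) has_derivative
      (\<lambda>u. (0, snd m) \<bullet> D (fst m) (fst u) (fst v) + (0, snd u) \<bullet> T (fst m) (fst v))) (at m)"
    unfolding D_def
    by (intro has_derivative_inner has_derivative_Pair has_derivative_const has_derivative_snd
        has_derivative_ident has_derivative_compose[OF has_derivative_fst[OF has_derivative_ident]
          smooth_on_has_derivative[OF smooth_T fst_J(1)[OF m]]])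
  ultimately show ?thesis
    using has_derivative_cong_open[OF open_J m, of "\<lambda>m. hlift m \<bullet> v" "\<lambda>m. (0, snd m) \<bullet> T (fst m) (fst v)"]
      hlift_inner has_derivative_unique by (metis (no_types, lifting))
qed

lemma dform_hlift:
  assumes "m \<in> J"
  shows "dform hlift m u v = (0, snd m) \<bullet> (D (fst m) (fst u) (fst v) - D (fst m) (fst v) (fst u))
    + (0, snd u) \<bullet> T (fst m) (fst v) - (0, snd v) \<bullet> T (fst m) (fst u)"
  by (simp add: dform_def der_hlift[OF assms] inner_diff_right del: inner_Pair)

lemma omegaR_eq_dform:
  assumes m: "m \<in> J"
  shows "omegaR T m = dform hlift m"
proof (intro ext)
  fix u v
  have "((\<lambda>y. horizontal_lift T y v) has_derivative (\<lambda>u. der hlift m u \<bullet> v)) (at m)" for v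
  proof -
    have "((\<lambda>m. hlift m \<bullet> v) has_derivative (\<lambda>u. der hlift m u \<bullet> v)) (at m)"
      by (intro has_derivative_inner_left smooth_on_has_derivative[OF smooth_hlift m])
    moreover have "hlift y \<bullet> v = horizontal_lift T y v" for y
      unfolding horizontal_lift_def hlift_def
      by (cases v) (simp only: inner_Pair inner_zero_right fst_conv add_0_right inner_commute)
    ultimately show ?thesis by simp
  qed
  from der_eqI[OF this] show "omegaR T m u v = dform hlift m u v"
    by (simp add: omegaR_def ext_d_def dform_def)
qed

end

lemma base_snd_expand: "(0, q) = (\<Sum>i\<in>UNIV. (q $ i) *\<^sub>R (0, axis i 1))"
  for q :: "real ^ 'n"
proof -
  have "(\<Sum>i\<in>UNIV. (q $ i) *\<^sub>R axis i 1) = q"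
    by (simp add: vec_eq_iff axis_def if_distrib cong: if_cong)
  then show ?thesis by (simp add: prod_eq_iff fst_sum snd_sum)
qed

lemma linear_base_snd:
  fixes f :: "'n::finite base \<Rightarrow> real"
  assumes "linear f"
  shows "(\<chi> i. f (0, axis i 1)) \<bullet> q = f (0, q)"
proof -
  interpret linear f by fact
  have "f (0, q) = (\<Sum>i\<in>UNIV. (q $ i) * f (0, axis i 1))"
    by (subst base_snd_expand) (simp only: sum scale real_scaleR_def)
  then show ?thesis by (simp add: inner_vec_def mult.commute)
qed

lemma der_jet_expand:
  fixes f :: "'n::finite jet \<Rightarrow> real"
  assumes "f differentiable (at m)"
  shows "der f m w = fst (fst w) * pd_t f m + (\<chi> i. pd_Q i f m) \<bullet> snd (fst w)
    + (\<chi> i. pd_P i f m) \<bullet> snd w"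
proof -
  interpret linear "der f m" by (rule linear_der[OF assms])
  have w: "w = fst (fst w) *\<^sub>R ((1, 0), 0) + (((0, snd (fst w)), 0) + ((0, 0), snd w))"
    by (simp add: prod_eq_iff)
  have "linear (\<lambda>x. der f m (x, 0))" "linear (\<lambda>x :: 'n base. der f m (0, snd x))"
    using add[of "(_, 0)" "(_, 0)"] scale[of _ "(_, 0)"] add[of "(0, _)" "(0, _)"] scale[of _ "(0, _)"]
    by (auto intro!: linearI)
  from this[THEN linear_base_snd] show ?thesis
    by (subst w) (simp only: add scale, simp add: pd_t_def pd_Q_def pd_P_def zero_prod_def)
qed

lemma linear_sum_Basis_inner:
  fixes f :: "'a::euclidean_space \<Rightarrow> real"
  assumes "linear f"
  shows "(\<Sum>b\<in>Basis. f b *\<^sub>R b) \<bullet> u = f u"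
proof -
  interpret linear f by fact
  have "f u = f (\<Sum>b\<in>Basis. (u \<bullet> b) *\<^sub>R b)" by (simp add: euclidean_representation)
  then show ?thesis by (simp add: sum scale inner_sum_left inner_commute[of u] mult.commute)
qed

section \<open>The Hamiltonian vector field in coordinates\<close>

text \<open>Constant fields carry the torsion condition: they yield the pointwise identity
  \<open>torsion_eq\<close>, the form in which it is applied.\<close>

locale hamiltonian_chart = endo_field S R
  for S :: "'n::finite base set" and R :: "'n base \<Rightarrow> 'n base \<Rightarrow> 'n base" +
  fixes h :: "'n jet \<Rightarrow> 'n cot"
  assumes R_dt: "x \<in> S \<Longrightarrow> adjoint (R x) dt = 0"
    and torsion: "x \<in> S \<Longrightarrow> nijenhuis R (\<lambda>_. u) (\<lambda>_. v) x = 0"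
    and smooth_h: "smooth_on J h"
    and rho_h: "m \<in> J \<Longrightarrow> rho (h m) = m"
begin

abbreviation H :: "'n jet \<Rightarrow> real" where "H \<equiv> hamiltonian h"

definition poincare_cartan :: "'n jet \<Rightarrow> 'n jet" where "poincare_cartan m = ((- H m, snd m), 0)"

lemma smooth_H: "smooth_on J H"
  unfolding hamiltonian_def[abs_def]
  by (intro smooth_on_minus smooth_on_bounded_linear[OF bounded_linear_fst]
      smooth_on_bounded_linear[OF bounded_linear_snd] open_J smooth_h)

lemma h_eq: "m \<in> J \<Longrightarrow> h m = (fst m, (- H m, snd m))"
  using rho_h[of m] by (auto simp: rho_def hamiltonian_def prod_eq_iff)

lemma has_derivative_H: "m \<in> J \<Longrightarrow> (H has_derivative der H m) (at m)"
  by (rule smooth_on_has_derivative[OF smooth_H])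

lemma smooth_poincare_cartan: "smooth_on J poincare_cartan"
  unfolding poincare_cartan_def[abs_def]
  by (intro smooth_on_Pair smooth_on_minus smooth_H smooth_on_const open_J
      smooth_on_bounded_linear[OF bounded_linear_snd open_J smooth_on_id[OF open_J]])

lemma dform_poincare_cartan:
  assumes m: "m \<in> J"
  shows "dform poincare_cartan m u v
    = - der H m u * fst (fst v) + snd u \<bullet> snd (fst v) + der H m v * fst (fst u) - snd v \<bullet> snd (fst u)"
proof -
  have "(poincare_cartan has_derivative (\<lambda>u. ((- der H m u, snd u), 0))) (at m)"
    unfolding poincare_cartan_def[abs_def]
    by (intro has_derivative_Pair has_derivative_minus has_derivative_H m has_derivative_const
        has_derivative_snd has_derivative_ident)
  from der_eqI[OF this] show ?thesis by (simp add: dform_def inner_prod_def)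
qed

lemma omegaE_eq: "omegaE z u v = snd u \<bullet> fst v - snd v \<bullet> fst u"
  for z u v :: "'n cot"
proof -
  have "((\<lambda>y. theta y w) has_derivative (\<lambda>v. snd v \<bullet> fst w)) (at z)" for w :: "'n cot"
    unfolding theta_def by (auto intro!: derivative_eq_intros)
  from der_eqI[OF this] show ?thesis by (simp add: omegaE_def ext_d_def)
qed

lemma pullback_h:
  assumes m: "m \<in> J"
  shows "pullback2 h omegaE m u v = dform poincare_cartan m u v"
proof -
  have "((\<lambda>m. (fst m, (- H m, snd m))) has_derivative (\<lambda>u. (fst u, (- der H m u, snd u)))) (at m)"
    by (intro has_derivative_Pair has_derivative_minus has_derivative_H m has_derivative_fst
        has_derivative_snd has_derivative_ident)
  then have "(h has_derivative (\<lambda>u. (fst u, (- der H m u, snd u)))) (at m)"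
    using has_derivative_cong_open[OF open_J m, of h "\<lambda>m. (fst m, (- H m, snd m))"] h_eq by blast
  from der_eqI[OF this] show ?thesis
    by (simp add: pullback2_def omegaE_eq dform_poincare_cartan[OF m] inner_prod_def)
qed

lemma ham_field_eq:
  assumes m: "m \<in> J"
  shows "ham_field h m = ((1, \<chi> i. pd_P i H m), - (\<chi> i. pd_Q i H m))"
  unfolding ham_field_def
proof (rule the_equality)
  let ?X = "((1, \<chi> i. pd_P i H m), - (\<chi> i. pd_Q i H m))"
  note ex = der_jet_expand[OF smooth_on_differentiable[OF smooth_H m]]
  show "(\<forall>w. pullback2 h omegaE m ?X w = 0) \<and> fst ?X \<bullet> dt = 1"
    by (simp add: pullback_h[OF m] dform_poincare_cartan[OF m] ex dt_def inner_commute algebra_simps)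
  fix v assume v: "(\<forall>w. pullback2 h omegaE m v w = 0) \<and> fst v \<bullet> dt = 1"
  then have t: "fst (fst v) = 1" by (simp add: dt_def inner_prod_def)
  have z: "dform poincare_cartan m v w = 0" for w using v unfolding pullback_h[OF m] by blast
  \<comment> \<open>Testing with pure momentum vectors fixes the \<open>q\<close> part of
    \<open>v\<close>, testing with pure \<open>q\<close> vectors its momentum part.\<close>
  have "p \<bullet> snd (fst v) = p \<bullet> (\<chi> i. pd_P i H m)" for p
    using z[of "((0, 0), p)"] t
    by (simp add: dform_poincare_cartan[OF m] ex[of "((0, 0), p)"] inner_commute)
  moreover have "q \<bullet> snd v = q \<bullet> - (\<chi> i. pd_Q i H m)" for q
    using z[of "((0, q), 0)"] t
    by (simp add: dform_poincare_cartan[OF m] ex[of "((0, q), 0)"] inner_commute)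
  ultimately have "snd (fst v) = (\<chi> i. pd_P i H m)" "snd v = - (\<chi> i. pd_Q i H m)"
    by (metis vector_eq_ldot)+
  with t show "v = ?X" by (simp add: prod_eq_iff)
qed

text \<open>Dually, \<open>R(dt) = 0\<close> says that all values of \<open>R\<close> are tangent to
  the fibres over time.\<close>

lemma fst_R: "x \<in> S \<Longrightarrow> fst (R x v) = 0"
  using adjoint_works[OF linear_T, of x v dt] R_dt[of x] by (simp add: dt_def inner_prod_def)

lemma fst_D:
  assumes x: "x \<in> S"
  shows "fst (D x v u) = 0"
proof -
  have "((\<lambda>y. fst (R y u)) has_derivative (\<lambda>v. fst (D x v u))) (at x)"
    unfolding D_def by (intro has_derivative_fst smooth_on_has_derivative[OF smooth_T x])
  moreover have "((\<lambda>y. fst (R y u)) has_derivative (\<lambda>v. 0)) (at x)"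
    using has_derivative_cong_open[OF open_S x, of "\<lambda>y. fst (R y u)" "\<lambda>_. 0"] fst_R by simp
  ultimately show ?thesis using has_derivative_unique by metis
qed

text \<open>For constant fields \<open>[u,v] = 0\<close>, and only derivatives of \<open>R\<close>
  contribute to the remaining brackets.\<close>

lemma torsion_eq:
  assumes x: "x \<in> S"
  shows "D x (R x u) v - D x (R x v) u = R x (D x u v - D x v u)"
proof -
  have "der (\<lambda>y. w) x = (\<lambda>_. 0)" for w :: "'n base" by (rule der_eqI[OF has_derivative_const])
  then show ?thesis
    unfolding D_def linear_diff[OF linear_T[OF x]]
    using torsion[OF x, of u v] linear_0[OF linear_T[OF x]]
      linear_neg[OF linear_T[OF x]]
    by (simp add: nijenhuis_def lie_bracket_def linear_0[OF linear_der[OF smooth_on_differentiable[OF smooth_T x]]]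
        algebra_simps)
qed

lemma adjoint_R_inner: "x \<in> S \<Longrightarrow> adjoint (R x) P \<bullet> u = P \<bullet> R x u"
  using adjoint_works[OF linear_T, of x u P] by (simp only: inner_commute)

lemma linear_inner_R: "x \<in> S \<Longrightarrow> linear (\<lambda>u. Q \<bullet> R x u)"
  using linear_compose[OF linear_T bounded_linear.linear[OF bounded_linear_inner_right]]
  by (simp add: o_def)

lemma linear_inner_D: "x \<in> S \<Longrightarrow> linear (\<lambda>u. P \<bullet> D x v u)" "x \<in> S \<Longrightarrow> linear (\<lambda>u. P \<bullet> D x u v)"
  using linear_compose[OF linear_D(1) bounded_linear.linear[OF bounded_linear_inner_right]]
    linear_compose[OF linear_D(2) bounded_linear.linear[OF bounded_linear_inner_right]]
  by (simp_all add: o_def)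

lemma linear_inner_curl: "x \<in> S \<Longrightarrow> linear (\<lambda>u. P \<bullet> (D x v u - D x u v))"
  using linear_compose_sub[OF linear_inner_D] by (simp add: inner_diff_right)

section \<open>The complete lift in coordinates\<close>

text \<open>The coordinate form of the complete lift. Its momentum part combines the transpose of
  \<open>R\<close> with the curl of the covector field obtained by contracting \<open>R\<close> with
  the momenta, and is assembled from its values on the axes.\<close>

definition N :: "'n jet \<Rightarrow> 'n jet \<Rightarrow> 'n jet" where
  "N m v = (R (fst m) (fst v), \<chi> i. (0, snd v) \<bullet> R (fst m) (0, axis i 1)
    + (0, snd m) \<bullet> (D (fst m) (fst v) (0, axis i 1) - D (fst m) (0, axis i 1) (fst v)))"

lemma snd_N:
  assumes "m \<in> J"
  shows "snd (N m v) \<bullet> q = (0, snd v) \<bullet> R (fst m) (0, q)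
    + (0, snd m) \<bullet> (D (fst m) (fst v) (0, q) - D (fst m) (0, q) (fst v))"
proof -
  note x = fst_J(1)[OF assms]
  from linear_compose_add[OF linear_inner_R[OF x] linear_inner_curl[OF x]]
  have "linear (\<lambda>w. (0, snd v) \<bullet> R (fst m) w + (0, snd m) \<bullet> (D (fst m) (fst v) w - D (fst m) w (fst v)))" .
  from linear_base_snd[OF this] show ?thesis by (simp add: N_def del: inner_Pair)
qed

text \<open>The pullback of \<open>omegaE\<close> under \<open>tauR\<close> consists of a transpose
  term and a curl term of \<open>R\<close>; nondegeneracy of \<open>omegaE\<close> then determines
  the lift componentwise.\<close>

lemma complete_lift_cot_eq:
  assumes x: "fst z \<in> S"
  shows "complete_lift_cot R z w = (R (fst z) (fst w),
    adjoint (R (fst z)) (snd w)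
      + (\<Sum>b\<in>Basis. (snd z \<bullet> (D (fst z) (fst w) b - D (fst z) b (fst w))) *\<^sub>R b))"
proof -
  let ?C = "\<Sum>b\<in>Basis. (snd z \<bullet> (D (fst z) (fst w) b - D (fst z) b (fst w))) *\<^sub>R b"
  let ?u = "(R (fst z) (fst w), adjoint (R (fst z)) (snd w) + ?C)"
  have C: "?C \<bullet> v = snd z \<bullet> (D (fst z) (fst w) v - D (fst z) v (fst w))" for v
    by (rule linear_sum_Basis_inner[OF linear_inner_curl[OF x]])
  have tau: "(tauR R has_derivative (\<lambda>w. (fst w, \<Sum>b\<in>Basis.
      (snd z \<bullet> D (fst z) (fst w) b + snd w \<bullet> R (fst z) b) *\<^sub>R b))) (at z)"
  proof -
    have op: "open (S \<times> (UNIV :: 'n base set))" and z: "z \<in> S \<times> UNIV"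
      using open_S x by (auto intro: open_Times simp: mem_Times_iff)
    have "((\<lambda>z. (fst z, \<Sum>b\<in>Basis. (snd z \<bullet> R (fst z) b) *\<^sub>R b)) has_derivative (\<lambda>w. (fst w, \<Sum>b\<in>Basis.
      (snd z \<bullet> D (fst z) (fst w) b + snd w \<bullet> R (fst z) b) *\<^sub>R b))) (at z)"
      unfolding D_def
      by (intro has_derivative_Pair has_derivative_sum has_derivative_inner has_derivative_fst
          has_derivative_snd has_derivative_ident has_derivative_scaleR_left
          has_derivative_compose[OF has_derivative_fst[OF has_derivative_ident]
            smooth_on_has_derivative[OF smooth_T x]])
    moreover have "(fst z, \<Sum>b\<in>Basis. (snd z \<bullet> R (fst z) b) *\<^sub>R b) = tauR R z" if "z \<in> S \<times> UNIV" for z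
      using that euclidean_representation[of "adjoint (R (fst z)) (snd z)"]
        adjoint_works[OF linear_T, of "fst z" _ "snd z"]
      by (auto simp: tauR_def mem_Times_iff inner_commute)
    ultimately show ?thesis
      using has_derivative_cong_open[OF op z, of "\<lambda>z. (fst z, \<Sum>b\<in>Basis. (snd z \<bullet> R (fst z) b) *\<^sub>R b)" "tauR R"]
      by blast
  qed
  have sumE: "(\<Sum>b\<in>Basis. (P \<bullet> D (fst z) v b + Q \<bullet> R (fst z) b) *\<^sub>R b) \<bullet> u
      = P \<bullet> D (fst z) v u + Q \<bullet> R (fst z) u" for P Q v u
    by (rule linear_sum_Basis_inner[OF linear_compose_add[OF linear_inner_D(1)[OF x] linear_inner_R[OF x]]])
  have pull: "pullback2 (tauR R) omegaE z w w' = snd z \<bullet> (D (fst z) (fst w) (fst w') - D (fst z) (fst w') (fst w))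
      + snd w \<bullet> R (fst z) (fst w') - snd w' \<bullet> R (fst z) (fst w)" for w'
    unfolding pullback2_def der_eqI[OF tau] by (simp add: omegaE_eq sumE inner_diff_right)
  have om: "omegaE z ?u w' = pullback2 (tauR R) omegaE z w w'" for w'
    by (simp add: pull omegaE_eq inner_add_left C adjoint_R_inner[OF x])
  show ?thesis
    unfolding complete_lift_cot_def
  proof (rule the_equality)
    show "\<forall>w'. omegaE z ?u w' = pullback2 (tauR R) omegaE z w w'" using om by blast
    fix u assume "\<forall>w'. omegaE z u w' = pullback2 (tauR R) omegaE z w w'"
    then have eq: "omegaE z u w' = omegaE z ?u w'" for w' unfolding om by blast
    show "u = ?u"
    proof (rule prod_eqI)
      have "p \<bullet> fst u = p \<bullet> fst ?u" for p
        using eq[of "(0, p)"] by (simp add: omegaE_eq)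
      then show "fst u = fst ?u" using vector_eq_ldot by blast
      have "snd u \<bullet> q = snd ?u \<bullet> q" for q
        using eq[of "(q, 0)"] by (simp add: omegaE_eq)
      then show "snd u = snd ?u" using vector_eq_rdot by blast
    qed
  qed
qed

text \<open>All values of \<open>R\<close> and of its derivatives have zero time component, so
  \<open>p\<^sub>0\<close> and its variation never enter the projected lift, and every
  representative gives the same result.\<close>

lemma complete_lift_eq:
  assumes m: "m \<in> J"
  shows "complete_lift R m v = N m v"
proof -
  note x = fst_J(1)[OF m]
  have rho: "der rho z w = rho w" for z w :: "'n cot"
  proof -
    have "(rho has_derivative rho) (at z)"
      unfolding rho_def[abs_def]
      by (intro has_derivative_Pair has_derivative_fst has_derivative_snd has_derivative_ident)
    from der_eqI[OF this] show ?thesis by simp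
  qed
  have inner0: "P \<bullet> u = (0, snd P) \<bullet> u" if "fst u = 0" for P u :: "'n base"
    using that by (simp add: inner_prod_def)
  have "rho (complete_lift_cot R z w) = N m v" if z: "rho z = m" and w: "rho w = v" for z w
  proof -
    have zm: "fst z = fst m" "snd (snd z) = snd m" "fst w = fst v" "snd (snd w) = snd v"
      using z w by (auto simp: rho_def)
    have xz: "fst z \<in> S" using x zm by simp
    let ?C = "\<Sum>b\<in>Basis. (snd z \<bullet> (D (fst m) (fst v) b - D (fst m) b (fst v))) *\<^sub>R b"
    have "snd (adjoint (R (fst m)) (snd w) + ?C) \<bullet> q = snd (N m v) \<bullet> q" for q
    proof -
      have C: "?C \<bullet> (0, q) = snd z \<bullet> (D (fst m) (fst v) (0, q) - D (fst m) (0, q) (fst v))"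
        by (rule linear_sum_Basis_inner[OF linear_inner_curl[OF x]])
      have "snd (adjoint (R (fst m)) (snd w) + ?C) \<bullet> q = (adjoint (R (fst m)) (snd w) + ?C) \<bullet> (0, q)"
        by (simp add: inner_prod_def[of _ "(0, q)"])
      also have "\<dots> = snd w \<bullet> R (fst m) (0, q) + snd z \<bullet> (D (fst m) (fst v) (0, q) - D (fst m) (0, q) (fst v))"
        by (simp add: inner_add_left C adjoint_R_inner[OF x] del: inner_Pair)
      also have "\<dots> = snd (N m v) \<bullet> q"
        unfolding snd_N[OF m] zm(2,4)[symmetric]
        by (intro arg_cong2[of _ _ _ _ "(+)"] inner0) (simp_all add: fst_R[OF x] fst_D[OF x])
      finally show ?thesis .
    qed
    then have "snd (adjoint (R (fst m)) (snd w) + ?C) = snd (N m v)" using vector_eq_rdot by blast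
    then show ?thesis
      unfolding complete_lift_cot_eq[OF xz] by (simp add: rho_def zm N_def)
  qed
  note lift = this
  show ?thesis
    unfolding complete_lift_def rho
  proof (rule the_equality)
    show "\<forall>z w. rho z = m \<and> rho w = v \<longrightarrow> rho (complete_lift_cot R z w) = N m v"
      using lift by blast
    fix u assume "\<forall>z w. rho z = m \<and> rho w = v \<longrightarrow> rho (complete_lift_cot R z w) = u"
    \<comment> \<open>Representatives with zero time component show that the defining condition is
      not vacuous, whence uniqueness.\<close>
    moreover have "rho (fst m, (0, snd m)) = m" "rho (fst v, (0, snd v)) = v"
      by (simp_all add: rho_def)
    ultimately show "u = N m v" using lift by metis
  qed
qed

section \<open>Relations among the three two-forms\<close>

lemma endo_field_square: "endo_field S (\<lambda>x v. R x (R x v))"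
proof (rule endo_field.intro[OF open_S])
  show "linear (\<lambda>v. R x (R x v))" if "x \<in> S" for x
    using linear_compose[OF linear_T[OF that] linear_T[OF that]] by (simp add: o_def)
qed (rule smooth_on_family_apply[OF open_S linear_T smooth_T smooth_T])

text \<open>The horizontal lift of the square supplies the form \<open>d\<^sub>2\<close>.\<close>

sublocale R2: endo_field S "\<lambda>x v. R x (R x v)"
  by (rule endo_field_square)

lemma R2_D: "x \<in> S \<Longrightarrow> R2.D x v u = D x v (R x u) + R x (D x v u)"
  using der_eqI[OF has_derivative_T[OF _ smooth_on_has_derivative[OF smooth_T]], of x u]
  by (simp add: R2.D_def D_def)

lemma fst_fst_N: "m \<in> J \<Longrightarrow> fst (fst (N m v)) = 0"
  by (simp add: N_def fst_R fst_J)

text \<open>With \<open>dt(u) = 0\<close> and \<open>dt(Nv) = 0\<close>, the terms containing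
  \<open>der H\<close> drop out of the Poincare-Cartan side, and the canonical pairing reproduces
  the definition of \<open>N\<close>.\<close>

lemma dform_hlift_N:
  assumes m: "m \<in> J" and u: "fst (fst u) = 0"
  shows "dform hlift m u v = dform poincare_cartan m u (N m v)"
proof -
  have "(0, snd (fst u)) = fst u" using u by (simp add: prod_eq_iff)
  then have "snd (N m v) \<bullet> snd (fst u) = (0, snd v) \<bullet> R (fst m) (fst u)
    + (0, snd m) \<bullet> (D (fst m) (fst v) (fst u) - D (fst m) (fst u) (fst v))"
    using snd_N[OF m, of v "snd (fst u)"] by simp
  moreover have "snd u \<bullet> snd (fst (N m v)) = (0, snd u) \<bullet> R (fst m) (fst v)"
    by (simp add: N_def inner_prod_def[of "(0, _)"])
  ultimately show ?thesis
    using u by (simp add: dform_hlift[OF m] dform_poincare_cartan[OF m] fst_fst_N[OF m] inner_diff_right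
        del: inner_Pair)
qed

text \<open>Expanding both sides leaves a difference of derivatives of \<open>R\<close>, which is
  the identity provided by the vanishing torsion; \<open>dt(u)\<close> is arbitrary here.\<close>

lemma dform_square_hlift:
  assumes m: "m \<in> J"
  shows "dform R2.hlift m u v = dform hlift m u (N m v)"
proof -
  note x = fst_J(1)[OF m]
  have Ru: "R (fst m) (fst u) = (0, snd (R (fst m) (fst u)))"
    using fst_R[OF x] by (simp add: prod_eq_iff)
  have "(0, snd (N m v)) \<bullet> R (fst m) (fst u) = snd (N m v) \<bullet> snd (R (fst m) (fst u))"
    by (simp add: inner_prod_def)
  also have "\<dots> = (0, snd v) \<bullet> R (fst m) (R (fst m) (fst u))
    + (0, snd m) \<bullet> (D (fst m) (fst v) (R (fst m) (fst u)) - D (fst m) (R (fst m) (fst u)) (fst v))"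
    unfolding snd_N[OF m] Ru[symmetric] ..
  finally have *: "(0, snd (N m v)) \<bullet> R (fst m) (fst u) = \<dots>" .
  have tor: "(0, snd m) \<bullet> D (fst m) (R (fst m) (fst u)) (fst v) - (0, snd m) \<bullet> D (fst m) (R (fst m) (fst v)) (fst u)
    = (0, snd m) \<bullet> R (fst m) (D (fst m) (fst u) (fst v)) - (0, snd m) \<bullet> R (fst m) (D (fst m) (fst v) (fst u))"
    using arg_cong[OF torsion_eq[OF x, of "fst u" "fst v"], of "\<lambda>w. (0, snd m) \<bullet> w"]
    by (simp add: inner_diff_right linear_diff[OF linear_T[OF x]] del: inner_Pair)
  have N1: "fst (N m v) = R (fst m) (fst v)" by (simp add: N_def)
  show ?thesis
    unfolding R2.dform_hlift[OF m] dform_hlift[OF m] R2_D[OF x] * N1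
    using tor by (simp add: inner_diff_right inner_add_right del: inner_Pair)
qed

lemma linear_dform:
  assumes m: "m \<in> J"
  shows "linear (\<lambda>u. dform poincare_cartan m u v)" "linear (\<lambda>v. dform poincare_cartan m u v)"
    "linear (\<lambda>u. dform hlift m u v)" "linear (\<lambda>v. dform hlift m u v)"
  by (intro bilinear_dform smooth_on_differentiable[OF smooth_poincare_cartan m]
      smooth_on_differentiable[OF smooth_hlift m])+

section \<open>Pairings of the iterated fields\<close>

abbreviation F :: "nat \<Rightarrow> 'n jet \<Rightarrow> 'n jet" where "F a m \<equiv> iterate_field R h m a"

lemma F_0: "F 0 m = ham_field h m"
  by (simp add: iterate_field_def)

lemma F_Suc: "m \<in> J \<Longrightarrow> F (Suc a) m = N m (F a m)"
  by (simp add: iterate_field_def complete_lift_eq)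

lemma fst_fst_F: "m \<in> J \<Longrightarrow> fst (fst (F a m)) = (if a = 0 then 1 else 0)"
  by (cases a) (auto simp: F_0 ham_field_eq F_Suc fst_fst_N)

lemma dform_pc_F0:
  assumes m: "m \<in> J"
  shows "dform poincare_cartan m (F 0 m) w = 0" "dform poincare_cartan m w (F 0 m) = 0"
proof -
  note ex = der_jet_expand[OF smooth_on_differentiable[OF smooth_H m]]
  show "dform poincare_cartan m (F 0 m) w = 0"
    unfolding F_0 ham_field_eq[OF m]
    by (simp add: dform_poincare_cartan[OF m] ex inner_commute algebra_simps)
  then show "dform poincare_cartan m w (F 0 m) = 0" by (simp add: dform_antisym[of _ m w])
qed

text \<open>Everything is expressed through \<open>d\<^sub>0\<close>: passing to
  \<open>d\<^sub>1\<close> or \<open>d\<^sub>2\<close> amounts to raising the index of the field by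
  one or two.\<close>

lemma dform_F_shift:
  assumes m: "m \<in> J" and u: "fst (fst u) = 0"
  shows "dform hlift m u (F l m) = dform poincare_cartan m u (F (Suc l) m)"
    "dform R2.hlift m u (F l m) = dform poincare_cartan m u (F (Suc (Suc l)) m)"
  using assms by (simp_all add: dform_square_hlift dform_hlift_N F_Suc)

text \<open>\<open>N\<close> is self-adjoint for \<open>d\<^sub>1\<close>, so the value depends on
  \<open>a + b\<close> only; antisymmetry then makes it equal to its own negative.\<close>

lemma dform_hlift_F:
  assumes m: "m \<in> J"
  shows "dform hlift m (F a m) (F b m) = 0"
proof -
  have "dform hlift m (N m u) v = dform hlift m u (N m v)" for u v
    using dform_hlift_N[OF m fst_fst_N[OF m], of u v] dform_hlift_N[OF m fst_fst_N[OF m], of v u]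
      dform_antisym[of hlift m "N m v" u] dform_antisym[of poincare_cartan m "N m v" "N m u"] by simp
  then have shift: "dform hlift m (F (Suc a) m) (F b m) = dform hlift m (F a m) (F (Suc b) m)" for a b
    by (simp add: F_Suc[OF m])
  have sum: "dform hlift m (F a m) (F b m) = dform hlift m (F 0 m) (F (a + b) m)" for a b
    by (induction a arbitrary: b) (simp_all add: shift)
  show ?thesis
    using sum[of a b] sum[of "a + b" 0] dform_antisym[of hlift m "F (a + b) m" "F 0 m"] by simp
qed

lemma dform_pc_F:
  assumes m: "m \<in> J"
  shows "dform poincare_cartan m (F a m) (F b m) = 0"
proof (cases a)
  case (Suc a')
  show ?thesis
  proof (cases b)
    case (Suc b')
    then show ?thesis
      using dform_F_shift(1)[OF m, of "F a m" b'] dform_hlift_F[OF m] fst_fst_F[OF m] \<open>a = Suc a'\<close> by simp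
  qed (simp add: dform_pc_F0[OF m])
qed (simp add: dform_pc_F0[OF m])

lemma dform_square_F: "m \<in> J \<Longrightarrow> dform R2.hlift m (F a m) (F b m) = 0"
  by (simp add: dform_square_hlift F_Suc[symmetric] dform_hlift_F)

lemma linear_N:
  assumes m: "m \<in> J"
  shows "linear (N m)"
proof -
  note x = fst_J(1)[OF m]
  have inner: "snd (N m v) \<bullet> q = (0, snd v) \<bullet> R (fst m) (0, q)
    + (0, snd m) \<bullet> D (fst m) (fst v) (0, q) - (0, snd m) \<bullet> D (fst m) (0, q) (fst v)" for v q
    using snd_N[OF m] by (simp add: inner_diff_right)
  have pair: "((0 :: real), a + b) = (0, a) + (0, b)" "((0 :: real), c *\<^sub>R a) = c *\<^sub>R (0, a)"
    for a b :: "real ^ 'n" and c by auto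
  show ?thesis
  proof (rule linearI; rule prod_eqI)
    fix u v :: "'n jet" and c :: real
    show "fst (N m (u + v)) = fst (N m u + N m v)" "fst (N m (c *\<^sub>R v)) = fst (c *\<^sub>R N m v)"
      by (simp_all add: N_def linear_add[OF linear_T[OF x]] linear_scale[OF linear_T[OF x]])
    have "snd (N m (u + v)) \<bullet> q = snd (N m u + N m v) \<bullet> q" for q
      by (simp add: inner inner_add_left pair(1) linear_add[OF linear_D(1)[OF x]]
          linear_add[OF linear_D(2)[OF x]] inner_add_right del: inner_Pair add_Pair)
    then show "snd (N m (u + v)) = snd (N m u + N m v)" using vector_eq_rdot by blast
    have "snd (N m (c *\<^sub>R v)) \<bullet> q = snd (c *\<^sub>R N m v) \<bullet> q" for q
      by (simp add: inner pair(2) linear_scale[OF linear_D(1)[OF x]]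
          linear_scale[OF linear_D(2)[OF x]] del: inner_Pair scaleR_Pair) (simp add: algebra_simps)
    then show "snd (N m (c *\<^sub>R v)) = snd (c *\<^sub>R N m v)" using vector_eq_rdot by blast
  qed
qed

lemma smooth_N: "smooth_on J (\<lambda>m. N m v)"
  unfolding N_def
  by (intro smooth_on_Pair open_J smooth_T_fst smooth_on_vec_lambda smooth_on_add smooth_on_inner
      smooth_on_const smooth_on_diff smooth_D_fst smooth_momentum)

lemma smooth_F: "smooth_on J (F a)"
proof (induction a)
  case 0
  have "smooth_on J (\<lambda>m. ((1 :: real, \<chi> i. pd_P i H m), - (\<chi> i. pd_Q i H m)))"
    unfolding pd_P_def pd_Q_def
    by (intro smooth_on_Pair open_J smooth_on_const smooth_on_minus smooth_on_vec_lambda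
        smooth_on_der smooth_H)
  then show ?case
    by (rule smooth_on_cong[OF open_J, rotated]) (simp add: F_0 ham_field_eq)
next
  case (Suc a)
  have "smooth_on J (\<lambda>m. N m (F a m))"
    by (rule smooth_on_family_apply[OF open_J linear_N smooth_N Suc])
  then show ?case
    by (rule smooth_on_cong[OF open_J, rotated]) (simp add: F_Suc)
qed

end

section \<open>The distribution\<close>

locale independent_chart = hamiltonian_chart S R h
  for S :: "'n::finite base set" and R h +
  assumes indep: "m \<in> J \<Longrightarrow> inj_on (iterate_field R h m) {..CARD('n)} \<and>
    independent (iterate_field R h m ` {..CARD('n)})"
begin

section \<open>The Lagrangian property\<close>

lemma dform_hlift_ham_distr:
  assumes m: "m \<in> J" and u: "\<And>a. dform hlift m u (F a m) = 0" and v: "v \<in> ham_distr R h m"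
  shows "dform hlift m u v = 0"
  using v unfolding ham_distr_def
  by (rule real_vector.linear_eq_0_on_span[OF linear_dform(4)[OF m], rotated]) (use u in auto)

lemma isotropic:
  assumes m: "m \<in> J" and u: "u \<in> ham_distr R h m" and v: "v \<in> ham_distr R h m"
  shows "dform hlift m u v = 0"
  using dform_hlift_ham_distr[OF m _ v] dform_hlift_ham_distr[OF m _ u] dform_hlift_F[OF m]
    dform_antisym by (metis neg_equal_0_iff_equal)

text \<open>On the hyperplane \<open>dt = 0\<close>, of dimension \<open>2n\<close>, the form
  \<open>d\<^sub>0\<close> is the canonical symplectic form. The \<open>n\<close> independent fields
  of index \<open>1\<close> to \<open>n\<close> span an isotropic subspace of half that dimension,
  which is therefore its own complement there.\<close>

lemma lagrangian_subspace:
  assumes m: "m \<in> J" and w: "fst (fst w) = 0"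
    and orth: "\<And>a. a < CARD('n) \<Longrightarrow> dform poincare_cartan m w (F (Suc a) m) = 0"
  shows "w \<in> span ((\<lambda>a. F (Suc a) m) ` {..<CARD('n)})"
proof -
  let ?n = "CARD('n)"
  let ?I = "(\<lambda>a. F (Suc a) m) ` {..<?n}"
  define V where "V = {v :: 'n jet. fst (fst v) = 0}"
  \<comment> \<open>Represents \<open>d\<^sub>0\<close> on \<open>V\<close> through the inner
    product. The time component is kept so that the map is injective on the whole space.\<close>
  define \<omega> :: "'n jet \<Rightarrow> 'n jet" where "\<omega> v = ((fst (fst v), - snd v), snd (fst v))" for v
  have V_eq: "V = {v. ((1, 0), 0) \<bullet> v = 0}" by (auto simp: V_def inner_prod_def)
  have dimV: "dim V = 2 * ?n"
    unfolding V_eq by (subst dim_hyperplane) (auto simp: DIM_prod zero_prod_def)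
  have V: "subspace V" unfolding V_eq by (rule subspace_hyperplane)
  have lin: "linear \<omega>" by (rule linearI) (auto simp: \<omega>_def)
  have inj: "inj \<omega>" by (rule injI) (auto simp: \<omega>_def prod_eq_iff)
  have pc: "dform poincare_cartan m u v = u \<bullet> \<omega> v" if "u \<in> V" "v \<in> V" for u v
    using that by (simp add: V_def dform_poincare_cartan[OF m] \<omega>_def inner_prod_def inner_commute)
  have IV: "?I \<subseteq> V" by (auto simp: V_def fst_fst_F[OF m])
  then have LV: "span ?I \<subseteq> V" using V by (rule span_minimal)
  have \<omega>V: "\<omega> ` V \<subseteq> V" by (auto simp: V_def \<omega>_def)
  have "Suc ` {..<?n} \<subseteq> {..?n}" by auto
  moreover have "?I = iterate_field R h m ` (Suc ` {..<?n})" by (simp add: image_image)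
  ultimately have "independent ?I" "card ?I = ?n"
    using indep[OF m] independent_mono[of "iterate_field R h m ` {..?n}" ?I]
      card_image[OF inj_on_subset, of "iterate_field R h m" "{..?n}" "Suc ` {..<?n}"]
    by (auto simp: card_image)
  then have dimL: "dim (span ?I) = ?n" by (simp add: dim_eq_card_independent)
  \<comment> \<open>The symplectic complement of the span within \<open>V\<close>; injectivity of
    \<open>\<omega>\<close> gives it dimension \<open>2n - n\<close>.\<close>
  define Z where "Z = {y \<in> V. \<forall>x \<in> \<omega> ` span ?I. orthogonal x y}"
  have "dim Z + dim (\<omega> ` span ?I) = dim V"
    unfolding Z_def using LV \<omega>V lin
    by (intro dim_subspace_orthogonal_to_vectors V linear_subspace_image) auto
  moreover have "dim (\<omega> ` span ?I) = ?n"
    using dim_image_eq[OF lin, of "span ?I"] inj dimL by (simp add: inj_on_subset)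
  ultimately have dimZ: "dim Z = ?n" using dimV by simp
  have Zsub: "subspace Z"
    unfolding Z_def using V
    by (auto simp: subspace_def orthogonal_def inner_add_right)
  have ZI: "u \<in> Z" if u: "u \<in> V" and z: "\<And>a. a < ?n \<Longrightarrow> dform poincare_cartan m u (F (Suc a) m) = 0" for u
  proof -
    have "u \<bullet> \<omega> y = 0" if "y \<in> span ?I" for y
    proof (rule real_vector.linear_eq_0_on_span[OF _ _ that])
      show "linear (\<lambda>y. u \<bullet> \<omega> y)"
        using linear_compose[OF lin bounded_linear.linear[OF bounded_linear_inner_right]] by (simp add: o_def)
      show "u \<bullet> \<omega> y = 0" if "y \<in> ?I" for y
      proof -
        obtain a where "a < ?n" "y = F (Suc a) m" using \<open>y \<in> ?I\<close> by blast
        moreover have "y \<in> V" using IV \<open>y \<in> ?I\<close> by blast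
        ultimately show ?thesis using z[of a] pc[OF u] by simp
      qed
    qed
    then show ?thesis using u by (auto simp: Z_def orthogonal_def inner_commute)
  qed
  have "?I \<subseteq> Z" using IV dform_pc_F[OF m] by (auto intro!: ZI)
  then have "span ?I \<subseteq> Z" using Zsub by (rule span_minimal)
  then have "span ?I = Z"
    using subspace_dim_equal[OF subspace_span Zsub, of ?I] dimL dimZ by simp
  moreover have "w \<in> Z" using w orth by (intro ZI) (auto simp: V_def)
  ultimately show ?thesis by simp
qed

lemma F_in_distr: "a \<le> CARD('n) \<Longrightarrow> F a m \<in> ham_distr R h m"
  unfolding ham_distr_def by (auto intro: span_base)

text \<open>Subtracting \<open>dt(w)\<close> times \<open>X\<^sub>h\<close> achieves
  \<open>dt = 0\<close> without changing the pairings with the generators under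
  \<open>d\<^sub>1\<close>, by isotropy; the shift to \<open>d\<^sub>0\<close> then leads to
  \<open>lagrangian_subspace\<close>.\<close>

lemma orth_in_distr:
  assumes m: "m \<in> J" and w: "\<And>a. a \<le> CARD('n) \<Longrightarrow> dform hlift m w (F a m) = 0"
  shows "w \<in> ham_distr R h m"
proof -
  define w' where "w' = w - fst (fst w) *\<^sub>R F 0 m"
  have v: "fst (fst w') = 0" by (simp add: w'_def fst_fst_F[OF m])
  have "dform poincare_cartan m w' (F (Suc a) m) = 0" if "a < CARD('n)" for a
    using dform_F_shift(1)[OF m v, of a] w[of a] that dform_hlift_F[OF m, of 0 a]
      linear_diff[OF linear_dform(3)[OF m]] linear_scale[OF linear_dform(3)[OF m]]
    by (simp add: w'_def)
  from lagrangian_subspace[OF m v this]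
  have "w' \<in> span ((\<lambda>a. F (Suc a) m) ` {..<CARD('n)})" .
  moreover have "(\<lambda>a. F (Suc a) m) ` {..<CARD('n)} \<subseteq> ham_distr R h m"
    by (intro image_subsetI F_in_distr) simp
  ultimately have "w' \<in> ham_distr R h m"
    unfolding ham_distr_def using span_minimal[OF _ subspace_span] by blast
  moreover have "fst (fst w) *\<^sub>R F 0 m \<in> ham_distr R h m"
    using F_in_distr[of 0] by (simp add: ham_distr_def span_scale)
  ultimately have "w' + fst (fst w) *\<^sub>R F 0 m \<in> ham_distr R h m"
    unfolding ham_distr_def by (rule span_add)
  then show ?thesis by (simp add: w'_def)
qed

theorem lagrangian:
  assumes m: "m \<in> J"
  shows "orth_complement (omegaR R m) (ham_distr R h m) = ham_distr R h m"
  unfolding orth_complement_def omegaR_eq_dform[OF m]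
  using isotropic[OF m] orth_in_distr[OF m] F_in_distr by blast

section \<open>Involutivity and integrability\<close>

text \<open>Iterates of every order are orthogonal to the generators, hence caught by
  \<open>orth_in_distr\<close>. Unbounded indices are what the induction in
  \<open>cyclic_system_trivial\<close> runs over.\<close>

lemma F_in_distr_all: "m \<in> J \<Longrightarrow> F a m \<in> ham_distr R h m"
  by (rule orth_in_distr) (simp_all add: dform_hlift_F)

text \<open>\<open>dt\<close> takes a constant value on each field, so it annihilates their
  brackets. This makes the index shifts applicable to them.\<close>

lemma fst_fst_bracket:
  assumes m: "m \<in> J"
  shows "fst (fst (lie_bracket (F a) (F b) m)) = 0"
proof -
  have "fst (fst (der (F a) m w)) = 0" for a w
  proof -
    have "((\<lambda>m. fst (fst (F a m))) has_derivative (\<lambda>w. fst (fst (der (F a) m w)))) (at m)"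
      by (intro has_derivative_fst smooth_on_has_derivative[OF smooth_F m])
    moreover have "((\<lambda>m. fst (fst (F a m))) has_derivative (\<lambda>w. 0)) (at m)"
      using has_derivative_cong_open[OF open_J m, of "\<lambda>m. fst (fst (F a m))" "\<lambda>_. if a = 0 then 1 else 0"]
        fst_fst_F by simp
    ultimately show ?thesis using has_derivative_unique by metis
  qed
  then show ?thesis by (simp add: lie_bracket_def)
qed

text \<open>The Leibniz rule for the Lie derivative; the term that differentiates the pairing of the
  two fields vanishes by isotropy.\<close>

lemma lie_deriv2_F:
  assumes m: "m \<in> J"
  shows "lie_deriv2 (ham_field h) (omegaR R) m (F b m) (F l m)
    = dform hlift m (lie_bracket (F 0) (F l) m) (F b m) - dform hlift m (lie_bracket (F 0) (F b) m) (F l m)"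
proof -
  have X: "F 0 = ham_field h" by (simp add: F_0 fun_eq_iff)
  have "der (\<lambda>y. omegaR R y u v) m = der (\<lambda>y. dform hlift y u v) m" for u v
    by (rule der_cong_open[OF open_J m]) (simp add: omegaR_eq_dform)
  moreover have "der (\<lambda>y. dform hlift y (F b m) (F l m)) m (F 0 m) + dform hlift m (der (F b) m (F 0 m)) (F l m)
      + dform hlift m (F b m) (der (F l) m (F 0 m)) = 0"
    by (rule dform_vanishing_derivative[OF open_J m smooth_hlift smooth_F smooth_F dform_hlift_F])
  moreover have "dform hlift m (lie_bracket (F 0) V m) w
      = dform hlift m (der V m (F 0 m)) w - dform hlift m (der (F 0) m (V m)) w" for V w
    unfolding lie_bracket_def by (rule linear_diff[OF linear_dform(3)[OF m]])
  ultimately show ?thesis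
    using dform_antisym[of hlift m "F b m" "der (F l) m (F 0 m)"]
      dform_antisym[of hlift m "F b m" "der (F 0) m (F l m)"]
    by (simp add: lie_deriv2_def omegaR_eq_dform[OF m] X F_0)
qed

text \<open>The pairings of brackets under \<open>d\<^sub>0\<close> satisfy the hypotheses of
  \<open>cyclic_system_trivial\<close>: closedness of the three forms gives the cyclic relations for
  \<open>k = 0, 1, 2\<close>, and the Lie derivative gives \<open>first\<close>. The resulting
  orthogonality under \<open>d\<^sub>1\<close> puts the bracket into the distribution.\<close>

lemma bracket_in_distr:
  assumes m: "m \<in> J"
    and lie: "\<And>u v. u \<in> ham_distr R h m \<Longrightarrow> v \<in> ham_distr R h m \<Longrightarrow>
      lie_deriv2 (ham_field h) (omegaR R) m u v = 0"
  shows "lie_bracket (F a) (F b) m \<in> ham_distr R h m"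
proof -
  define B where "B a b l = dform poincare_cartan m (lie_bracket (F a) (F b) m) (F l m)" for a b l
  note cyc = dform_cyclic_bracket[OF open_J m]
  note shift = dform_F_shift[OF m fst_fst_bracket[OF m]]
  have "B a b l = 0" for a b l
  proof (rule cyclic_system_trivial)
    show "B a b l = - B b a l" for a b l
    proof -
      have "lie_bracket (F a) (F b) m = - lie_bracket (F b) (F a) m" by (simp add: lie_bracket_def)
      then show ?thesis using linear_neg[OF linear_dform(1)[OF m]] by (simp add: B_def)
    qed
    show "B a b 0 = 0" for a b by (simp add: B_def dform_pc_F0[OF m])
    show "B 0 b (Suc l) = B 0 l (Suc b)" for b l
      using lie_deriv2_F[OF m, of b l] lie[OF F_in_distr_all[OF m] F_in_distr_all[OF m], of b l]
      by (simp add: B_def shift)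
    fix a b l k :: nat assume "k \<le> 2"
    then consider "k = 0" | "k = 1" | "k = 2" by linarith
    then show "B a b (l + k) + B b l (a + k) + B l a (b + k) = 0"
    proof cases
      case 1
      then show ?thesis
        using cyc[OF smooth_poincare_cartan smooth_F smooth_F smooth_F, of a b l] dform_pc_F
        by (simp add: B_def)
    next
      case 2
      then show ?thesis
        using cyc[OF smooth_hlift smooth_F smooth_F smooth_F, of a b l] dform_hlift_F
        by (simp add: B_def shift)
    next
      case 3
      then show ?thesis
        using cyc[OF R2.smooth_hlift smooth_F smooth_F smooth_F, of a b l] dform_square_F
        by (simp add: B_def shift)
    qed
  qed
  then show ?thesis
    by (intro orth_in_distr[OF m]) (simp add: shift B_def)
qed

text \<open>\<open>'n base\<close> has dimension \<open>n + 1\<close>, the number of generating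
  fields, so a bijection from its basis to the indices packages them as the operator-valued frame
  that \<open>frobenius\<close> expects.\<close>

lemma ham_distr_smooth_frame:
  obtains E :: "'n jet \<Rightarrow> 'n base \<Rightarrow>\<^sub>L 'n jet" and \<beta> where
    "\<And>m c. E m c = (\<Sum>b\<in>Basis. (c \<bullet> b) *\<^sub>R F (\<beta> b) m)" "smooth_on J E"
    "\<And>m. range (blinfun_apply (E m)) = ham_distr R h m"
    "\<And>m. m \<in> J \<Longrightarrow> inj (blinfun_apply (E m))"
proof -
  have "card (Basis :: 'n base set) = card {..CARD('n)}" by (simp add: DIM_prod)
  then obtain \<beta> where \<beta>: "bij_betw \<beta> (Basis :: 'n base set) {..CARD('n)}"
    using finite_same_card_bij[OF finite_Basis finite_atMost] by blast
  define E :: "'n jet \<Rightarrow> 'n base \<Rightarrow>\<^sub>L 'n jet" where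
    "E m = (\<Sum>b\<in>Basis. blinfun_scaleR_left (F (\<beta> b) m) o\<^sub>L blinfun_inner_left b)" for m
  have ap: "E m c = (\<Sum>b\<in>Basis. (c \<bullet> b) *\<^sub>R F (\<beta> b) m)" for m c
    by (simp add: E_def blinfun.sum_left blinfun_inner_left.rep_eq)
  have bl: "bounded_linear (\<lambda>y :: 'n jet. blinfun_scaleR_left y o\<^sub>L blinfun_inner_left (b :: 'n base))" for b
    by (rule bounded_linear_compose[OF bounded_bilinear.bounded_linear_left[OF bounded_bilinear_blinfun_compose]
          bounded_linear_blinfun_scaleR_left])
  have sm: "smooth_on J E"
    unfolding E_def[abs_def] by (intro smooth_on_sum smooth_on_bounded_linear[OF bl] open_J smooth_F)
  have lin: "linear (blinfun_apply (E m))" for m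
    by (rule bounded_linear.linear[OF blinfun.bounded_linear_right])
  have Eb: "E m b = F (\<beta> b) m" if "b \<in> Basis" for m b
  proof -
    have "E m b = (\<Sum>c\<in>Basis. if b = c then F (\<beta> c) m else 0)"
      unfolding ap using that by (intro sum.cong) (auto simp: inner_Basis)
    then show ?thesis using that by simp
  qed
  have im: "blinfun_apply (E m) ` Basis = iterate_field R h m ` {..CARD('n)}" for m
  proof -
    have "blinfun_apply (E m) ` Basis = iterate_field R h m ` (\<beta> ` Basis)" by (simp add: image_image Eb)
    then show ?thesis using \<beta> by (simp add: bij_betw_def)
  qed
  have rg: "range (blinfun_apply (E m)) = ham_distr R h m" for m
    using linear_span_image[OF lin, of m Basis] by (simp add: im ham_distr_def)
  have inj: "inj (blinfun_apply (E m))" if m: "m \<in> J" for m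
  proof -
    have "inj_on (iterate_field R h m \<circ> \<beta>) Basis"
      using \<beta> indep[OF m] by (intro comp_inj_on) (auto simp: bij_betw_def)
    then have "inj_on (blinfun_apply (E m)) Basis"
      using Eb by (simp add: inj_on_def)
    moreover have "independent (blinfun_apply (E m) ` Basis)" using indep[OF m] by (simp add: im)
    ultimately have "inj_on (blinfun_apply (E m)) (span Basis)"
      by (intro linear_inj_on_span_independent_image[OF lin])
    then show ?thesis by simp
  qed
  show ?thesis by (rule that[OF ap sm rg inj])
qed

theorem integrable:
  assumes lie: "\<And>m u v. m \<in> J \<Longrightarrow> u \<in> ham_distr R h m \<Longrightarrow> v \<in> ham_distr R h m \<Longrightarrow>
      lie_deriv2 (ham_field h) (omegaR R) m u v = 0"
    and m0: "m0 \<in> J"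
  shows "\<exists>(W :: 'n base set) f. integral_submanifold J (ham_distr R h) W f \<and> m0 \<in> f ` W"
proof -
  obtain E :: "'n jet \<Rightarrow> 'n base \<Rightarrow>\<^sub>L 'n jet" and \<beta> where
    ap: "\<And>m c. E m c = (\<Sum>b\<in>Basis. (c \<bullet> b) *\<^sub>R F (\<beta> b) m)" and sm: "smooth_on J E"
    and rg: "\<And>m. range (blinfun_apply (E m)) = ham_distr R h m"
    and inj: "\<And>m. m \<in> J \<Longrightarrow> inj (blinfun_apply (E m))"
    by (rule ham_distr_smooth_frame) (rule that)
  have "der E m (E m c) d - der E m (E m d) c \<in> range (blinfun_apply (E m))" if m: "m \<in> J" for m c d
  proof -
    have dE: "der E m w c = (\<Sum>b\<in>Basis. (c \<bullet> b) *\<^sub>R der (F (\<beta> b)) m w)" for w c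
    proof -
      have 1: "((\<lambda>y. E y c) has_derivative (\<lambda>w. der E m w c)) (at m)"
        by (rule bounded_linear.has_derivative[OF blinfun.bounded_linear_left smooth_on_has_derivative[OF sm m]])
      have 2: "((\<lambda>y. E y c) has_derivative (\<lambda>w. \<Sum>b\<in>Basis. (c \<bullet> b) *\<^sub>R der (F (\<beta> b)) m w)) (at m)"
        unfolding ap by (intro has_derivative_sum has_derivative_scaleR_right smooth_on_has_derivative[OF smooth_F m])
      show ?thesis using fun_cong[OF has_derivative_unique[OF 1 2], of w] .
    qed
    have lin: "linear (der (F k) m)" for k
      by (rule linear_der[OF smooth_on_differentiable[OF smooth_F m]])
    \<comment> \<open>Since \<open>c\<close> and \<open>d\<close> are constant, no derivatives of
      coefficients appear, and only brackets of the generating fields remain.\<close>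
    have "der E m (E m c) d - der E m (E m d) c
        = (\<Sum>i\<in>Basis. \<Sum>j\<in>Basis. ((c \<bullet> i) * (d \<bullet> j)) *\<^sub>R lie_bracket (F (\<beta> i)) (F (\<beta> j)) m)"
    proof -
      have dEE: "der E m (E m c) d = (\<Sum>j\<in>Basis. \<Sum>i\<in>Basis. ((c \<bullet> i) * (d \<bullet> j)) *\<^sub>R der (F (\<beta> j)) m (F (\<beta> i) m))"
        for c d
        by (simp add: dE ap linear_sum[OF lin] linear_scale[OF lin] scaleR_sum_right mult.commute)
      have "der E m (E m c) d = (\<Sum>i\<in>Basis. \<Sum>j\<in>Basis. ((c \<bullet> i) * (d \<bullet> j)) *\<^sub>R der (F (\<beta> j)) m (F (\<beta> i) m))"
        unfolding dEE by (rule sum.swap)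
      moreover have "der E m (E m d) c = (\<Sum>i\<in>Basis. \<Sum>j\<in>Basis. ((c \<bullet> i) * (d \<bullet> j)) *\<^sub>R der (F (\<beta> i)) m (F (\<beta> j) m))"
        unfolding dEE by (simp only: mult.commute)
      ultimately show ?thesis
        unfolding lie_bracket_def scaleR_diff_right sum_subtractf by (simp only:)
    qed
    then show ?thesis
      using bracket_in_distr[OF m lie[OF m]] unfolding rg
      by (simp add: ham_distr_def span_sum span_scale)
  qed
  from frobenius[OF open_J m0 sm inj[OF m0] this] show ?thesis by (simp add: rg)
qed

end

section \<open>Darboux-Nijenhuis coordinates\<close>

lemma axis_nth_mult: "axis j 1 $ i * (x :: real) = (if i = j then x else 0)"
  by (simp add: axis_def)

section \<open>Diagonal form of the lift and of the distribution\<close>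

locale darboux_nijenhuis_chart = independent_chart S R h
  for S :: "'n::finite base set" and R h +
  fixes ev :: "'n \<Rightarrow> real \<Rightarrow> real"
  assumes diagonal: "x \<in> S \<Longrightarrow> R x v = (0, \<chi> i. ev i (snd x $ i) * (snd v $ i))"
    and distinct: "x \<in> S \<Longrightarrow> diagonalizable_distinct (R x)"
begin

abbreviation ew :: "'n \<Rightarrow> 'n jet \<Rightarrow> real" where "ew i m \<equiv> ev i (snd (fst m) $ i)"

text \<open>By counting: every eigenvalue of \<open>R x\<close> is \<open>0\<close> or one of the
  \<open>n\<close> diagonal entries, so \<open>n + 1\<close> distinct eigenvalues leave no room for
  coincidences.\<close>

lemma eigenvalues:
  assumes x: "x \<in> S"
  shows "ev i (snd x $ i) = ev j (snd x $ j) \<Longrightarrow> i = j" "ev i (snd x $ i) \<noteq> 0"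
proof -
  let ?l = "\<lambda>i. ev i (snd x $ i)"
  obtain B \<mu> where B: "independent B" "span B = UNIV" "\<And>b. b \<in> B \<Longrightarrow> R x b = \<mu> b *\<^sub>R b" "inj_on \<mu> B"
    using distinct[OF x] unfolding diagonalizable_distinct_def by blast
  have "\<mu> b \<in> insert 0 (range ?l)" if b: "b \<in> B" for b
  proof (rule ccontr)
    assume n: "\<mu> b \<notin> insert 0 (range ?l)"
    have eq: "\<mu> b * fst b = 0" "\<mu> b * snd b $ i = ?l i * snd b $ i" for i
      using B(3)[OF b] unfolding diagonal[OF x] by (auto simp: prod_eq_iff vec_eq_iff)
    have "b = 0"
      using eq n by (auto simp: prod_eq_iff vec_eq_iff)
    then show False using B(1) b dependent_zero by blast
  qed
  then have sub: "\<mu> ` B \<subseteq> insert 0 (range ?l)" by blast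
  have "card B = DIM('n base)"
    using B(1,2) dim_eq_card_independent[OF B(1)] dim_span[of B] by simp
  then have "CARD('n) + 1 \<le> card (insert 0 (range ?l))"
    using card_mono[OF _ sub] card_image[OF B(4)] by (simp add: DIM_prod)
  moreover have "card (range ?l) \<le> CARD('n)" by (rule card_image_le) simp
  ultimately have "0 \<notin> range ?l" "card (range ?l) = CARD('n)"
    by (auto simp: card_insert_if split: if_splits)
  then have "inj ?l" "?l i \<noteq> 0"
    by (auto intro: eq_card_imp_inj_on)
  then show "?l i = ?l j \<Longrightarrow> i = j" "?l i \<noteq> 0"
    by (auto dest: injD)
qed

text \<open>Each eigenvalue depends on its own coordinate alone, so component \<open>i\<close> of
  \<open>D x u v\<close> is the derivative of \<open>ev i\<close> times the \<open>i\<close>-th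
  components of \<open>u\<close> and \<open>v\<close>. Differentiability of \<open>ev\<close> along
  the chart is read off from that of \<open>R\<close>.\<close>

lemma D_sym:
  assumes x: "x \<in> S"
  shows "D x u v = D x v u"
proof -
  let ?l = "\<lambda>i y. ev i (snd y $ i)"
  let ?d = "\<lambda>i u. snd (D x u (0, axis i 1)) $ i"
  have bl: "bounded_linear (\<lambda>w :: 'n base. snd w $ i)" for i
    by (rule bounded_linear_compose[OF bounded_linear_vec_nth bounded_linear_snd])
  have comp: "((\<lambda>y. snd (R y v) $ i) has_derivative (\<lambda>u. snd (D x u v) $ i)) (at x)" for v i
    unfolding D_def by (rule bounded_linear.has_derivative[OF bl smooth_on_has_derivative[OF smooth_T x]])
  have dl: "(?l i has_derivative ?d i) (at x)" for i
    using comp[of "(0, axis i 1)" i] has_derivative_cong_open[OF open_S x, of "?l i" "\<lambda>y. snd (R y (0, axis i 1)) $ i"]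
    by (simp add: diagonal)
  have "((\<lambda>y. snd (R y v) $ i) has_derivative (\<lambda>u. ?d i u * snd v $ i)) (at x)" for v i
    using has_derivative_mult_left[OF dl[of i], of "snd v $ i"]
      has_derivative_cong_open[OF open_S x, of "\<lambda>y. snd (R y v) $ i" "\<lambda>y. ?l i y * snd v $ i"]
    by (simp add: diagonal)
  then have Dv: "snd (D x u v) $ i = ?d i u * snd v $ i" for u v i
    using fun_cong[OF has_derivative_unique[OF comp]] by blast
  \<comment> \<open>Moving in a direction with zero \<open>i\<close>-th component leaves
    \<open>ev i\<close> unchanged.\<close>
  have van: "?d i w = 0" if w: "snd w $ i = 0" for i w
  proof -
    have "((\<lambda>s::real. x + s *\<^sub>R w) has_derivative (\<lambda>s. s *\<^sub>R w)) (at 0)"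
      by (auto intro!: derivative_eq_intros)
    moreover have "(?l i has_derivative ?d i) (at (x + 0 *\<^sub>R w))" using dl by simp
    ultimately have "((\<lambda>s. ?l i (x + s *\<^sub>R w)) has_derivative (\<lambda>s. ?d i (s *\<^sub>R w))) (at 0)"
      by (rule has_derivative_compose)
    moreover have "(\<lambda>s. ?l i (x + s *\<^sub>R w)) = (\<lambda>s. ?l i x)" using w by simp
    ultimately have "(\<lambda>s. ?d i (s *\<^sub>R w)) = (\<lambda>s. 0)"
      using has_derivative_unique[OF has_derivative_const] by metis
    from fun_cong[OF this, of 1] show ?thesis by simp
  qed
  have ld: "linear (?d i)" for i
    using has_derivative_bounded_linear[OF dl] by (rule bounded_linear.linear)
  have du: "?d i u = snd u $ i * ?d i (0, axis i 1)" for i u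
  proof -
    have "snd (u - (snd u $ i) *\<^sub>R (0, axis i 1)) $ i = 0" by (simp add: axis_def)
    then have "?d i (u - (snd u $ i) *\<^sub>R (0, axis i 1)) = 0" by (rule van)
    then show ?thesis
      unfolding linear_diff[OF ld[of i]] linear_scale[OF ld[of i]] by simp
  qed
  have "snd (D x u v) $ i = snd (D x v u) $ i" for i
    unfolding Dv[of u v i] Dv[of v u i] du[of u i] du[of v i] by (simp only: mult_ac)
  then show ?thesis by (simp add: prod_eq_iff vec_eq_iff fst_D[OF x])
qed

text \<open>Symmetry of \<open>D\<close> removes the curl term.\<close>

lemma N_diagonal:
  assumes m: "m \<in> J"
  shows "N m v = ((0, \<chi> i. ew i m * (snd (fst v) $ i)), \<chi> i. ew i m * (snd v $ i))"
proof -
  note x = fst_J(1)[OF m]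
  have "(\<chi> j. ew j m * axis i 1 $ j) = ew i m *\<^sub>R axis i 1" for i
    by (simp add: vec_eq_iff axis_def)
  then show ?thesis
    unfolding N_def D_sym[OF x, of "(0, axis _ 1)"] diagonal[OF x] by (simp add: inner_axis)
qed

lemma dform_hlift_diagonal:
  assumes m: "m \<in> J"
  shows "dform hlift m u v
    = (\<Sum>i\<in>UNIV. ew i m * (snd u $ i * snd (fst v) $ i - snd v $ i * snd (fst u) $ i))"
  using fst_J(1)[OF m]
  by (simp add: dform_hlift[OF m] D_sym[of _ "fst u" "fst v"] diagonal inner_vec_def sum_subtractf[symmetric]
      algebra_simps)

text \<open>The combination of the fields \<open>Z\<^sub>i\<close> with coefficients
  \<open>c\<close>; \<open>Z (axis i 1)\<close> is \<open>Z\<^sub>i\<close> itself.\<close>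

definition Z :: "real ^ 'n \<Rightarrow> 'n jet \<Rightarrow> 'n jet" where
  "Z c m = ((0, \<chi> i. c $ i * pd_P i H m), \<chi> i. - (c $ i * pd_Q i H m))"

definition et :: "'n jet" where "et = ((1, 0), 0)"

lemma linear_Z: "linear (\<lambda>c. Z c m)"
  by (rule linearI) (auto simp: Z_def vec_eq_iff algebra_simps)

lemma F_diagonal:
  assumes m: "m \<in> J"
  shows "F 0 m = et + Z 1 m" "F (Suc a) m = Z (\<chi> i. ew i m ^ Suc a) m"
proof -
  show F0: "F 0 m = et + Z 1 m"
    by (simp add: F_0 ham_field_eq[OF m] et_def Z_def vec_eq_iff)
  show "F (Suc a) m = Z (\<chi> i. ew i m ^ Suc a) m"
  proof (induction a)
    case 0
    show ?case
      unfolding F_Suc[OF m] F0 N_diagonal[OF m] by (simp add: Z_def et_def)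
  next
    case (Suc a)
    show ?case
      unfolding F_Suc[OF m, of "Suc a"] Suc N_diagonal[OF m] by (simp add: Z_def mult_ac)
  qed
qed

text \<open>The generators are \<open>et + Z 1\<close> and the combinations with coefficients
  \<open>\<lambda>\<^sub>i ^ k\<close>, \<open>k \<ge> 1\<close>; distinct nonzero eigenvalues
  separate the individual \<open>Z\<^sub>i\<close>.\<close>

lemma ham_distr_diagonal:
  assumes m: "m \<in> J"
  shows "ham_distr R h m = {s *\<^sub>R et + Z c m | s c. True}"
proof
  txt \<open>Instead of inverting a Vandermonde matrix, the factors \<open>\<lambda>\<^sub>i - \<lambda>\<^sub>j\<close> that annihilate the
    components \<open>i = j\<close> are multiplied in one at a time.\<close>
  have Zmem: "Z (\<chi> i. ew i m ^ Suc k * (\<Prod>j\<in>A. ew i m - ew j m)) m \<in> ham_distr R h m" for A k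
  proof (induction A arbitrary: k rule: infinite_finite_induct)
    case empty
    then show ?case using F_in_distr_all[OF m, of "Suc k"] by (simp add: F_diagonal(2)[OF m])
  next
    case (insert j A)
    have "Z (\<chi> i. ew i m ^ Suc k * (\<Prod>j\<in>insert j A. ew i m - ew j m)) m
      = Z (\<chi> i. ew i m ^ Suc (Suc k) * (\<Prod>j\<in>A. ew i m - ew j m)) m
        - ew j m *\<^sub>R Z (\<chi> i. ew i m ^ Suc k * (\<Prod>j\<in>A. ew i m - ew j m)) m"
      using insert.hyps by (simp add: Z_def vec_eq_iff algebra_simps)
    then show ?case
      using insert.IH[of "Suc k"] insert.IH[of k] by (simp add: ham_distr_def span_diff span_scale)
  qed auto
  have axis: "Z (axis i 1) m \<in> ham_distr R h m" for i
  proof -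
    \<comment> \<open>The coefficient that survives when the product omits only the factor of
      \<open>i\<close>; it is nonzero because the eigenvalues are nonzero and distinct.\<close>
    define p where "p = ew i m * (\<Prod>j\<in>-{i}. ew i m - ew j m)"
    have "p \<noteq> 0"
      using eigenvalues[OF fst_J(1)[OF m]] by (auto simp: p_def)
    then have "Z (axis i 1) m = inverse p *\<^sub>R Z (p *\<^sub>R axis i 1) m"
      by (simp add: linear_scale[OF linear_Z])
    moreover have "(\<chi> k. ew k m ^ Suc 0 * (\<Prod>j\<in>-{i}. ew k m - ew j m)) = p *\<^sub>R axis i 1"
      by (auto simp: vec_eq_iff axis_def p_def)
    ultimately show ?thesis
      using Zmem[of 0 "-{i}"] by (simp only: ham_distr_def span_scale)
  qed
  have Zin: "Z c m \<in> ham_distr R h m" for c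
  proof -
    have "c = (\<Sum>i\<in>UNIV. (c $ i) *\<^sub>R axis i 1)"
      by (simp add: vec_eq_iff axis_def if_distrib cong: if_cong)
    then have "Z c m = (\<Sum>i\<in>UNIV. (c $ i) *\<^sub>R Z (axis i 1) m)"
      by (metis (no_types, lifting) linear_sum[OF linear_Z] linear_scale[OF linear_Z] sum.cong)
    then show ?thesis using axis by (simp add: ham_distr_def span_sum span_scale)
  qed
  have "F 0 m - Z 1 m \<in> ham_distr R h m"
    using Zin[of 1] F_in_distr_all[OF m, of 0] unfolding ham_distr_def by (intro span_diff)
  then have et: "et \<in> ham_distr R h m" by (simp add: F_diagonal(1)[OF m])
  show "{s *\<^sub>R et + Z c m | s c. True} \<subseteq> ham_distr R h m"
    using et Zin by (auto simp: ham_distr_def span_add span_scale)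
  have "subspace {s *\<^sub>R et + Z c m | s c. True}"
  proof -
    have "s *\<^sub>R et + Z c m + (s' *\<^sub>R et + Z c' m) = (s + s') *\<^sub>R et + Z (c + c') m"
      "k *\<^sub>R (s *\<^sub>R et + Z c m) = (k * s) *\<^sub>R et + Z (k *\<^sub>R c) m" "0 = 0 *\<^sub>R et + Z 0 m" for s s' c c' k
      by (simp_all add: linear_add[OF linear_Z] linear_scale[OF linear_Z] linear_0[OF linear_Z] algebra_simps)
    then show ?thesis unfolding subspace_def by blast
  qed
  moreover have "F a m \<in> {s *\<^sub>R et + Z c m | s c. True}" for a
  proof (cases a)
    case 0
    then have "F a m = 1 *\<^sub>R et + Z 1 m" by (simp add: F_diagonal(1)[OF m])
    then show ?thesis by blast
  next
    case (Suc a')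
    then have "F a m = 0 *\<^sub>R et + Z (\<chi> i. ew i m ^ Suc a') m" by (simp add: F_diagonal(2)[OF m])
    then show ?thesis by blast
  qed
  ultimately show "ham_distr R h m \<subseteq> {s *\<^sub>R et + Z c m | s c. True}"
    unfolding ham_distr_def by (intro span_minimal) auto
qed

lemma in_ham_distr: "m \<in> J \<Longrightarrow> s *\<^sub>R et + Z c m \<in> ham_distr R h m"
  by (auto simp: ham_distr_diagonal)

section \<open>The Lie derivative and Forbat's conditions\<close>

text \<open>Where \<open>pd_P i H\<close> is nonzero, this is its square times the differential of
  the ratio \<open>pd_Q i H / pd_P i H\<close>. Both kinds of Forbat expressions are its values, on
  \<open>Z (axis j 1)\<close> and on \<open>et\<close>.\<close>

definition G :: "'n \<Rightarrow> 'n jet \<Rightarrow> 'n jet \<Rightarrow> real" where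
  "G i m u = pd_P i H m * der (pd_Q i H) m u - pd_Q i H m * der (pd_P i H) m u"

lemma smooth_pd: "smooth_on J (pd_t H)" "smooth_on J (pd_Q i H)" "smooth_on J (pd_P i H)"
  unfolding pd_t_def[abs_def] pd_Q_def[abs_def] pd_P_def[abs_def] by (intro smooth_on_der smooth_H)+

lemma linear_G:
  assumes m: "m \<in> J"
  shows "linear (G i m)"
proof -
  note l = linear_der[OF smooth_on_differentiable[OF smooth_pd(2) m]]
    linear_der[OF smooth_on_differentiable[OF smooth_pd(3) m]]
  show ?thesis
    by (rule linearI)
      (simp_all add: G_def linear_add[OF l(1)] linear_add[OF l(2)] linear_scale[OF l(1)]
        linear_scale[OF l(2)] algebra_simps)
qed

lemma lie_deriv2_diagonal:
  assumes m: "m \<in> J"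
  shows "lie_deriv2 (ham_field h) (omegaR R) m (s *\<^sub>R et + Z c m) (s' *\<^sub>R et + Z c' m)
    = (\<Sum>i\<in>UNIV. ew i m * (c $ i * G i m (s' *\<^sub>R et + Z c' m) - c' $ i * G i m (s *\<^sub>R et + Z c m)))"
proof -
  let ?u = "s *\<^sub>R et + Z c m" and ?v = "s' *\<^sub>R et + Z c' m"
  let ?b = "\<lambda>i u v. snd u $ i * snd (fst v) $ i - snd v $ i * snd (fst u) $ i :: real"
  \<comment> \<open>\<open>?u\<close> and \<open>?v\<close> are frozen at \<open>m\<close>. Their
    \<open>i\<close>-th components are multiples of one fixed pair, so every summand of the form
    cancels at each \<open>y\<close>, and the differentiated term of \<open>lie_deriv2\<close> is
    zero.\<close>
  have "der (\<lambda>y. omegaR R y ?u ?v) m = der (\<lambda>y. 0) m"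
  proof (rule der_cong_open[OF open_J m])
    fix y assume "y \<in> J"
    then show "omegaR R y ?u ?v = 0"
      by (simp add: omegaR_eq_dform dform_hlift_diagonal Z_def et_def)
  qed
  then have 1: "der (\<lambda>y. omegaR R y ?u ?v) m w = 0" for w by simp
  have X: "snd (fst (der (ham_field h) m w)) $ i = der (pd_P i H) m w"
    "snd (der (ham_field h) m w) $ i = - der (pd_Q i H) m w" for i w
  proof -
    have X: "(ham_field h has_derivative der (ham_field h) m) (at m)"
      using smooth_on_has_derivative[OF smooth_F m, of 0] by (simp add: F_0)
    have b: "bounded_linear (\<lambda>w :: 'n jet. snd (fst w) $ i)" "bounded_linear (\<lambda>w :: 'n jet. snd w $ i)"
      by (intro bounded_linear_compose[OF bounded_linear_vec_nth]
          bounded_linear_compose[OF bounded_linear_snd] bounded_linear_fst bounded_linear_snd)+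
    have "((\<lambda>y. snd (fst (ham_field h y)) $ i) has_derivative der (pd_P i H) m) (at m)"
      using smooth_on_has_derivative[OF smooth_pd(3) m, of i] ham_field_eq
        has_derivative_cong_open[OF open_J m, of "\<lambda>y. snd (fst (ham_field h y)) $ i" "pd_P i H"] by simp
    from has_derivative_unique[OF this bounded_linear.has_derivative[OF b(1) X]]
    show "snd (fst (der (ham_field h) m w)) $ i = der (pd_P i H) m w" by metis
    have "((\<lambda>y. snd (ham_field h y) $ i) has_derivative (\<lambda>w. - der (pd_Q i H) m w)) (at m)"
      using has_derivative_minus[OF smooth_on_has_derivative[OF smooth_pd(2) m, of i]] ham_field_eq
        has_derivative_cong_open[OF open_J m, of "\<lambda>y. snd (ham_field h y) $ i" "\<lambda>y. - pd_Q i H y"] by simp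
    from has_derivative_unique[OF this bounded_linear.has_derivative[OF b(2) X]]
    show "snd (der (ham_field h) m w) $ i = - der (pd_Q i H) m w" by metis
  qed
  have comp: "snd (fst (s *\<^sub>R et + Z c m)) $ i = c $ i * pd_P i H m"
    "snd (s *\<^sub>R et + Z c m) $ i = - (c $ i * pd_Q i H m)" for s c i
    by (simp_all add: et_def Z_def)
  show ?thesis
    unfolding lie_deriv2_def 1 omegaR_eq_dform[OF m] dform_hlift_diagonal[OF m] X comp add_0_left
      sum.distrib[symmetric]
    by (intro sum.cong refl) (simp add: G_def algebra_simps)
qed

lemma pd_commute:
  assumes m: "m \<in> J"
  shows "pd_Q i (pd_Q j H) m = pd_Q j (pd_Q i H) m" "pd_P i (pd_P j H) m = pd_P j (pd_P i H) m"
    "pd_Q i (pd_P j H) m = pd_P j (pd_Q i H) m"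
    "der (pd_Q i H) m et = pd_Q i (pd_t H) m" "der (pd_P i H) m et = pd_P i (pd_t H) m"
proof -
  have *: "der (\<lambda>y. der H y u) m v = der (\<lambda>y. der H y v) m u" for u v
    using smooth_H by (intro der_der_commute[OF open_J m]) (simp add: smooth_on_def)
  show "pd_Q i (pd_Q j H) m = pd_Q j (pd_Q i H) m" "pd_P i (pd_P j H) m = pd_P j (pd_P i H) m"
    "pd_Q i (pd_P j H) m = pd_P j (pd_Q i H) m"
    "der (pd_Q i H) m et = pd_Q i (pd_t H) m" "der (pd_P i H) m et = pd_P i (pd_t H) m"
    unfolding pd_Q_def pd_P_def pd_t_def et_def by (rule *)+
qed

lemma G_et:
  assumes m: "m \<in> J"
  shows "G i m et = pd_P i H m * pd_Q i (pd_t H) m - pd_Q i H m * pd_P i (pd_t H) m"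
  by (simp add: G_def pd_commute[OF m])

lemma G_Z:
  assumes m: "m \<in> J"
  shows "G i m (Z (axis j 1) m)
    = pd_P i H m * (pd_Q i (pd_Q j H) m * pd_P j H m - pd_Q i (pd_P j H) m * pd_Q j H m)
      - pd_Q i H m * (pd_P i (pd_Q j H) m * pd_P j H m - pd_P i (pd_P j H) m * pd_Q j H m)"
proof -
  have "der f m (Z (axis j 1) m) = pd_P j H m * pd_Q j f m - pd_Q j H m * pd_P j f m"
    if "f differentiable (at m)" for f :: "'n jet \<Rightarrow> real"
    unfolding der_jet_expand[OF that]
    by (simp add: Z_def inner_vec_def axis_nth_mult sum_negf if_distrib[of "(*) _"] if_distrib[of uminus]
        cong: if_cong)
  from this[OF smooth_on_differentiable[OF smooth_pd(2) m]] this[OF smooth_on_differentiable[OF smooth_pd(3) m]]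
  show ?thesis
    by (simp add: G_def pd_commute(1)[OF m, of j i] pd_commute(2)[OF m, of j i]
        pd_commute(3)[OF m, of i j, symmetric] pd_commute(3)[OF m, of j i] right_diff_distrib)
qed

text \<open>Second partial derivatives commute. The symmetry merges the two terms of the Lie
  derivative on \<open>Z\<^sub>i\<close>, \<open>Z\<^sub>j\<close> into one with the factor
  \<open>\<lambda>\<^sub>i - \<lambda>\<^sub>j\<close>.\<close>

lemma G_Z_sym: "m \<in> J \<Longrightarrow> G i m (Z (axis j 1) m) = G j m (Z (axis i 1) m)"
  by (simp add: G_Z pd_commute(1)[of m j i] pd_commute(2)[of m j i] pd_commute(3)[of m i j]
      pd_commute(3)[of m j i] algebra_simps)

lemma forbat_iff_G:
  "forbat_conditions J H \<longleftrightarrow>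
    (\<forall>m\<in>J. (\<forall>i j. i \<noteq> j \<longrightarrow> G i m (Z (axis j 1) m) = 0) \<and> (\<forall>i. G i m et = 0))"
  unfolding forbat_conditions_def by (simp add: G_Z G_et cong: ball_cong)

theorem lie_condition_iff_forbat:
  "(\<forall>m\<in>J. \<forall>u\<in>ham_distr R h m. \<forall>v\<in>ham_distr R h m. lie_deriv2 (ham_field h) (omegaR R) m u v = 0)
    \<longleftrightarrow> forbat_conditions J H"
proof
  assume L: "\<forall>m\<in>J. \<forall>u\<in>ham_distr R h m. \<forall>v\<in>ham_distr R h m. lie_deriv2 (ham_field h) (omegaR R) m u v = 0"
  have "G i m (Z (axis j 1) m) = 0" if m: "m \<in> J" and ij: "i \<noteq> j" for i j m
  proof -
    have "0 = lie_deriv2 (ham_field h) (omegaR R) m (0 *\<^sub>R et + Z (axis i 1) m) (0 *\<^sub>R et + Z (axis j 1) m)"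
      using L m in_ham_distr by (metis (no_types))
    also have "\<dots> = ew i m * G i m (Z (axis j 1) m) - ew j m * G j m (Z (axis i 1) m)"
      unfolding lie_deriv2_diagonal[OF m]
      by (simp add: axis_nth_mult right_diff_distrib sum_subtractf if_distrib[of "(*) _"] cong: if_cong)
    also have "\<dots> = (ew i m - ew j m) * G i m (Z (axis j 1) m)"
      unfolding G_Z_sym[OF m, of j i] by (simp add: algebra_simps)
    finally show ?thesis
      using eigenvalues(1)[OF fst_J(1)[OF m]] ij by auto
  qed
  moreover have "G i m et = 0" if m: "m \<in> J" for i m
  proof -
    have "0 = lie_deriv2 (ham_field h) (omegaR R) m (0 *\<^sub>R et + Z (axis i 1) m) (1 *\<^sub>R et + Z 0 m)"
      using L m in_ham_distr by (metis (no_types))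
    also have "\<dots> = ew i m * G i m et"
      unfolding lie_deriv2_diagonal[OF m] using linear_0[OF linear_Z]
      by (simp add: axis_nth_mult if_distrib[of "(*) _"] cong: if_cong)
    finally show ?thesis using eigenvalues(2)[OF fst_J(1)[OF m]] by simp
  qed
  ultimately show "forbat_conditions J H" unfolding forbat_iff_G by blast
next
  assume forbat: "forbat_conditions J H"
  show "\<forall>m\<in>J. \<forall>u\<in>ham_distr R h m. \<forall>v\<in>ham_distr R h m. lie_deriv2 (ham_field h) (omegaR R) m u v = 0"
  proof (intro ballI)
    fix m u v assume m: "m \<in> J" and uv: "u \<in> ham_distr R h m" "v \<in> ham_distr R h m"
    then obtain s c s' c' where u: "u = s *\<^sub>R et + Z c m" and v: "v = s' *\<^sub>R et + Z c' m"
      unfolding ham_distr_diagonal[OF m] by blast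
    \<comment> \<open>Only the diagonal value of \<open>G i\<close> survives. It may be nonzero, but
      it enters the sum symmetrically in \<open>c\<close> and \<open>c'\<close> and so
      cancels.\<close>
    have "G i m (s *\<^sub>R et + Z c m) = c $ i * G i m (Z (axis i 1) m)" for s c i
    proof -
      have "c = (\<Sum>j\<in>UNIV. (c $ j) *\<^sub>R axis j 1)"
        by (simp add: vec_eq_iff axis_def if_distrib cong: if_cong)
      then have "Z c m = (\<Sum>j\<in>UNIV. (c $ j) *\<^sub>R Z (axis j 1) m)"
        by (metis (no_types, lifting) linear_sum[OF linear_Z] linear_scale[OF linear_Z] sum.cong)
      then have "G i m (s *\<^sub>R et + Z c m) = s * G i m et + (\<Sum>j\<in>UNIV. c $ j * G i m (Z (axis j 1) m))"
        by (simp add: linear_add[OF linear_G[OF m]] linear_scale[OF linear_G[OF m]] linear_sum[OF linear_G[OF m]])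
      also have "(\<Sum>j\<in>UNIV. c $ j * G i m (Z (axis j 1) m)) = (\<Sum>j\<in>UNIV. if i = j then c $ j * G i m (Z (axis j 1) m) else 0)"
        using forbat m unfolding forbat_iff_G by (intro sum.cong) auto
      also have "\<dots> = c $ i * G i m (Z (axis i 1) m)" by simp
      finally show ?thesis using forbat m unfolding forbat_iff_G by simp
    qed
    then show "lie_deriv2 (ham_field h) (omegaR R) m u v = 0"
      unfolding u v lie_deriv2_diagonal[OF m] by simp
  qed
qed

end

section \<open>Assembly over the charts of the bundle\<close>

theorem theorem7:
  fixes \<tau> :: "'e::{t2_space, second_countable_topology} \<Rightarrow> real"
    and A :: "('e, 'n::finite) chart set"
    and h :: "('e, 'n) chart \<Rightarrow> 'n jet \<Rightarrow> 'n cot"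
    and R :: "('e, 'n) chart \<Rightarrow> 'n base \<Rightarrow> 'n base \<Rightarrow> 'n base"
  assumes bundle_E: "bundle_over_R \<tau> A"
    and section_h: "section_of_rho A h"
    and tensor: "tensor11_field A R"
    and R_dt: "\<forall>c\<in>A. \<forall>x\<in>cimg c. adjoint (R c x) dt = 0"
    and torsion: "\<forall>c\<in>A. \<forall>X Y. smooth_on (cimg c) X \<longrightarrow> smooth_on (cimg c) Y \<longrightarrow>
          (\<forall>x\<in>cimg c. nijenhuis (R c) X Y x = 0)"
    and diagonalizable: "\<forall>c\<in>A. \<forall>x\<in>cimg c. diagonalizable_distinct (R c x)"
    and indep: "\<forall>c\<in>A. \<forall>m\<in>jdom c. inj_on (iterate_field (R c) (h c) m) {..CARD('n)} \<and>
          independent (iterate_field (R c) (h c) m ` {..CARD('n)})"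
  shows "(\<forall>c\<in>A. \<forall>m\<in>jdom c.
            orth_complement (omegaR (R c) m) (ham_distr (R c) (h c) m) = ham_distr (R c) (h c) m)
     \<and> ((\<forall>c\<in>A. lie_condition c (R c) (h c)) \<longrightarrow>
          (\<forall>c\<in>A. \<forall>m\<in>jdom c. \<exists>(W :: 'n base set) f.
             integral_submanifold (jdom c) (ham_distr (R c) (h c)) W f \<and> m \<in> f ` W))
     \<and> (\<forall>c\<in>A. darboux_nijenhuis c (R c) \<longrightarrow>
          (lie_condition c (R c) (h c) \<longleftrightarrow>
           forbat_conditions (jdom c) (hamiltonian (h c))))"
proof -
  \<comment> \<open>Every chart of the atlas is an instance of the locale, over the domain
    \<open>jdom c\<close>; for the torsion, constant fields are inserted as smooth fields.\<close>
  have chart: "independent_chart (cimg c) (R c) (h c)" and J: "endo_field.J (cimg c) = jdom c"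
    if c: "c \<in> A" for c
  proof -
    have "open (cimg c)"
      using bundle_E c by (auto simp: bundle_over_R_def adapted_chart_def)
    then have endo: "endo_field (cimg c) (R c)"
      using tensor c by (auto simp: endo_field_def tensor11_field_def)
    show J: "endo_field.J (cimg c) = jdom c"
      by (simp add: endo_field.J_def[OF endo] jdom_def)
    have "hamiltonian_chart (cimg c) (R c) (h c)"
      using endo section_h R_dt torsion c
      by (auto simp: hamiltonian_chart_def hamiltonian_chart_axioms_def J section_of_rho_def
          smooth_on_const)
    then show "independent_chart (cimg c) (R c) (h c)"
      using indep c by (auto simp: independent_chart_def independent_chart_axioms_def J)
  qed
  show ?thesis
  proof (intro conjI impI ballI)
    fix c m assume "c \<in> A" "m \<in> jdom c"
    then show "orth_complement (omegaR (R c) m) (ham_distr (R c) (h c) m) = ham_distr (R c) (h c) m"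
      using independent_chart.lagrangian[OF chart] J by blast
  next
    fix c m assume lie: "\<forall>c\<in>A. lie_condition c (R c) (h c)" and c: "c \<in> A" and m: "m \<in> jdom c"
    show "\<exists>(W :: 'n base set) f. integral_submanifold (jdom c) (ham_distr (R c) (h c)) W f \<and> m \<in> f ` W"
      using independent_chart.integrable[OF chart[OF c], of m] lie c m
      by (simp add: J[OF c] lie_condition_def)
  next
    fix c assume c: "c \<in> A" and "darboux_nijenhuis c (R c)"
    then obtain ev where ev: "\<And>x v. x \<in> cimg c \<Longrightarrow> R c x v = (0, \<chi> i. ev i (snd x $ i) * (snd v $ i))"
      by (auto simp: darboux_nijenhuis_def)
    have "darboux_nijenhuis_chart (cimg c) (R c) (h c) ev"
      using chart[OF c] ev diagonalizable c
      by (auto simp: darboux_nijenhuis_chart_def darboux_nijenhuis_chart_axioms_def)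
    from darboux_nijenhuis_chart.lie_condition_iff_forbat[OF this]
    show "lie_condition c (R c) (h c) \<longleftrightarrow> forbat_conditions (jdom c) (hamiltonian (h c))"
      by (simp add: J[OF c] lie_condition_def)
  qed
qed

end
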